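(* For any left cancellative semigroup $S$ with unit, there is a commutative diagram in which every row is a short exact sequence and the vertical maps are surjective *-homomorphisms: $$\begin{array}{ccccccccc} 0 &\to& J &\to& C^*(S^* ) &\to& C^*(S)&\to& 0\\ &&&&\downarrow&&\downarrow&&\\ 0&\to& J_r&\to& C^*_r(S^* )&\to& C^*_r(S)&\to&0\end{array}$$ Here $J$ is the closed ideal in $C^*(S^* )$ generated by $\{x-y: x,y\in S^*,\ x\approx_{R_5}y\}$, and $J_r$ is the kernel of the restriction of the left regular representation of $S^*$ to the invariant subspace $\ell^2(S)\subset\ell^2(S^* )$.
   Context: $S^*$ is the inverse semigroup generated by elements $v_p$ ($p\in S$) subject to $v_pv_q=v_{pq}$ and $v_p^*v_p=1$ (quotient of the free inverse semigroup on $\{v_p:p\in S\}$). For an inverse semigroup $P$: *-representations are homomorphisms $\pi\colon P\to B(H)$ with $\pi(s^* )=\pi(s)^*$, sending a zero element (if any) to $0$; $C^*(P)$ is the completion of $\ell^1(P)$ in the supremum norm over all *-representations; $C^*_r(P)$ is the C*-algebra generated by the left regular representation on $\ell^2(P)$: $V_s\delta_t=\delta_{st}$ if $s^*st=t$, and $0$ otherwise. $C^*_r(S)\subset B(\ell^2(S))$ is the C*-algebra generated by the isometries $V_p\delta_q=\delta_{pq}$, $p,q\in S$. The space $\ell^2(S)$ is embedded in $\ell^2(S^* )$ by $\delta_s\mapsto\delta_{v_s}$; it is invariant under the left regular representation of $S^*$, and the restriction sends $v_p$ to $V_p$. For $A\subset S$, $a\in S$ let $aA=\{ax:x\in A\}$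 and $a^{-1}A=\{x\in S: ax\in A\}$. The set $\mathcal J$ of constructible right ideals consists of $\emptyset$ and all sets $a_n^{-1}(a_{n-1}\cdots a_2^{-1}(a_1S))$, $a_i\in S$. $W$ is the inverse semigroup generated by isometries $w_s$ ($s\in S$) and projections $e_X$ ($X\in\mathcal J$) subject to $w_{st}=w_sw_t$, $w_se_Xw_s^*=e_{sX}$, $e_S=1$, $e_\emptyset=0$, $e_{X\cap Y}=e_Xe_Y$ for all $s,t\in S$, $X,Y\in\mathcal J$; $C^*(S)$ is the universal C*-algebra generated by $W$. $R_5$ denotes the relations which, imposed on $S^*$, give the quotient $S^*/R_5=W$ via $v_s\mapsto w_s$; for $x,y\in S^*$ one writes $x\approx_{R_5}y$ if $x$ and $y$ have the same image in $W$. In the diagram, the map $C^*(S^* )\to C^*(S)$ is the one induced by $S^*\to W$, the map $C^*_r(S^* )\to C^*_r(S)$ is given by restriction to $\ell^2(S)$, and the vertical maps are the left regular representations of $S^*$ and $S$.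
   Formalization: A new zero, represented by 0, is adjoined to S* in C*(S* ) and in J, so x may be equivalent to 0; literally false for S free on a, b, where v_a*v_b is not in J. Representations act on a fixed l2-space of dimension at least max(|S|, aleph_0), which gives the same norm. *)

theory Defs
  imports "HOL-Analysis.Analysis"
begin

section \<open>C*-algebras\<close>

class invol =
  fixes invol :: "'a \<Rightarrow> 'a"  ("_\<^sup>\<star>" [1000] 999)

class scaleC =
  fixes scaleC :: "complex \<Rightarrow> 'a \<Rightarrow> 'a"  (infixr "*\<^sub>C" 75)

class cstar_algebra = real_normed_algebra + banach + scaleC + invol +
  assumes scaleC_of_real: "complex_of_real r *\<^sub>C x = r *\<^sub>R x"
    and scaleC_scaleC: "c *\<^sub>C d *\<^sub>C x = (c * d) *\<^sub>C x"
    and scaleC_add_right: "c *\<^sub>C (x + y) = c *\<^sub>C x + c *\<^sub>C y"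
    and scaleC_add_left: "(c + d) *\<^sub>C x = c *\<^sub>C x + d *\<^sub>C x"
    and scaleC_mult_left: "(c *\<^sub>C x) * y = c *\<^sub>C (x * y)"
    and scaleC_mult_right: "x * (c *\<^sub>C y) = c *\<^sub>C (x * y)"
    and norm_scaleC: "norm (c *\<^sub>C x) = cmod c * norm x"
    and invol_add: "(x + y)\<^sup>\<star> = x\<^sup>\<star> + y\<^sup>\<star>"
    and invol_scaleC: "(c *\<^sub>C x)\<^sup>\<star> = cnj c *\<^sub>C x\<^sup>\<star>"
    and invol_mult: "(x * y)\<^sup>\<star> = y\<^sup>\<star> * x\<^sup>\<star>"
    and invol_invol: "(x\<^sup>\<star>)\<^sup>\<star> = x"
    and cstar_identity: "norm (x\<^sup>\<star> * x) = (norm x)\<^sup>2"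

definition cstar_subalgebra :: "'a::cstar_algebra set \<Rightarrow> bool" where
  "cstar_subalgebra A \<longleftrightarrow> closed A \<and> 0 \<in> A \<and>
     (\<forall>a\<in>A. \<forall>b\<in>A. a + b \<in> A \<and> a * b \<in> A) \<and> (\<forall>a\<in>A. a\<^sup>\<star> \<in> A \<and> (\<forall>c. c *\<^sub>C a \<in> A))"

definition cstar_generated :: "'a::cstar_algebra set \<Rightarrow> 'a set" where
  "cstar_generated G = \<Inter>{A. cstar_subalgebra A \<and> G \<subseteq> A}"

definition closed_ideal :: "'a::cstar_algebra set \<Rightarrow> 'a set \<Rightarrow> bool" where
  "closed_ideal A I \<longleftrightarrow> I \<subseteq> A \<and> closed I \<and> 0 \<in> I \<and>
     (\<forall>x\<in>I. \<forall>y\<in>I. x + y \<in> I) \<and> (\<forall>x\<in>I. \<forall>c. c *\<^sub>C x \<in> I) \<and>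
     (\<forall>a\<in>A. \<forall>x\<in>I. a * x \<in> I \<and> x * a \<in> I)"

definition closed_ideal_generated :: "'a::cstar_algebra set \<Rightarrow> 'a set \<Rightarrow> 'a set" where
  "closed_ideal_generated A G = \<Inter>{I. closed_ideal A I \<and> G \<subseteq> I}"

definition star_hom :: "'a::cstar_algebra set \<Rightarrow> 'b::cstar_algebra set \<Rightarrow> ('a \<Rightarrow> 'b) \<Rightarrow> bool" where
  "star_hom A B f \<longleftrightarrow> f ` A \<subseteq> B \<and>
     (\<forall>a\<in>A. \<forall>b\<in>A. f (a + b) = f a + f b \<and> f (a * b) = f a * f b) \<and>
     (\<forall>a\<in>A. f (a\<^sup>\<star>) = (f a)\<^sup>\<star> \<and> (\<forall>c. f (c *\<^sub>C a) = c *\<^sub>C f a))"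

definition short_exact ::
    "'a::cstar_algebra set \<Rightarrow> 'a set \<Rightarrow> 'b::cstar_algebra set \<Rightarrow> ('a \<Rightarrow> 'b) \<Rightarrow> bool" where
  "short_exact I A B f \<longleftrightarrow>
     cstar_subalgebra A \<and> cstar_subalgebra B \<and> closed_ideal A I \<and> star_hom A B f \<and>
     {a \<in> A. f a = 0} = I \<and> f ` A = B"

text \<open>Bounded functions into a C*-algebra, with pointwise operations and the supremum norm.\<close>

lemma bcontfun_mult_mem:
  fixes f g :: "'a::metric_space \<Rightarrow>\<^sub>C 'b::cstar_algebra"
  shows "(\<lambda>x. f x * g x) \<in> bcontfun"
proof (rule bcontfun_normI)
  show "continuous_on UNIV (\<lambda>x. f x * g x)" by (intro continuous_intros) auto
  show "norm (f x * g x) \<le> norm f * norm g" for x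
    by (rule order.trans[OF norm_mult_ineq]) (intro mult_mono norm_bounded norm_ge_zero)
qed

lemma scaleC_bounded_linear: "bounded_linear (\<lambda>x::'b::cstar_algebra. c *\<^sub>C x)"
proof (rule bounded_linear_intro[where K="cmod c"])
  fix r and x :: 'b
  have "c *\<^sub>C r *\<^sub>R x = r *\<^sub>R c *\<^sub>C x"
    by (simp flip: scaleC_of_real add: scaleC_scaleC mult.commute)
  then show "c *\<^sub>C (r *\<^sub>R x) = r *\<^sub>R (c *\<^sub>C x)" .
qed (auto simp: scaleC_add_right norm_scaleC mult.commute)

lemma norm_invol: "norm (x\<^sup>\<star>) = norm (x::'b::cstar_algebra)"
proof -
  have *: "norm x \<le> norm (x\<^sup>\<star>)" for x :: 'b
  proof (cases "x = 0")
    case False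
    have "norm x * norm x \<le> norm (x\<^sup>\<star>) * norm x"
      using norm_mult_ineq[of "x\<^sup>\<star>" x] by (simp add: cstar_identity power2_eq_square)
    with False show ?thesis by simp
  qed simp
  from *[of x] *[of "x\<^sup>\<star>"] show ?thesis by (simp add: invol_invol)
qed

lemma invol_bounded_linear: "bounded_linear (\<lambda>x::'b::cstar_algebra. x\<^sup>\<star>)"
proof (rule bounded_linear_intro[where K=1])
  fix r and x :: 'b
  show "(r *\<^sub>R x)\<^sup>\<star> = r *\<^sub>R x\<^sup>\<star>"
    by (simp flip: scaleC_of_real add: invol_scaleC)
qed (auto simp: invol_add norm_invol)

lemma bcontfun_scaleC_mem:
  fixes f :: "'a::metric_space \<Rightarrow>\<^sub>C 'b::cstar_algebra"
  shows "(\<lambda>x. c *\<^sub>C f x) \<in> bcontfun"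
proof (rule bcontfun_normI)
  show "continuous_on UNIV (\<lambda>x. c *\<^sub>C f x)"
    by (intro bounded_linear.continuous_on[OF scaleC_bounded_linear]) auto
  show "norm (c *\<^sub>C f x) \<le> cmod c * norm f" for x
    by (simp add: norm_scaleC mult_left_mono norm_bounded)
qed

lemma bcontfun_invol_mem:
  fixes f :: "'a::metric_space \<Rightarrow>\<^sub>C 'b::cstar_algebra"
  shows "(\<lambda>x. (f x)\<^sup>\<star>) \<in> bcontfun"
proof (rule bcontfun_normI)
  show "continuous_on UNIV (\<lambda>x. (f x)\<^sup>\<star>)"
    by (intro bounded_linear.continuous_on[OF invol_bounded_linear]) auto
  show "norm ((f x)\<^sup>\<star>) \<le> norm f" for x
    by (simp add: norm_invol norm_bounded)
qed

instantiation bcontfun :: (metric_space, cstar_algebra) cstar_algebra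
begin

definition times_bcontfun :: "('a \<Rightarrow>\<^sub>C 'b) \<Rightarrow> ('a \<Rightarrow>\<^sub>C 'b) \<Rightarrow> 'a \<Rightarrow>\<^sub>C 'b"
  where "times_bcontfun f g = Bcontfun (\<lambda>x. f x * g x)"

definition scaleC_bcontfun :: "complex \<Rightarrow> ('a \<Rightarrow>\<^sub>C 'b) \<Rightarrow> 'a \<Rightarrow>\<^sub>C 'b"
  where "scaleC_bcontfun c f = Bcontfun (\<lambda>x. c *\<^sub>C f x)"

definition invol_bcontfun :: "('a \<Rightarrow>\<^sub>C 'b) \<Rightarrow> 'a \<Rightarrow>\<^sub>C 'b"
  where "invol_bcontfun f = Bcontfun (\<lambda>x. (f x)\<^sup>\<star>)"

lemma apply_bcontfun_cstar [simp]:
  fixes f g :: "'a \<Rightarrow>\<^sub>C 'b"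
  shows "(f * g) x = f x * g x" "(c *\<^sub>C f) x = c *\<^sub>C f x" "(f\<^sup>\<star>) x = (f x)\<^sup>\<star>"
  by (simp_all add: times_bcontfun_def scaleC_bcontfun_def invol_bcontfun_def
      Bcontfun_inverse bcontfun_mult_mem bcontfun_scaleC_mem bcontfun_invol_mem)

instance
proof
  fix f g h :: "'a \<Rightarrow>\<^sub>C 'b" and c d :: complex and r :: real
  show mult_le: "norm (f * g) \<le> norm f * norm g" for f g :: "'a \<Rightarrow>\<^sub>C 'b"
    by (rule norm_bound)
      (simp add: order.trans[OF norm_mult_ineq] mult_mono norm_bounded)
  have sc: "norm (c *\<^sub>C f) \<le> cmod c * norm f" for c and f :: "'a \<Rightarrow>\<^sub>C 'b"
    by (rule norm_bound) (simp add: norm_scaleC mult_left_mono norm_bounded)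
  show "norm (c *\<^sub>C f) = cmod c * norm f"
  proof (cases "c = 0")
    case True
    then show ?thesis using sc[of c f] by simp
  next
    case False
    have "f = inverse c *\<^sub>C c *\<^sub>C f"
      by (rule bcontfun_eqI) (use False in \<open>simp add: scaleC_scaleC scaleC_of_real[of 1, simplified]\<close>)
    then have "norm f \<le> inverse (cmod c) * norm (c *\<^sub>C f)"
      using sc[of "inverse c" "c *\<^sub>C f"] by (simp add: norm_inverse)
    then have "cmod c * norm f \<le> norm (c *\<^sub>C f)"
      using False by (simp add: field_simps)
    with sc[of c f] show ?thesis by simp
  qed
  have inv: "norm (f\<^sup>\<star>) \<le> norm f" for f :: "'a \<Rightarrow>\<^sub>C 'b"
    by (rule norm_bound) (simp add: norm_invol norm_bounded)
  show "norm (f\<^sup>\<star> * f) = (norm f)\<^sup>2"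
  proof (rule antisym)
    have "norm (f\<^sup>\<star> * f) \<le> norm (f\<^sup>\<star>) * norm f" by (rule mult_le)
    also have "\<dots> \<le> norm f * norm f" by (intro mult_right_mono inv) simp
    finally show "norm (f\<^sup>\<star> * f) \<le> (norm f)\<^sup>2" by (simp add: power2_eq_square)
    have "norm (f x) \<le> sqrt (norm (f\<^sup>\<star> * f))" for x
      using norm_bounded[of "f\<^sup>\<star> * f" x] by (simp add: cstar_identity real_le_rsqrt)
    then have "norm f \<le> sqrt (norm (f\<^sup>\<star> * f))" by (rule norm_bound)
    then have "(norm f)\<^sup>2 \<le> (sqrt (norm (f\<^sup>\<star> * f)))\<^sup>2" by (intro power_mono) auto
    then show "(norm f)\<^sup>2 \<le> norm (f\<^sup>\<star> * f)" by simp
  qed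
qed (rule bcontfun_eqI; simp add: algebra_simps scaleC_of_real scaleC_scaleC scaleC_add_right
      scaleC_add_left scaleC_mult_left scaleC_mult_right invol_add invol_scaleC invol_mult invol_invol)+

end

section \<open>The Hilbert spaces l2 and their bounded operators\<close>

typedef 'a ell2 = "{f :: 'a \<Rightarrow> complex. (\<lambda>x. (cmod (f x))\<^sup>2) summable_on UNIV}"
  morphisms ell2_nth Abs_ell2
  by (intro exI[of _ "\<lambda>_. 0"]) simp

setup_lifting type_definition_ell2

lemma ell2_summable: "(\<lambda>x. (cmod (ell2_nth f x))\<^sup>2) summable_on UNIV"
  using ell2_nth[of f] by simp

lemma ell2_add_aux:
  fixes f g :: "'a \<Rightarrow> complex"
  assumes "(\<lambda>x. (cmod (f x))\<^sup>2) summable_on UNIV" "(\<lambda>x. (cmod (g x))\<^sup>2) summable_on UNIV"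
  shows "(\<lambda>x. (cmod (f x + g x))\<^sup>2) summable_on UNIV"
proof (rule summable_on_comparison_test)
  show "(\<lambda>x. 2 * ((cmod (f x))\<^sup>2 + (cmod (g x))\<^sup>2)) summable_on UNIV"
    by (intro summable_on_cmult_right summable_on_add assms)
  fix x
  have "(cmod (f x + g x))\<^sup>2 \<le> (cmod (f x) + cmod (g x))\<^sup>2"
    by (intro power_mono norm_triangle_ineq) auto
  also have "\<dots> \<le> 2 * ((cmod (f x))\<^sup>2 + (cmod (g x))\<^sup>2)"
    using sum_squares_bound[of "cmod (f x)" "cmod (g x)"] by (simp add: power2_sum)
  finally show "(cmod (f x + g x))\<^sup>2 \<le> 2 * ((cmod (f x))\<^sup>2 + (cmod (g x))\<^sup>2)" .
qed auto

lemma ell2_scaleC_aux: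
  fixes f :: "'a \<Rightarrow> complex"
  assumes "(\<lambda>x. (cmod (f x))\<^sup>2) summable_on UNIV"
  shows "(\<lambda>x. (cmod (c * f x))\<^sup>2) summable_on UNIV"
  using summable_on_cmult_right[OF assms, of "(cmod c)\<^sup>2"]
  by (simp add: norm_mult power_mult_distrib)

lemma ell2_prod_abs_summable:
  "(\<lambda>x. cmod (ell2_nth f x) * cmod (ell2_nth g x)) summable_on UNIV"
proof (rule summable_on_comparison_test)
  show "(\<lambda>x. (cmod (ell2_nth f x))\<^sup>2 + (cmod (ell2_nth g x))\<^sup>2) summable_on UNIV"
    by (intro summable_on_add ell2_summable)
  fix x
  have "2 * (cmod (ell2_nth f x) * cmod (ell2_nth g x)) \<le>
    (cmod (ell2_nth f x))\<^sup>2 + (cmod (ell2_nth g x))\<^sup>2"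
    using sum_squares_bound[of "cmod (ell2_nth f x)" "cmod (ell2_nth g x)"] by simp
  moreover have "0 \<le> cmod (ell2_nth f x) * cmod (ell2_nth g x)" by simp
  ultimately show "cmod (ell2_nth f x) * cmod (ell2_nth g x) \<le>
    (cmod (ell2_nth f x))\<^sup>2 + (cmod (ell2_nth g x))\<^sup>2" by linarith
qed auto

lemma ell2_inner_summable: "(\<lambda>x. ell2_nth f x * cnj (ell2_nth g x)) summable_on UNIV"
  by (rule abs_summable_summable) (use ell2_prod_abs_summable[of f g] in \<open>simp add: norm_mult\<close>)

lift_definition delta :: "'a \<Rightarrow> 'a ell2" is "\<lambda>a x. if x = a then 1 else 0"
proof -
  fix a :: 'a
  show "(\<lambda>x. (cmod (if x = a then 1 else 0))\<^sup>2) summable_on UNIV"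
    by (rule finite_nonzero_values_imp_summable_on) (auto intro: finite_subset[of _ "{a}"])
qed

definition cinner :: "'a ell2 \<Rightarrow> 'a ell2 \<Rightarrow> complex" where
  "cinner f g = (\<Sum>\<^sub>\<infinity>x. ell2_nth f x * cnj (ell2_nth g x))"

instantiation ell2 :: (type) "{real_inner, scaleC}"
begin

lift_definition zero_ell2 :: "'a ell2" is "\<lambda>_. 0" by simp
lift_definition plus_ell2 :: "'a ell2 \<Rightarrow> 'a ell2 \<Rightarrow> 'a ell2" is "\<lambda>f g x. f x + g x"
  by (rule ell2_add_aux)
lift_definition scaleC_ell2 :: "complex \<Rightarrow> 'a ell2 \<Rightarrow> 'a ell2" is "\<lambda>c f x. c * f x"
  by (rule ell2_scaleC_aux)
definition scaleR_ell2 :: "real \<Rightarrow> 'a ell2 \<Rightarrow> 'a ell2"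
  where "scaleR_ell2 r f = complex_of_real r *\<^sub>C f"
definition uminus_ell2 :: "'a ell2 \<Rightarrow> 'a ell2"
  where "uminus_ell2 f = (- 1) *\<^sub>C f"
definition minus_ell2 :: "'a ell2 \<Rightarrow> 'a ell2 \<Rightarrow> 'a ell2"
  where "minus_ell2 f g = f + (- 1) *\<^sub>C g"
definition inner_ell2 :: "'a ell2 \<Rightarrow> 'a ell2 \<Rightarrow> real"
  where "inner_ell2 f g = Re (cinner f g)"
definition norm_ell2 :: "'a ell2 \<Rightarrow> real"
  where "norm_ell2 f = sqrt (inner f f)"
definition sgn_ell2 :: "'a ell2 \<Rightarrow> 'a ell2"
  where "sgn_ell2 f = inverse (norm f) *\<^sub>R f"
definition dist_ell2 :: "'a ell2 \<Rightarrow> 'a ell2 \<Rightarrow> real"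
  where "dist_ell2 f g = norm (f - g)"
definition uniformity_ell2 :: "('a ell2 \<times> 'a ell2) filter"
  where "uniformity_ell2 = (INF e\<in>{0<..}. principal {(x, y). dist x y < e})"
definition open_ell2 :: "'a ell2 set \<Rightarrow> bool"
  where "open_ell2 S = (\<forall>x\<in>S. \<forall>\<^sub>F (x', y) in uniformity. x' = x \<longrightarrow> y \<in> S)"

lemma ell2_nth_simps [simp]:
  fixes f g :: "'a ell2"
  shows "ell2_nth 0 x = 0" "ell2_nth (f + g) x = ell2_nth f x + ell2_nth g x"
    "ell2_nth (c *\<^sub>C f) x = c * ell2_nth f x" "ell2_nth (r *\<^sub>R f) x = complex_of_real r * ell2_nth f x"
    "ell2_nth (- f) x = - ell2_nth f x" "ell2_nth (f - g) x = ell2_nth f x - ell2_nth g x"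
  by (simp_all add: zero_ell2.rep_eq plus_ell2.rep_eq scaleC_ell2.rep_eq scaleR_ell2_def
      uminus_ell2_def minus_ell2_def)

lemma ell2_eqI: "(\<And>x. ell2_nth f x = ell2_nth g x) \<Longrightarrow> f = g"
  by (simp add: ell2_nth_inject[symmetric] fun_eq_iff)

lemma cinner_add_left: "cinner (f + g) h = cinner f h + cinner g h"
  unfolding cinner_def
  by (simp add: distrib_right infsum_add ell2_inner_summable)

lemma cinner_scaleC_left: "cinner (c *\<^sub>C f) g = c * cinner f g"
  unfolding cinner_def
  by (simp add: mult.assoc infsum_cmult_right ell2_inner_summable)

lemma cinner_commute: "cinner f g = cnj (cinner g f)"
  unfolding cinner_def by (simp flip: infsum_cnj add: mult.commute)

lemma cinner_self: "cinner f f = complex_of_real (\<Sum>\<^sub>\<infinity>x. (cmod (ell2_nth f x))\<^sup>2)"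
  unfolding cinner_def complex_norm_square[symmetric]
  by (intro infsumI has_sum_of_real has_sum_infsum ell2_summable)

instance
proof
  fix f g h :: "'a ell2" and r s :: real
  show "inner f g = inner g f"
    unfolding inner_ell2_def by (subst cinner_commute) simp
  show "inner (f + g) h = inner f h + inner g h"
    by (simp add: inner_ell2_def cinner_add_left)
  show "inner (r *\<^sub>R f) g = r * inner f g"
    by (simp add: inner_ell2_def scaleR_ell2_def cinner_scaleC_left)
  have nn: "0 \<le> (\<Sum>\<^sub>\<infinity>x. (cmod (ell2_nth f x))\<^sup>2)" by (intro infsum_nonneg) simp
  then show "0 \<le> inner f f" by (simp add: inner_ell2_def cinner_self)
  show "inner f f = 0 \<longleftrightarrow> f = 0"
  proof
    assume "inner f f = 0"
    then have "(\<Sum>\<^sub>\<infinity>x. (cmod (ell2_nth f x))\<^sup>2) = 0" by (simp add: inner_ell2_def cinner_self)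
    then have "(cmod (ell2_nth f x))\<^sup>2 = 0" for x
      by (intro nonneg_infsum_le_0D[where A=UNIV and f="\<lambda>x. (cmod (ell2_nth f x))\<^sup>2"])
        (auto simp: ell2_summable)
    then show "f = 0" by (intro ell2_eqI) simp
  qed (simp add: inner_ell2_def cinner_def)
qed (auto intro!: ell2_eqI simp: algebra_simps dist_ell2_def sgn_ell2_def norm_ell2_def
      uniformity_ell2_def open_ell2_def)

end

lemma norm_ell2_square: "(norm f)\<^sup>2 = (\<Sum>\<^sub>\<infinity>x. (cmod (ell2_nth f x))\<^sup>2)"
proof -
  have "0 \<le> (\<Sum>\<^sub>\<infinity>x. (cmod (ell2_nth f x))\<^sup>2)" by (intro infsum_nonneg) simp
  then show ?thesis by (simp add: norm_ell2_def inner_ell2_def cinner_self)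
qed

lemma cinner_self_norm: "cinner f f = complex_of_real ((norm f)\<^sup>2)"
  by (simp only: norm_ell2_square cinner_self)

lemma norm_ell2_scaleC: "norm (c *\<^sub>C f) = cmod c * norm (f :: 'a ell2)"
proof -
  have "(norm (c *\<^sub>C f))\<^sup>2 = (cmod c * norm f)\<^sup>2"
    by (simp add: norm_ell2_square power_mult_distrib norm_mult infsum_cmult_right ell2_summable)
  then show ?thesis by simp
qed

lemma cinner_bound: "cmod (cinner f g) \<le> norm f * norm g"
proof (cases "cinner f g = 0")
  case False
  define c where "c = cnj (sgn (cinner f g))"
  have c1: "cmod c = 1" using False by (simp add: c_def norm_sgn)
  have "cinner (c *\<^sub>C f) g = complex_of_real (cmod (cinner f g))"
    using False by (simp add: cinner_scaleC_left c_def sgn_eq complex_norm_square[symmetric]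
        power2_eq_square mult.commute[of "cnj _"])
  then have "cmod (cinner f g) = inner (c *\<^sub>C f) g" by (simp add: inner_ell2_def)
  also have "\<dots> \<le> norm (c *\<^sub>C f) * norm g" by (rule norm_cauchy_schwarz)
  finally show ?thesis by (simp add: norm_ell2_scaleC c1)
qed simp

lemma ell2_finite_sum_le: "finite F \<Longrightarrow> (\<Sum>x\<in>F. (cmod (ell2_nth f x))\<^sup>2) \<le> (norm f)\<^sup>2"
  unfolding norm_ell2_square by (rule finite_sum_le_infsum) (auto simp: ell2_summable)

lemma ell2_memI:
  assumes "\<And>F. finite F \<Longrightarrow> (\<Sum>x\<in>F. (cmod (f x))\<^sup>2) \<le> B"
  shows "(\<lambda>x. (cmod (f x))\<^sup>2) summable_on UNIV"
  by (rule nonneg_bdd_above_summable_on) (auto intro!: bdd_aboveI[where M=B] assms)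

lemma norm_ell2_leI:
  assumes "\<And>F. finite F \<Longrightarrow> (\<Sum>x\<in>F. (cmod (ell2_nth f x))\<^sup>2) \<le> B\<^sup>2" "0 \<le> B"
  shows "norm f \<le> B"
proof -
  have "(norm f)\<^sup>2 \<le> B\<^sup>2"
    unfolding norm_ell2_square
    by (rule infsum_le_finite_sums[OF ell2_summable]) (use assms in auto)
  then show ?thesis using assms(2) by (rule power2_le_imp_le)
qed

lemma ell2_nth_bound: "cmod (ell2_nth f x) \<le> norm f"
  using ell2_finite_sum_le[of "{x}" f] by (simp add: power2_le_iff_abs_le)

instance ell2 :: (type) banach
proof
  fix X :: "nat \<Rightarrow> 'a ell2"
  assume X: "Cauchy X"
  have "Cauchy (\<lambda>n. ell2_nth (X n) x)" for x
  proof (rule metric_CauchyI)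
    fix e :: real assume "0 < e"
    with X obtain M where "\<forall>m\<ge>M. \<forall>n\<ge>M. dist (X m) (X n) < e" by (auto simp: Cauchy_def)
    moreover have "dist (ell2_nth (X m) x) (ell2_nth (X n) x) \<le> dist (X m) (X n)" for m n
      using ell2_nth_bound[of "X m - X n" x] by (simp add: dist_norm)
    ultimately show "\<exists>M. \<forall>m\<ge>M. \<forall>n\<ge>M. dist (ell2_nth (X m) x) (ell2_nth (X n) x) < e"
      by (meson le_less_trans)
  qed
  then have "\<exists>l. (\<lambda>n. ell2_nth (X n) x) \<longlonglongrightarrow> l" for x
    by (simp add: Cauchy_convergent_iff convergent_def)
  then obtain l where l: "\<And>x. (\<lambda>n. ell2_nth (X n) x) \<longlonglongrightarrow> l x" by metis
  have fin: "\<exists>M. \<forall>m\<ge>M. \<forall>F. finite F \<longrightarrow> (\<Sum>x\<in>F. (cmod (ell2_nth (X m) x - l x))\<^sup>2) \<le> e\<^sup>2"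
    if "0 < e" for e
  proof -
    from X that obtain M where M: "\<forall>m\<ge>M. \<forall>n\<ge>M. dist (X m) (X n) < e" by (auto simp: Cauchy_def)
    show ?thesis
    proof (intro exI[of _ M] allI impI)
      fix m and F :: "'a set" assume m: "M \<le> m" and F: "finite F"
      have "(\<lambda>n. \<Sum>x\<in>F. (cmod (ell2_nth (X m) x - ell2_nth (X n) x))\<^sup>2)
          \<longlonglongrightarrow> (\<Sum>x\<in>F. (cmod (ell2_nth (X m) x - l x))\<^sup>2)"
        by (intro tendsto_intros l)
      moreover have "(\<Sum>x\<in>F. (cmod (ell2_nth (X m) x - ell2_nth (X n) x))\<^sup>2) \<le> e\<^sup>2" if "n \<ge> M" for n
      proof -
        have "(\<Sum>x\<in>F. (cmod (ell2_nth (X m - X n) x))\<^sup>2) \<le> (norm (X m - X n))\<^sup>2"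
          by (rule ell2_finite_sum_le[OF F])
        also have "\<dots> \<le> e\<^sup>2"
          using M m that by (intro power_mono) (auto simp: dist_norm intro: less_imp_le)
        finally show ?thesis by simp
      qed
      ultimately show "(\<Sum>x\<in>F. (cmod (ell2_nth (X m) x - l x))\<^sup>2) \<le> e\<^sup>2"
        by (intro LIMSEQ_le_const2) auto
    qed
  qed
  obtain M where M: "\<And>F. finite F \<Longrightarrow> (\<Sum>x\<in>F. (cmod (ell2_nth (X M) x - l x))\<^sup>2) \<le> 1\<^sup>2"
    using fin[of 1] by auto
  have "(\<lambda>x. (cmod (ell2_nth (X M) x - l x))\<^sup>2) summable_on UNIV"
    by (rule ell2_memI[OF M])
  from ell2_add_aux[OF ell2_summable[of "X M"] ell2_scaleC_aux[OF this, of "- 1"]]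
  have "(\<lambda>x. (cmod (l x))\<^sup>2) summable_on UNIV" by simp
  then obtain L where L: "ell2_nth L = l" using Abs_ell2_inverse by blast
  have "X \<longlonglongrightarrow> L"
  proof (rule metric_LIMSEQ_I)
    fix e :: real assume e: "0 < e"
    from fin[of "e/2"] e obtain M where M: "\<And>m F. M \<le> m \<Longrightarrow> finite F \<Longrightarrow>
        (\<Sum>x\<in>F. (cmod (ell2_nth (X m) x - l x))\<^sup>2) \<le> (e/2)\<^sup>2" by auto
    have "dist (X m) L < e" if "M \<le> m" for m
    proof -
      have "norm (X m - L) \<le> e/2"
        by (rule norm_ell2_leI) (use M[OF that] L e in auto)
      with e show ?thesis by (simp add: dist_norm)
    qed
    then show "\<exists>M. \<forall>m\<ge>M. dist (X m) L < e" by blast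
  qed
  then show "convergent X" by (rule convergentI)
qed

lemma cinner_delta_right: "cinner f (delta a) = ell2_nth f a"
proof -
  have "cinner f (delta a) = (\<Sum>\<^sub>\<infinity>x\<in>{a}. ell2_nth f x)"
    unfolding cinner_def by (rule infsum_cong_neutral) (auto simp: delta.rep_eq)
  then show ?thesis by simp
qed

lemma cinner_add_right: "cinner f (g + h) = cinner f g + cinner f h"
  by (metis cinner_add_left cinner_commute complex_cnj_add)

lemma cinner_scaleC_right: "cinner f (c *\<^sub>C g) = cnj c * cinner f g"
  by (metis cinner_scaleC_left cinner_commute complex_cnj_mult)

lemma cinner_diff_left: "cinner (f - g) h = cinner f h - cinner g h"
  using cinner_add_left[of "f - g" g h] by simp

lemma cinner_diff_right: "cinner f (g - h) = cinner f g - cinner f h"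
  using cinner_add_right[of f "g - h" h] by simp

lemma cinner_ext_right: "(\<And>x. cinner x f = cinner x g) \<Longrightarrow> f = g"
  by (metis cinner_commute cinner_delta_right ell2_eqI)

definition ell2_trunc :: "'a set \<Rightarrow> 'a ell2 \<Rightarrow> 'a ell2" where
  "ell2_trunc F f = (\<Sum>a\<in>F. ell2_nth f a *\<^sub>C delta a)"

lemma ell2_nth_sum: "ell2_nth (\<Sum>a\<in>F. g a) x = (\<Sum>a\<in>F. ell2_nth (g a) x)"
  by (induction F rule: infinite_finite_induct) auto

lemma ell2_nth_trunc: "finite F \<Longrightarrow> ell2_nth (ell2_trunc F f) x = (if x \<in> F then ell2_nth f x else 0)"
  by (simp add: ell2_trunc_def ell2_nth_sum delta.rep_eq if_distrib[of "(*) _"] cong: if_cong)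

lemma ell2_trunc_tendsto: "((\<lambda>F. ell2_trunc F f) \<longlongrightarrow> f) (finite_subsets_at_top UNIV)"
proof (rule tendstoI)
  fix e :: real assume e: "0 < e"
  have "((\<lambda>F. \<Sum>x\<in>F. (cmod (ell2_nth f x))\<^sup>2) \<longlongrightarrow> (norm f)\<^sup>2) (finite_subsets_at_top UNIV)"
    unfolding norm_ell2_square by (rule infsum_tendsto[OF ell2_summable])
  from tendstoD[OF this, of "e\<^sup>2"] e
  have "\<forall>\<^sub>F F in finite_subsets_at_top UNIV.
      dist (\<Sum>x\<in>F. (cmod (ell2_nth f x))\<^sup>2) ((norm f)\<^sup>2) < e\<^sup>2" by simp
  moreover have "\<forall>\<^sub>F F in finite_subsets_at_top (UNIV::'a set). finite F"
    by (rule eventually_finite_subsets_at_top_weakI)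
  ultimately show "\<forall>\<^sub>F F in finite_subsets_at_top UNIV. dist (ell2_trunc F f) f < e"
  proof eventually_elim
    case (elim F)
    have "(\<Sum>\<^sub>\<infinity>x. (cmod (ell2_nth f x))\<^sup>2) =
        (\<Sum>\<^sub>\<infinity>x\<in>F. (cmod (ell2_nth f x))\<^sup>2) + (\<Sum>\<^sub>\<infinity>x\<in>-F. (cmod (ell2_nth f x))\<^sup>2)"
      by (subst infsum_Un_disjoint[symmetric])
        (auto intro: summable_on_subset_banach[OF ell2_summable])
    moreover have "(norm (f - ell2_trunc F f))\<^sup>2 = (\<Sum>\<^sub>\<infinity>x\<in>-F. (cmod (ell2_nth f x))\<^sup>2)"
      unfolding norm_ell2_square
      by (rule infsum_cong_neutral) (auto simp: ell2_nth_trunc elim)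
    ultimately have "(norm (f - ell2_trunc F f))\<^sup>2 = (norm f)\<^sup>2 - (\<Sum>x\<in>F. (cmod (ell2_nth f x))\<^sup>2)"
      using elim by (simp add: norm_ell2_square)
    also have "\<dots> < e\<^sup>2" using elim(1) by (simp add: dist_real_def abs_if split: if_splits)
    finally have "norm (f - ell2_trunc F f) < e" using e by (simp add: power2_less_imp_less)
    then show ?case by (simp add: dist_norm norm_minus_commute)
  qed
qed

text \<open>The algebra B(l2): bounded operators of the underlying real normed space that are
  complex-linear. The adjoint is determined by the inner product.\<close>

typedef 'a bop = "{T :: 'a ell2 \<Rightarrow>\<^sub>L 'a ell2. \<forall>c x. blinfun_apply T (c *\<^sub>C x) = c *\<^sub>C blinfun_apply T x}"
  morphisms bop_blinfun Abs_bop
  by (intro exI[of _ 0]) (auto intro!: ell2_eqI)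

setup_lifting type_definition_bop

definition bop_apply :: "'a bop \<Rightarrow> 'a ell2 \<Rightarrow> 'a ell2"  (infixl "\<bullet>\<^sub>B" 70)
  where "T \<bullet>\<^sub>B x = blinfun_apply (bop_blinfun T) x"

lemma bop_scaleC: "T \<bullet>\<^sub>B (c *\<^sub>C x) = c *\<^sub>C (T \<bullet>\<^sub>B x)"
  using bop_blinfun[of T] by (simp add: bop_apply_def)

lemma scaleR_scaleC_ell2: "r *\<^sub>R (f :: 'a ell2) = complex_of_real r *\<^sub>C f"
  by (rule scaleR_ell2_def)

lemma scaleC_ell2_bounded_linear: "bounded_linear (\<lambda>x :: 'a ell2. c *\<^sub>C x)"
  by (rule bounded_linear_intro[where K="cmod c"])
    (auto intro!: ell2_eqI simp: algebra_simps norm_ell2_scaleC)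

lemma bop_blinfunI:
  assumes "\<And>x y. f (x + y) = f x + f y" "\<And>c x. f (c *\<^sub>C x) = c *\<^sub>C f x"
    and "\<And>x. norm (f x) \<le> norm x * K"
  shows "\<exists>T. \<forall>x. T \<bullet>\<^sub>B x = f (x :: 'a ell2)"
proof -
  have "bounded_linear f"
    by (rule bounded_linear_intro[where K=K]) (auto simp: assms scaleR_scaleC_ell2)
  then have *: "blinfun_apply (Blinfun f) = f" by (rule bounded_linear_Blinfun_apply)
  then have "bop_blinfun (Abs_bop (Blinfun f)) = Blinfun f"
    by (intro Abs_bop_inverse) (simp add: assms)
  with * show ?thesis by (intro exI[of _ "Abs_bop (Blinfun f)"]) (simp add: bop_apply_def)
qed

lemma bop_eqI: "(\<And>x. S \<bullet>\<^sub>B x = T \<bullet>\<^sub>B x) \<Longrightarrow> S = T"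
  by (simp add: bop_apply_def bop_blinfun_inject[symmetric] blinfun_eqI)

instantiation bop :: (type) "{real_normed_algebra_1, scaleC, invol}"
begin

lift_definition zero_bop :: "'a bop" is 0 by (auto intro!: ell2_eqI)
lift_definition one_bop :: "'a bop" is id_blinfun by simp
lift_definition plus_bop :: "'a bop \<Rightarrow> 'a bop \<Rightarrow> 'a bop" is "(+)"
  by (auto intro!: ell2_eqI simp: blinfun.add_left algebra_simps)
lift_definition minus_bop :: "'a bop \<Rightarrow> 'a bop \<Rightarrow> 'a bop" is "(-)"
  by (auto intro!: ell2_eqI simp: blinfun.diff_left algebra_simps)
lift_definition uminus_bop :: "'a bop \<Rightarrow> 'a bop" is "uminus"
  by (auto intro!: ell2_eqI simp: blinfun.minus_left)
lift_definition times_bop :: "'a bop \<Rightarrow> 'a bop \<Rightarrow> 'a bop" is "(o\<^sub>L)"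
  by simp
lift_definition scaleR_bop :: "real \<Rightarrow> 'a bop \<Rightarrow> 'a bop" is "scaleR"
  by (auto intro!: ell2_eqI simp: blinfun.scaleR_left)
lift_definition scaleC_bop :: "complex \<Rightarrow> 'a bop \<Rightarrow> 'a bop"
  is "\<lambda>c T. blinfun_compose (Blinfun (\<lambda>x. c *\<^sub>C x)) T"
  by (auto intro!: ell2_eqI simp: bounded_linear_Blinfun_apply[OF scaleC_ell2_bounded_linear])
lift_definition norm_bop :: "'a bop \<Rightarrow> real" is norm .
definition sgn_bop :: "'a bop \<Rightarrow> 'a bop" where "sgn_bop f = inverse (norm f) *\<^sub>R f"
definition dist_bop :: "'a bop \<Rightarrow> 'a bop \<Rightarrow> real" where "dist_bop f g = norm (f - g)"
definition uniformity_bop :: "('a bop \<times> 'a bop) filter"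
  where "uniformity_bop = (INF e\<in>{0<..}. principal {(x, y). dist x y < e})"
definition open_bop :: "'a bop set \<Rightarrow> bool"
  where "open_bop S = (\<forall>x\<in>S. \<forall>\<^sub>F (x', y) in uniformity. x' = x \<longrightarrow> y \<in> S)"
definition invol_bop :: "'a bop \<Rightarrow> 'a bop"
  where "invol_bop T = (THE U. \<forall>x y. cinner (T \<bullet>\<^sub>B x) y = cinner x (U \<bullet>\<^sub>B y))"

instance
proof
  fix f g h :: "'a bop" and r :: real
  show "f * g * h = f * (g * h)" by transfer (simp add: blinfun_eqI)
  show "norm (f * g) \<le> norm f * norm g" by transfer (rule norm_blinfun_compose)
  show "norm (f + g) \<le> norm f + norm g" by transfer (rule norm_triangle_ineq)
  show "(0::'a bop) \<noteq> 1"
  proof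
    assume "(0::'a bop) = 1"
    then have "(0 :: 'a bop) \<bullet>\<^sub>B delta undefined = 1 \<bullet>\<^sub>B delta undefined" by simp
    then have "ell2_nth (0 :: 'a ell2) undefined = ell2_nth (delta (undefined :: 'a)) undefined"
      by (simp add: bop_apply_def zero_bop.rep_eq one_bop.rep_eq)
    then show False by (simp add: delta.rep_eq)
  qed
  have "\<exists>x :: 'a ell2. x \<noteq> 0"
  proof
    have "ell2_nth (delta undefined) undefined \<noteq> ell2_nth (0 :: 'a ell2) undefined"
      by (simp add: delta.rep_eq)
    then show "delta (undefined :: 'a) \<noteq> 0" by metis
  qed
  then obtain x :: "'a ell2" where x: "x \<noteq> 0" ..
  show "norm (1::'a bop) = 1"
  proof (transfer, rule antisym)
    show "norm (id_blinfun :: 'a ell2 \<Rightarrow>\<^sub>L 'a ell2) \<le> 1" by (rule norm_blinfun_bound) auto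
    show "1 \<le> norm (id_blinfun :: 'a ell2 \<Rightarrow>\<^sub>L 'a ell2)"
      using norm_blinfun[of id_blinfun x] x by simp
  qed
qed (simp add: sgn_bop_def dist_bop_def uniformity_bop_def open_bop_def |
     (transfer; (rule blinfun_eqI)?; simp add: blinfun.bilinear_simps algebra_simps; fail))+

end

lemma bop_apply_simps [simp]:
  "(S + T) \<bullet>\<^sub>B x = S \<bullet>\<^sub>B x + T \<bullet>\<^sub>B x" "(S - T) \<bullet>\<^sub>B x = S \<bullet>\<^sub>B x - T \<bullet>\<^sub>B x" "(- T) \<bullet>\<^sub>B x = - (T \<bullet>\<^sub>B x)"
  "(0 :: 'a bop) \<bullet>\<^sub>B x = 0" "(1 :: 'a bop) \<bullet>\<^sub>B x = x" "(S * T) \<bullet>\<^sub>B x = S \<bullet>\<^sub>B (T \<bullet>\<^sub>B x)"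
  "(c *\<^sub>C T) \<bullet>\<^sub>B x = c *\<^sub>C (T \<bullet>\<^sub>B x)" "(r *\<^sub>R T) \<bullet>\<^sub>B x = r *\<^sub>R (T \<bullet>\<^sub>B x)"
  by (simp_all add: bop_apply_def plus_bop.rep_eq minus_bop.rep_eq uminus_bop.rep_eq zero_bop.rep_eq
      one_bop.rep_eq times_bop.rep_eq scaleC_bop.rep_eq scaleR_bop.rep_eq blinfun.bilinear_simps
      bounded_linear_Blinfun_apply[OF scaleC_ell2_bounded_linear])

lemma bop_add: "T \<bullet>\<^sub>B (x + y) = T \<bullet>\<^sub>B x + T \<bullet>\<^sub>B y"
  and bop_diff: "T \<bullet>\<^sub>B (x - y) = T \<bullet>\<^sub>B x - T \<bullet>\<^sub>B y"
  and bop_zero: "T \<bullet>\<^sub>B 0 = 0"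
  and bop_sum: "T \<bullet>\<^sub>B (\<Sum>a\<in>F. h a) = (\<Sum>a\<in>F. T \<bullet>\<^sub>B h a)"
  by (simp_all add: bop_apply_def blinfun.bilinear_simps)

lemma norm_bop_apply: "norm (T \<bullet>\<^sub>B x) \<le> norm T * norm x"
  by (simp add: bop_apply_def norm_bop.rep_eq norm_blinfun)

lemma norm_bop_bound: "0 \<le> b \<Longrightarrow> (\<And>x. norm (T \<bullet>\<^sub>B x) \<le> b * norm x) \<Longrightarrow> norm T \<le> b"
  by (simp add: bop_apply_def norm_bop.rep_eq norm_blinfun_bound)

lemma bop_continuous: "isCont (\<lambda>x. T \<bullet>\<^sub>B x) x"
  unfolding bop_apply_def by (intro continuous_intros)

instance bop :: (type) banach
proof
  fix X :: "nat \<Rightarrow> 'a bop"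
  assume "Cauchy X"
  then have "Cauchy (\<lambda>n. bop_blinfun (X n))"
    by (simp add: Cauchy_def dist_norm norm_bop.rep_eq minus_bop.rep_eq)
  then obtain L where L: "(\<lambda>n. bop_blinfun (X n)) \<longlonglongrightarrow> L"
    by (auto simp: Cauchy_convergent_iff convergent_def)
  have lim: "(\<lambda>n. X n \<bullet>\<^sub>B x) \<longlonglongrightarrow> blinfun_apply L x" for x
    unfolding bop_apply_def by (intro tendsto_intros L)
  have "blinfun_apply L (c *\<^sub>C x) = c *\<^sub>C blinfun_apply L x" for c x
  proof (rule LIMSEQ_unique)
    show "(\<lambda>n. X n \<bullet>\<^sub>B (c *\<^sub>C x)) \<longlonglongrightarrow> blinfun_apply L (c *\<^sub>C x)" by (rule lim)
    show "(\<lambda>n. X n \<bullet>\<^sub>B (c *\<^sub>C x)) \<longlonglongrightarrow> c *\<^sub>C blinfun_apply L x"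
      unfolding bop_scaleC
      by (rule bounded_linear.tendsto[OF scaleC_ell2_bounded_linear lim])
  qed
  then obtain K where K: "bop_blinfun K = L" using Abs_bop_inverse[of L] by blast
  have "X \<longlonglongrightarrow> K"
    using L unfolding LIMSEQ_iff K[symmetric]
    by (simp add: dist_norm norm_bop.rep_eq minus_bop.rep_eq)
  then show "convergent X" by (rule convergentI)
qed

lemma bop_eq_on_basis:
  assumes "\<And>a. S \<bullet>\<^sub>B delta a = T \<bullet>\<^sub>B delta a"
  shows "S = T"
proof (rule bop_eqI)
  fix x
  have tr: "S \<bullet>\<^sub>B ell2_trunc F x = T \<bullet>\<^sub>B ell2_trunc F x" for F
    by (simp add: ell2_trunc_def bop_sum bop_scaleC assms)
  have "((\<lambda>F. S \<bullet>\<^sub>B ell2_trunc F x) \<longlongrightarrow> S \<bullet>\<^sub>B x) (finite_subsets_at_top UNIV)"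
    by (rule isCont_tendsto_compose[OF bop_continuous ell2_trunc_tendsto])
  moreover have "((\<lambda>F. S \<bullet>\<^sub>B ell2_trunc F x) \<longlongrightarrow> T \<bullet>\<^sub>B x) (finite_subsets_at_top UNIV)"
    unfolding tr by (rule isCont_tendsto_compose[OF bop_continuous ell2_trunc_tendsto])
  ultimately show "S \<bullet>\<^sub>B x = T \<bullet>\<^sub>B x"
    by (intro tendsto_unique[OF finite_subsets_at_top_neq_bot])
qed

lemma cinner_tendsto_left:
  assumes "(f \<longlongrightarrow> l) F" shows "((\<lambda>n. cinner (f n) y) \<longlongrightarrow> cinner l y) F"
proof -
  have "bounded_linear (\<lambda>x. cinner x y)"
    by (rule bounded_linear_intro[where K="norm y"])
      (auto simp: cinner_add_left scaleR_scaleC_ell2 cinner_scaleC_left cinner_bound scaleR_conv_of_real)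
  from bounded_linear.tendsto[OF this assms] show ?thesis .
qed

lemma bop_adjoint_exists: "\<exists>U. \<forall>x y. cinner (T \<bullet>\<^sub>B x) y = cinner x (U \<bullet>\<^sub>B y)"
proof -
  define g where "g y a = cinner y (T \<bullet>\<^sub>B delta a)" for y a
  have trunc: "cinner (T \<bullet>\<^sub>B (\<Sum>a\<in>F. c a *\<^sub>C delta a)) y = (\<Sum>a\<in>F. c a * cnj (g y a))"
    if "finite F" for F c y
    using that
  proof (induction F)
    case empty
    then show ?case by (simp add: bop_zero cinner_def)
  next
    case (insert a F)
    have "cinner (T \<bullet>\<^sub>B delta a) y = cnj (g y a)" unfolding g_def by (rule cinner_commute)
    with insert show ?case by (simp add: bop_add bop_scaleC cinner_add_left cinner_scaleC_left)
  qed
  have bd: "(\<Sum>a\<in>F. (cmod (g y a))\<^sup>2) \<le> (norm T * norm y)\<^sup>2" if F: "finite F" for y F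
  proof -
    define u where "u = (\<Sum>a\<in>F. g y a *\<^sub>C delta a)"
    define s where "s = (\<Sum>a\<in>F. (cmod (g y a))\<^sup>2)"
    have nth: "ell2_nth u x = (if x \<in> F then g y x else 0)" for x
      by (simp add: u_def ell2_nth_sum delta.rep_eq F if_distrib[of "(*) _"] cong: if_cong)
    have "(norm u)\<^sup>2 = (\<Sum>\<^sub>\<infinity>a\<in>F. (cmod (g y a))\<^sup>2)"
      unfolding norm_ell2_square by (rule infsum_cong_neutral) (auto simp: nth)
    then have nu: "(norm u)\<^sup>2 = s" using F by (simp add: s_def)
    have "cinner (T \<bullet>\<^sub>B u) y = complex_of_real s"
      unfolding u_def trunc[OF F] s_def of_real_sum complex_norm_square ..
    then have "s \<le> norm (T \<bullet>\<^sub>B u) * norm y"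
      using cinner_bound[of "T \<bullet>\<^sub>B u" y] by simp
    also have "\<dots> \<le> (norm T * norm u) * norm y" by (intro mult_right_mono norm_bop_apply) simp
    finally have "norm u * norm u \<le> (norm T * norm y) * norm u"
      using nu by (simp add: power2_eq_square mult_ac)
    then have "norm u \<le> norm T * norm y"
      by (cases "norm u = 0") (auto simp: mult_le_cancel_right)
    then have "(norm u)\<^sup>2 \<le> (norm T * norm y)\<^sup>2" by (intro power_mono) auto
    with nu show ?thesis by (simp add: s_def)
  qed
  define f where "f y = Abs_ell2 (g y)" for y
  have f: "ell2_nth (f y) = g y" for y
    unfolding f_def by (rule Abs_ell2_inverse) (use ell2_memI[OF bd] in blast)
  have "\<exists>U. \<forall>y. U \<bullet>\<^sub>B y = f y"
  proof (rule bop_blinfunI[where K="norm T"])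
    show "f (x + y) = f x + f y" for x y
      by (rule ell2_eqI) (simp add: f g_def cinner_add_left)
    show "f (c *\<^sub>C x) = c *\<^sub>C f x" for c x
      by (rule ell2_eqI) (simp add: f g_def cinner_scaleC_left)
    show "norm (f y) \<le> norm y * norm T" for y
      by (rule norm_ell2_leI) (use bd[of _ y] in \<open>auto simp: f mult.commute\<close>)
  qed
  then obtain U where U: "\<And>y. U \<bullet>\<^sub>B y = f y" by auto
  have "cinner (T \<bullet>\<^sub>B x) y = cinner x (U \<bullet>\<^sub>B y)" for x y
  proof (rule tendsto_unique[OF finite_subsets_at_top_neq_bot])
    have "((\<lambda>F. T \<bullet>\<^sub>B ell2_trunc F x) \<longlongrightarrow> T \<bullet>\<^sub>B x) (finite_subsets_at_top UNIV)"
      by (rule isCont_tendsto_compose[OF bop_continuous ell2_trunc_tendsto])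
    then show "((\<lambda>F. cinner (T \<bullet>\<^sub>B ell2_trunc F x) y) \<longlongrightarrow> cinner (T \<bullet>\<^sub>B x) y) (finite_subsets_at_top UNIV)"
      by (rule cinner_tendsto_left)
    have "((\<lambda>F. cinner (ell2_trunc F x) (U \<bullet>\<^sub>B y)) \<longlongrightarrow> cinner x (U \<bullet>\<^sub>B y)) (finite_subsets_at_top UNIV)"
      by (rule cinner_tendsto_left[OF ell2_trunc_tendsto])
    moreover have "\<forall>\<^sub>F F in finite_subsets_at_top (UNIV::'a set).
        cinner (ell2_trunc F x) (U \<bullet>\<^sub>B y) = cinner (T \<bullet>\<^sub>B ell2_trunc F x) y"
    proof (rule eventually_finite_subsets_at_top_weakI)
      fix F :: "'a set" assume F: "finite F"
      have "cinner (ell2_trunc F x) (U \<bullet>\<^sub>B y) = (\<Sum>\<^sub>\<infinity>a\<in>F. ell2_nth x a * cnj (g y a))"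
        unfolding cinner_def by (rule infsum_cong_neutral) (auto simp: ell2_nth_trunc F U f)
      then show "cinner (ell2_trunc F x) (U \<bullet>\<^sub>B y) = cinner (T \<bullet>\<^sub>B ell2_trunc F x) y"
        unfolding ell2_trunc_def[of F x] trunc[OF F] using F by simp
    qed
    ultimately show "((\<lambda>F. cinner (T \<bullet>\<^sub>B ell2_trunc F x) y) \<longlongrightarrow> cinner x (U \<bullet>\<^sub>B y)) (finite_subsets_at_top UNIV)"
      by (rule Lim_transform_eventually)
  qed
  then show ?thesis by blast
qed

lemma bop_adjoint_unique:
  assumes "\<And>x y. cinner (T \<bullet>\<^sub>B x) y = cinner x (U \<bullet>\<^sub>B y)"
  shows "T\<^sup>\<star> = U"
  unfolding invol_bop_def
proof (rule the_equality)
  fix V assume "\<forall>x y. cinner (T \<bullet>\<^sub>B x) y = cinner x (V \<bullet>\<^sub>B y)"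
  then show "V = U" by (intro bop_eqI cinner_ext_right) (simp flip: assms)
qed (simp add: assms)

lemma bop_adjoint: "cinner (T \<bullet>\<^sub>B x) y = cinner x (T\<^sup>\<star> \<bullet>\<^sub>B y)"
proof -
  obtain U where U: "\<And>x y. cinner (T \<bullet>\<^sub>B x) y = cinner x (U \<bullet>\<^sub>B y)"
    using bop_adjoint_exists[of T] by blast
  with bop_adjoint_unique[OF U] show ?thesis by simp
qed

lemma bop_adjoint': "cinner (T\<^sup>\<star> \<bullet>\<^sub>B x) y = cinner x (T \<bullet>\<^sub>B y)"
  by (metis bop_adjoint cinner_commute)

instance bop :: (type) cstar_algebra
proof
  fix S T :: "'a bop" and c d :: complex and r :: real
  show "complex_of_real r *\<^sub>C T = r *\<^sub>R T"
    by (rule bop_eqI) (simp add: scaleR_scaleC_ell2)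
  have sc: "norm (c *\<^sub>C T) \<le> cmod c * norm T" for c and T :: "'a bop"
  proof (rule norm_bop_bound)
    show "norm ((c *\<^sub>C T) \<bullet>\<^sub>B x) \<le> cmod c * norm T * norm x" for x
      using norm_bop_apply[of T x] by (simp add: norm_ell2_scaleC mult.assoc mult_left_mono)
  qed simp
  show "norm (c *\<^sub>C T) = cmod c * norm T"
  proof (cases "c = 0")
    case True
    then show ?thesis using sc[of c T] by simp
  next
    case False
    have "T = inverse c *\<^sub>C c *\<^sub>C T"
      by (intro bop_eqI ell2_eqI) (use False in simp)
    then have "norm T \<le> inverse (cmod c) * norm (c *\<^sub>C T)"
      using sc[of "inverse c" "c *\<^sub>C T"] by (simp add: norm_inverse)
    then have "cmod c * norm T \<le> norm (c *\<^sub>C T)"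
      using False by (simp add: field_simps)
    with sc[of c T] show ?thesis by simp
  qed
  show "(S + T)\<^sup>\<star> = S\<^sup>\<star> + T\<^sup>\<star>"
    by (rule bop_adjoint_unique) (simp add: cinner_add_left cinner_add_right bop_adjoint)
  show "(c *\<^sub>C T)\<^sup>\<star> = cnj c *\<^sub>C T\<^sup>\<star>"
    by (rule bop_adjoint_unique) (simp add: cinner_scaleC_left cinner_scaleC_right bop_adjoint)
  show "(S * T)\<^sup>\<star> = T\<^sup>\<star> * S\<^sup>\<star>"
    by (rule bop_adjoint_unique) (simp add: bop_adjoint)
  show inv: "(T\<^sup>\<star>)\<^sup>\<star> = T" for T :: "'a bop"
    by (rule bop_adjoint_unique) (simp add: bop_adjoint')
  have sq: "(norm T)\<^sup>2 \<le> norm (T\<^sup>\<star> * T)" for T :: "'a bop"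
  proof -
    have "norm (T \<bullet>\<^sub>B x) \<le> sqrt (norm (T\<^sup>\<star> * T)) * norm x" for x
    proof (rule power2_le_imp_le)
      have "complex_of_real ((norm (T \<bullet>\<^sub>B x))\<^sup>2) = cinner x ((T\<^sup>\<star> * T) \<bullet>\<^sub>B x)"
        by (simp only: cinner_self_norm[symmetric] bop_adjoint bop_apply_simps)
      then have "(norm (T \<bullet>\<^sub>B x))\<^sup>2 = cmod (cinner x ((T\<^sup>\<star> * T) \<bullet>\<^sub>B x))"
        by (metis norm_of_real abs_power2)
      also have "\<dots> \<le> norm x * (norm (T\<^sup>\<star> * T) * norm x)"
        by (rule order.trans[OF cinner_bound]) (intro mult_left_mono norm_bop_apply norm_ge_zero)
      finally show "(norm (T \<bullet>\<^sub>B x))\<^sup>2 \<le> (sqrt (norm (T\<^sup>\<star> * T)) * norm x)\<^sup>2"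
        by (simp add: power_mult_distrib) (simp add: power2_eq_square mult_ac)
    qed simp
    then have "norm T \<le> sqrt (norm (T\<^sup>\<star> * T))" by (intro norm_bop_bound) auto
    then have "(norm T)\<^sup>2 \<le> (sqrt (norm (T\<^sup>\<star> * T)))\<^sup>2" by (intro power_mono) auto
    then show ?thesis by simp
  qed
  have le: "norm T \<le> norm (T\<^sup>\<star>)" for T :: "'a bop"
  proof (cases "T = 0")
    case False
    have "norm T * norm T \<le> norm (T\<^sup>\<star>) * norm T"
      using order.trans[OF sq norm_mult_ineq, of T] by (simp add: power2_eq_square)
    with False show ?thesis by simp
  qed simp
  show "norm (T\<^sup>\<star> * T) = (norm T)\<^sup>2"
  proof (rule antisym)
    have "norm (T\<^sup>\<star> * T) \<le> norm (T\<^sup>\<star>) * norm T" by (rule norm_mult_ineq)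
    also have "\<dots> \<le> norm T * norm T" using le[of "T\<^sup>\<star>"] by (intro mult_right_mono) (auto simp: inv)
    finally show "norm (T\<^sup>\<star> * T) \<le> (norm T)\<^sup>2" by (simp add: power2_eq_square)
  qed (rule sq)
qed (intro bop_eqI ell2_eqI; simp add: algebra_simps bop_scaleC)+


text \<open>The partial shift \<open>delta t \<mapsto> delta (f t)\<close> for \<open>t \<in> D\<close>, \<open>delta t \<mapsto> 0\<close> otherwise; used only for
  \<open>f\<close> injective on \<open>D\<close>, where it is a partial isometry.\<close>

definition shift_op :: "'a set \<Rightarrow> ('a \<Rightarrow> 'a) \<Rightarrow> 'a bop" where
  "shift_op D f = (THE T. \<forall>t. T \<bullet>\<^sub>B delta t = (if t \<in> D then delta (f t) else 0))"

lemma ell2_pull_mem: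
  assumes "inj_on g A"
  shows "(\<lambda>u. if u \<in> A then ell2_nth \<xi> (g u) else 0) \<in> {h. (\<lambda>x. (cmod (h x))\<^sup>2) summable_on UNIV}"
    and "norm (Abs_ell2 (\<lambda>u. if u \<in> A then ell2_nth \<xi> (g u) else 0)) \<le> norm \<xi>"
proof -
  have bd: "(\<Sum>u\<in>F. (cmod (if u \<in> A then ell2_nth \<xi> (g u) else 0))\<^sup>2) \<le> (norm \<xi>)\<^sup>2"
    if F: "finite F" for F
  proof -
    have "(\<Sum>u\<in>F. (cmod (if u \<in> A then ell2_nth \<xi> (g u) else 0))\<^sup>2)
        = (\<Sum>u\<in>F \<inter> A. (cmod (ell2_nth \<xi> (g u)))\<^sup>2)"
      using F by (intro sum.mono_neutral_cong_right) auto
    also have "\<dots> = (\<Sum>t\<in>g ` (F \<inter> A). (cmod (ell2_nth \<xi> t))\<^sup>2)"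
      by (subst sum.reindex) (auto intro: inj_on_subset[OF assms])
    also have "\<dots> \<le> (norm \<xi>)\<^sup>2" using F by (intro ell2_finite_sum_le) auto
    finally show ?thesis .
  qed
  show *: "(\<lambda>u. if u \<in> A then ell2_nth \<xi> (g u) else 0) \<in> {h. (\<lambda>x. (cmod (h x))\<^sup>2) summable_on UNIV}"
    by (simp only: mem_Collect_eq) (rule ell2_memI[OF bd])
  show "norm (Abs_ell2 (\<lambda>u. if u \<in> A then ell2_nth \<xi> (g u) else 0)) \<le> norm \<xi>"
    by (rule norm_ell2_leI) (simp_all only: Abs_ell2_inverse[OF *] bd norm_ge_zero)
qed

lemma shift_op_delta:
  assumes inj: "inj_on f D"
  shows "shift_op D f \<bullet>\<^sub>B delta t = (if t \<in> D then delta (f t) else 0)"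
proof -
  define h where "h \<xi> u = (if u \<in> f ` D then ell2_nth \<xi> (inv_into D f u) else 0)" for \<xi> u
  have i: "inj_on (inv_into D f) (f ` D)" by (rule inj_on_inv_into) simp
  have h: "ell2_nth (Abs_ell2 (h \<xi>)) = h \<xi>" for \<xi>
    unfolding h_def by (rule Abs_ell2_inverse[OF ell2_pull_mem(1)[OF i]])
  have "\<exists>T. \<forall>\<xi>. T \<bullet>\<^sub>B \<xi> = Abs_ell2 (h \<xi>)"
  proof (rule bop_blinfunI[where K=1])
    show "norm (Abs_ell2 (h \<xi>)) \<le> norm \<xi> * 1" for \<xi>
      using ell2_pull_mem(2)[OF i, of \<xi>] by (simp add: h_def[abs_def])
  qed (rule ell2_eqI; simp only: h ell2_nth_simps; simp add: h_def)+
  then obtain T where T: "\<And>\<xi>. T \<bullet>\<^sub>B \<xi> = Abs_ell2 (h \<xi>)" by auto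
  have Td: "T \<bullet>\<^sub>B delta t = (if t \<in> D then delta (f t) else 0)" for t
    unfolding T
    by (rule ell2_eqI) (use inj in \<open>auto simp: h h_def delta.rep_eq inv_into_f_f dest: inj_onD\<close>)
  have "shift_op D f = T"
    unfolding shift_op_def
    by (rule the_equality) (auto intro!: bop_eq_on_basis simp: Td)
  with Td show ?thesis by simp
qed

text \<open>The isometry \<open>delta s \<mapsto> delta (g s)\<close> for injective \<open>g\<close>.\<close>

definition ell2_embed :: "('a \<Rightarrow> 'b) \<Rightarrow> 'a ell2 \<Rightarrow> 'b ell2" where
  "ell2_embed g \<xi> = Abs_ell2 (\<lambda>u. if u \<in> range g then ell2_nth \<xi> (inv g u) else 0)"

lemma ell2_nth_embed:
  "ell2_nth (ell2_embed g \<xi>) u = (if u \<in> range g then ell2_nth \<xi> (inv g u) else 0)"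
  unfolding ell2_embed_def
  by (subst Abs_ell2_inverse[OF ell2_pull_mem(1)[OF inj_on_inv_into]]) auto

lemma ell2_embed_delta: "inj g \<Longrightarrow> ell2_embed g (delta s) = delta (g s)"
  by (rule ell2_eqI) (auto simp: ell2_nth_embed delta.rep_eq)


section \<open>Inverse semigroups and their C*-algebras\<close>

text \<open>The standard equational axioms: \<open>x\<^sup>\<star>\<close> is then the unique element with \<open>x * x\<^sup>\<star> * x = x\<close> and
  \<open>x\<^sup>\<star> * x * x\<^sup>\<star> = x\<^sup>\<star>\<close>.\<close>

class inverse_semigroup = semigroup_mult + invol +
  assumes isg_regular: "x * x\<^sup>\<star> * x = x"
    and isg_invol_invol: "(x\<^sup>\<star>)\<^sup>\<star> = x"
    and isg_invol_mult: "(x * y)\<^sup>\<star> = y\<^sup>\<star> * x\<^sup>\<star>"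
    and isg_comm: "(x * x\<^sup>\<star>) * (y * y\<^sup>\<star>) = (y * y\<^sup>\<star>) * (x * x\<^sup>\<star>)"

definition is_zero :: "'p::semigroup_mult \<Rightarrow> bool" where
  "is_zero z \<longleftrightarrow> (\<forall>s. z * s = z \<and> s * z = z)"

definition star_rep :: "('p::inverse_semigroup \<Rightarrow> 'h bop) \<Rightarrow> bool" where
  "star_rep \<pi> \<longleftrightarrow> (\<forall>s t. \<pi> (s * t) = \<pi> s * \<pi> t) \<and> (\<forall>s. \<pi> (s\<^sup>\<star>) = (\<pi> s)\<^sup>\<star>) \<and>
     (\<forall>z. is_zero z \<longrightarrow> \<pi> z = 0)"

text \<open>HOL cannot quantify over the Hilbert spaces of all types inside a formula, so representations act
  on \<open>l2('h)\<close> for a type parameter \<open>'h\<close>. A *-representation is a direct sum of a zero representation and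
  cyclic ones, each of which has Hilbert space dimension at most the maximum of \<open>card P\<close> and \<open>aleph_0\<close>
  and hence, extended by 0, acts on \<open>l2('h)\<close> as soon as \<open>'h\<close> has at least that many elements. For every
  such \<open>'h\<close> the supremum norm below is the one over all *-representations.\<close>

typedef (overloaded) ('p, 'h) rep = "{\<pi> :: 'p::inverse_semigroup \<Rightarrow> 'h bop. star_rep \<pi>}"
  morphisms rep_apply Abs_rep
proof (intro exI[of _ "\<lambda>_. 0"])
  have "(0 :: 'h bop)\<^sup>\<star> = 0" by (rule bop_adjoint_unique) (simp add: cinner_def)
  then show "(\<lambda>_. 0) \<in> {\<pi> :: 'p \<Rightarrow> 'h bop. star_rep \<pi>}" by (simp add: star_rep_def)
qed

text \<open>With the discrete metric, the bounded continuous functions on the set of representations are all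
  bounded functions.\<close>

instantiation rep :: (inverse_semigroup, type) metric_space
begin

definition dist_rep :: "('a, 'b) rep \<Rightarrow> ('a, 'b) rep \<Rightarrow> real"
  where "dist_rep x y = (if x = y then 0 else 1)"
definition uniformity_rep :: "(('a, 'b) rep \<times> ('a, 'b) rep) filter"
  where "uniformity_rep = (INF e\<in>{0<..}. principal {(x, y). dist x y < e})"
definition open_rep :: "('a, 'b) rep set \<Rightarrow> bool"
  where "open_rep S = (\<forall>x\<in>S. \<forall>\<^sub>F (x', y) in uniformity. x' = x \<longrightarrow> y \<in> S)"

instance
  by standard (auto simp: dist_rep_def uniformity_rep_def open_rep_def)

end

lemma rep_open: "open (A :: ('p::inverse_semigroup, 'h) rep set)"
  unfolding open_dist by (intro ballI exI[of _ "1/2"]) (auto simp: dist_rep_def)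

lemma norm_rep_le_1: "norm (rep_apply \<pi> s) \<le> 1"
proof -
  define T where "T = rep_apply \<pi> s"
  have "star_rep (rep_apply \<pi>)" using rep_apply[of \<pi>] by simp
  then have "T * T\<^sup>\<star> * T = T" unfolding T_def star_rep_def by (metis isg_regular)
  then have i: "(T\<^sup>\<star> * T) * (T\<^sup>\<star> * T) = T\<^sup>\<star> * T" by (simp add: mult.assoc)
  have "(T\<^sup>\<star> * T)\<^sup>\<star> = T\<^sup>\<star> * T" by (simp add: invol_mult invol_invol)
  with i have "norm (T\<^sup>\<star> * T) = (norm (T\<^sup>\<star> * T))\<^sup>2"
    using cstar_identity[of "T\<^sup>\<star> * T"] by simp
  then have "(norm T)\<^sup>2 = ((norm T)\<^sup>2)\<^sup>2" by (simp only: cstar_identity)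
  then have "(norm T)\<^sup>2 \<le> 1" by (cases "norm T = 0") (auto simp: power2_eq_square)
  then show ?thesis unfolding T_def by (simp add: abs_square_le_1)
qed

type_synonym ('p, 'h) full = "('p, 'h) rep \<Rightarrow>\<^sub>C 'h bop"

definition l1 :: "('p \<Rightarrow> complex) set" where
  "l1 = {f. (\<lambda>s. cmod (f s)) summable_on UNIV}"

definition l1_hat :: "('p::inverse_semigroup \<Rightarrow> complex) \<Rightarrow> ('p, 'h) full" where
  "l1_hat f = Bcontfun (\<lambda>\<pi>. \<Sum>\<^sub>\<infinity>s. f s *\<^sub>C rep_apply \<pi> s)"

lemma l1_hat_apply:
  assumes "f \<in> l1"
  shows "apply_bcontfun (l1_hat f) \<pi> = (\<Sum>\<^sub>\<infinity>s. f s *\<^sub>C rep_apply \<pi> s)"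
  unfolding l1_hat_def
proof (subst Bcontfun_inverse)
  have s: "(\<lambda>s. cmod (f s)) summable_on UNIV" using assms by (simp add: l1_def)
  have le: "norm (f s *\<^sub>C rep_apply \<pi> s) \<le> cmod (f s)" for s and \<pi> :: "('a, 'h) rep"
    using mult_left_mono[OF norm_rep_le_1[of \<pi> s], of "cmod (f s)"] by (simp add: norm_scaleC)
  show "(\<lambda>\<pi> :: ('a, 'h) rep. \<Sum>\<^sub>\<infinity>s. f s *\<^sub>C rep_apply \<pi> s) \<in> bcontfun"
  proof (rule bcontfun_normI)
    show "continuous_on UNIV (\<lambda>\<pi> :: ('a, 'h) rep. \<Sum>\<^sub>\<infinity>s. f s *\<^sub>C rep_apply \<pi> s)"
      by (simp add: continuous_on_open_vimage rep_open)
    fix \<pi> :: "('a, 'h) rep"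
    have sm: "(\<lambda>s. norm (f s *\<^sub>C rep_apply \<pi> s)) summable_on UNIV"
      by (rule summable_on_comparison_test[OF s]) (auto simp: le)
    have "norm (\<Sum>\<^sub>\<infinity>s. f s *\<^sub>C rep_apply \<pi> s) \<le> (\<Sum>\<^sub>\<infinity>s. norm (f s *\<^sub>C rep_apply \<pi> s))"
      by (rule norm_infsum_bound[OF sm])
    also have "\<dots> \<le> (\<Sum>\<^sub>\<infinity>s. cmod (f s))" by (rule infsum_mono[OF sm s le])
    finally show "norm (\<Sum>\<^sub>\<infinity>s. f s *\<^sub>C rep_apply \<pi> s) \<le> (\<Sum>\<^sub>\<infinity>s. cmod (f s))" .
  qed
qed simp

lemma norm_l1_hat:
  assumes "f \<in> l1"
  shows "norm (l1_hat f :: ('p::inverse_semigroup, 'h) full) =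
    (SUP \<pi> :: ('p, 'h) rep. norm (\<Sum>\<^sub>\<infinity>s. f s *\<^sub>C rep_apply \<pi> s))"
  by (simp add: norm_bcontfun_def dist_bcontfun.rep_eq l1_hat_apply[OF assms])

text \<open>By \<open>norm_l1_hat\<close>, \<open>l1_hat\<close> is isometric for the supremum norm over all *-representations, and its
  target is a Banach space; so the closure of its image is the completion of \<open>l1(P)\<close> in that norm.\<close>

definition full_cstar :: "('p::inverse_semigroup, 'h) full set" where
  "full_cstar = closure (l1_hat ` l1)"

definition full_gen :: "'p::inverse_semigroup \<Rightarrow> ('p, 'h) full" where
  "full_gen s = l1_hat (\<lambda>t. if t = s then 1 else 0)"

lemma full_gen_apply: "apply_bcontfun (full_gen s) \<pi> = rep_apply \<pi> s"
proof -
  have "(\<lambda>t. if t = s then 1 else 0) \<in> l1"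
    unfolding l1_def
    by (auto intro!: finite_nonzero_values_imp_summable_on intro: finite_subset[of _ "{s}"])
  then have "apply_bcontfun (full_gen s) \<pi> = (\<Sum>\<^sub>\<infinity>t. (if t = s then 1 else 0) *\<^sub>C rep_apply \<pi> t)"
    unfolding full_gen_def by (rule l1_hat_apply)
  also have "\<dots> = (\<Sum>\<^sub>\<infinity>t\<in>{s}. rep_apply \<pi> t)"
    by (rule infsum_cong_neutral) (auto intro!: bop_eqI ell2_eqI)
  finally show ?thesis by simp
qed

definition left_regular :: "'p::inverse_semigroup \<Rightarrow> 'p bop" where
  "left_regular s = shift_op {t. s\<^sup>\<star> * s * t = t} (\<lambda>t. s * t)"

lemma left_regular_delta:
  "left_regular s \<bullet>\<^sub>B delta t = (if s\<^sup>\<star> * s * t = t then delta (s * t) else 0)"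
  unfolding left_regular_def
proof (subst shift_op_delta)
  show "inj_on (\<lambda>t. s * t) {t. s\<^sup>\<star> * s * t = t}"
  proof (rule inj_onI)
    fix t u
    assume t: "t \<in> {t. s\<^sup>\<star> * s * t = t}" and u: "u \<in> {t. s\<^sup>\<star> * s * t = t}" and "s * t = s * u"
    from this(3) have "s\<^sup>\<star> * s * t = s\<^sup>\<star> * s * u" by (simp add: mult.assoc)
    with t u show "t = u" by simp
  qed
qed simp

definition reduced_cstar :: "'p::inverse_semigroup bop set" where
  "reduced_cstar = cstar_generated (range left_regular)"

datatype 'p adjoin0 = Zero0 | Elt 'p

instantiation adjoin0 :: (inverse_semigroup) inverse_semigroup
begin

fun times_adjoin0 :: "'a adjoin0 \<Rightarrow> 'a adjoin0 \<Rightarrow> 'a adjoin0" where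
  "Elt x * Elt y = Elt (x * y)"
| "Zero0 * y = Zero0"
| "x * Zero0 = Zero0"

fun invol_adjoin0 :: "'a adjoin0 \<Rightarrow> 'a adjoin0" where
  "invol_adjoin0 (Elt x) = Elt (x\<^sup>\<star>)"
| "invol_adjoin0 Zero0 = Zero0"

lemma adjoin0_mult_Zero0 [simp]: "x * Zero0 = (Zero0 :: 'a adjoin0)"
  by (cases x) auto

instance
proof
  fix x y z :: "'a adjoin0"
  show "x * y * z = x * (y * z)"
    by (cases x; cases y; cases z) (auto simp: mult.assoc)
  show "x * x\<^sup>\<star> * x = x"
    by (cases x) (auto simp: isg_regular)
  show "(x\<^sup>\<star>)\<^sup>\<star> = x"
    by (cases x) (auto simp: isg_invol_invol)
  show "(x * y)\<^sup>\<star> = y\<^sup>\<star> * x\<^sup>\<star>"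
    by (cases x; cases y) (auto simp: isg_invol_mult)
  show "x * x\<^sup>\<star> * (y * y\<^sup>\<star>) = y * y\<^sup>\<star> * (x * x\<^sup>\<star>)"
    by (cases x; cases y) (auto simp: isg_comm)
qed

end


lemma star_rep_adjoin0:
  "star_rep \<pi> \<longleftrightarrow> \<pi> Zero0 = 0 \<and> (\<forall>s t. \<pi> (Elt (s * t)) = \<pi> (Elt s) * \<pi> (Elt t)) \<and>
     (\<forall>s. \<pi> (Elt (s\<^sup>\<star>)) = (\<pi> (Elt s))\<^sup>\<star>)"
proof -
  have z: "is_zero z \<longleftrightarrow> z = Zero0" for z :: "'a adjoin0"
    unfolding is_zero_def by (metis adjoin0_mult_Zero0 times_adjoin0.simps(2))
  have "(0 :: 'b bop)\<^sup>\<star> = 0" by (rule bop_adjoint_unique) (simp add: cinner_def)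
  moreover have all: "(\<forall>x. P x) \<longleftrightarrow> P Zero0 \<and> (\<forall>s. P (Elt s))" for P :: "'a adjoin0 \<Rightarrow> bool"
    by (metis adjoin0.exhaust)
  ultimately show ?thesis unfolding star_rep_def z by (subst (1 2 3) all) (auto simp: all)
qed


section \<open>Presentations of inverse monoids\<close>

datatype 'g letter = Gen 'g | GenStar 'g

fun letter_star :: "'g letter \<Rightarrow> 'g letter" where
  "letter_star (Gen g) = GenStar g"
| "letter_star (GenStar g) = Gen g"

definition word_star :: "'g letter list \<Rightarrow> 'g letter list" where
  "word_star u = rev (map letter_star u)"

lemma word_star_simps [simp]:
  "word_star [] = []" "word_star (u @ v) = word_star v @ word_star u" "word_star (word_star u) = u"
proof -
  have [simp]: "letter_star (letter_star l) = l" for l :: "'g letter" by (cases l) auto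
  show "word_star (word_star u) = u" unfolding word_star_def by (induction u) simp_all
qed (simp_all add: word_star_def)

text \<open>The congruence on words generated by the relations \<open>R\<close> together with the identities of
  inverse semigroups; the empty word is the unit. In both presentations below the unit is already a product
  of generators (an idempotent isometry equals 1), so admitting it adds no element.\<close>

inductive presented :: "('g letter list \<Rightarrow> 'g letter list \<Rightarrow> bool) \<Rightarrow> 'g letter list \<Rightarrow> 'g letter list \<Rightarrow> bool"
  for R where
  rel: "R u v \<Longrightarrow> presented R u v"
| regular: "presented R (u @ word_star u @ u) u"
| comm: "presented R ((u @ word_star u) @ (v @ word_star v)) ((v @ word_star v) @ (u @ word_star u))"
| refl: "presented R u u"
| sym: "presented R u v \<Longrightarrow> presented R v u"
| trans: "presented R u v \<Longrightarrow> presented R v w \<Longrightarrow> presented R u w"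
| append: "presented R u u' \<Longrightarrow> presented R v v' \<Longrightarrow> presented R (u @ v) (u' @ v')"
| star: "presented R u v \<Longrightarrow> presented R (word_star u) (word_star v)"

lemma equivp_presented: "equivp (presented R)"
proof (rule equivpI)
  show "reflp (presented R)" by (rule reflpI) (rule presented.refl)
  show "symp (presented R)" by (rule sympI) (rule presented.sym)
  show "transp (presented R)" by (rule transpI) (rule presented.trans)
qed


section \<open>The inverse semigroups S* and W of a left cancellative semigroup with unit\<close>

class left_cancellative_monoid = monoid_mult +
  assumes left_cancel: "a * b = a * c \<Longrightarrow> b = c"

inductive sstar_rel :: "'s::left_cancellative_monoid letter list \<Rightarrow> 's letter list \<Rightarrow> bool" where
  "sstar_rel [Gen p, Gen q] [Gen (p * q)]"
| "sstar_rel [GenStar p, Gen p] []"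

quotient_type (overloaded) 's sstar =
    "'s::left_cancellative_monoid letter list" / "presented sstar_rel"
  by (rule equivp_presented)

instantiation sstar :: (left_cancellative_monoid) "{monoid_mult, inverse_semigroup}"
begin

lift_definition one_sstar :: "'a sstar" is "[]" .
lift_definition times_sstar :: "'a sstar \<Rightarrow> 'a sstar \<Rightarrow> 'a sstar" is "(@)"
  by (rule presented.append)
lift_definition invol_sstar :: "'a sstar \<Rightarrow> 'a sstar" is word_star
  by (rule presented.star)

instance
proof
  fix x y z :: "'a sstar"
  show "1 * x = x" by transfer (simp add: presented.refl)
  show "x * 1 = x" by transfer (simp add: presented.refl)
  show "x * y * z = x * (y * z)" by transfer (simp add: presented.refl)
  show "x * x\<^sup>\<star> * x = x" by transfer (use presented.regular in simp)
  show "(x\<^sup>\<star>)\<^sup>\<star> = x" by transfer (simp add: presented.refl)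
  show "(x * y)\<^sup>\<star> = y\<^sup>\<star> * x\<^sup>\<star>" by transfer (simp add: presented.refl)
  show "x * x\<^sup>\<star> * (y * y\<^sup>\<star>) = y * y\<^sup>\<star> * (x * x\<^sup>\<star>)" by transfer (rule presented.comm)
qed

end

lift_definition v_gen :: "'s::left_cancellative_monoid \<Rightarrow> 's sstar" is "\<lambda>p. [Gen p]" .

lemma v_mult: "v_gen p * v_gen q = v_gen (p * q)"
  by transfer (simp add: presented.rel sstar_rel.intros)

lemma v_isometry: "(v_gen p)\<^sup>\<star> * v_gen p = 1"
  by transfer (simp add: word_star_def presented.rel sstar_rel.intros)

text \<open>Since \<open>a\<close> or \<open>b\<close> may be 1, iterating \<open>X \<mapsto> b\<^sup>-\<^sup>1(aX)\<close> from \<open>S\<close> yields all sets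
  \<open>a\<^sub>n\<^sup>-\<^sup>1(\<dots>a\<^sub>2\<^sup>-\<^sup>1(a\<^sub>1S))\<close>.\<close>

inductive_set constructible :: "'s::left_cancellative_monoid set set" where
  empty: "{} \<in> constructible"
| top: "UNIV \<in> constructible"
| step: "X \<in> constructible \<Longrightarrow> (*) b -` ((*) a ` X) \<in> constructible"

lemma constructible_image: "X \<in> constructible \<Longrightarrow> (*) a ` X \<in> constructible"
  using constructible.step[of X 1 a] by (simp add: vimage_def)

lemma constructible_vimage: "X \<in> constructible \<Longrightarrow> (*) a -` X \<in> constructible"
  using constructible.step[of X a 1] by simp

lemma constructible_inter:
  "X \<in> constructible \<Longrightarrow> Y \<in> constructible \<Longrightarrow> X \<inter> Y \<in> constructible"
proof (induction X arbitrary: Y rule: constructible.induct)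
  case (step X b a)
  have "(*) b -` ((*) a ` X) \<inter> Y = (*) b -` ((*) a ` (X \<inter> (*) a -` ((*) b ` Y)))"
  proof (intro set_eqI iffI)
    fix x assume "x \<in> (*) b -` ((*) a ` X) \<inter> Y"
    then obtain z where z: "z \<in> X" "b * x = a * z" "x \<in> Y" by auto
    then have "a * z \<in> (*) b ` Y" by (metis imageI)
    with z show "x \<in> (*) b -` ((*) a ` (X \<inter> (*) a -` ((*) b ` Y)))" by auto
  qed (auto dest: left_cancel)
  moreover have "X \<inter> (*) a -` ((*) b ` Y) \<in> constructible"
    by (intro step.IH constructible_vimage constructible_image step.prems)
  ultimately show ?case by (simp add: constructible.step)
qed (auto intro: constructible.empty)

typedef (overloaded) 's cideal = "constructible :: 's::left_cancellative_monoid set set"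
  by (rule exI[of _ UNIV]) (rule constructible.top)

setup_lifting type_definition_cideal

lift_definition cideal_empty :: "'s::left_cancellative_monoid cideal" is "{}"
  by (rule constructible.empty)
lift_definition cideal_top :: "'s::left_cancellative_monoid cideal" is UNIV
  by (rule constructible.top)
lift_definition cideal_image :: "'s::left_cancellative_monoid \<Rightarrow> 's cideal \<Rightarrow> 's cideal"
  is "\<lambda>s X. (*) s ` X" by (rule constructible_image)
lift_definition cideal_inter :: "'s::left_cancellative_monoid cideal \<Rightarrow> 's cideal \<Rightarrow> 's cideal"
  is "(\<inter>)" by (rule constructible_inter)

declare [[typedef_overloaded]]

datatype 's wgen = WIsom 's | WProj "'s::left_cancellative_monoid cideal"

declare [[typedef_overloaded = false]]

text \<open>The last two clauses say that the projection of the empty ideal is a zero element.\<close>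

inductive w_rel :: "'s::left_cancellative_monoid wgen letter list \<Rightarrow> 's wgen letter list \<Rightarrow> bool" where
  isometry: "w_rel [GenStar (WIsom s), Gen (WIsom s)] []"
| selfadjoint: "w_rel [GenStar (WProj X)] [Gen (WProj X)]"
| idempotent: "w_rel [Gen (WProj X), Gen (WProj X)] [Gen (WProj X)]"
| mult: "w_rel [Gen (WIsom (s * t))] [Gen (WIsom s), Gen (WIsom t)]"
| conj: "w_rel [Gen (WIsom s), Gen (WProj X), GenStar (WIsom s)] [Gen (WProj (cideal_image s X))]"
| unit: "w_rel [Gen (WProj cideal_top)] []"
| inter: "w_rel [Gen (WProj (cideal_inter X Y))] [Gen (WProj X), Gen (WProj Y)]"
| zero_left: "w_rel [Gen (WProj cideal_empty), l] [Gen (WProj cideal_empty)]"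
| zero_right: "w_rel [l, Gen (WProj cideal_empty)] [Gen (WProj cideal_empty)]"

quotient_type (overloaded) 's winv =
    "'s::left_cancellative_monoid wgen letter list" / "presented w_rel"
  by (rule equivp_presented)

instantiation winv :: (left_cancellative_monoid) "{monoid_mult, inverse_semigroup}"
begin

lift_definition one_winv :: "'a winv" is "[]" .
lift_definition times_winv :: "'a winv \<Rightarrow> 'a winv \<Rightarrow> 'a winv" is "(@)"
  by (rule presented.append)
lift_definition invol_winv :: "'a winv \<Rightarrow> 'a winv" is word_star
  by (rule presented.star)

instance
proof
  fix x y z :: "'a winv"
  show "1 * x = x" by transfer (simp add: presented.refl)
  show "x * 1 = x" by transfer (simp add: presented.refl)
  show "x * y * z = x * (y * z)" by transfer (simp add: presented.refl)
  show "x * x\<^sup>\<star> * x = x" by transfer (use presented.regular in simp)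
  show "(x\<^sup>\<star>)\<^sup>\<star> = x" by transfer (simp add: presented.refl)
  show "(x * y)\<^sup>\<star> = y\<^sup>\<star> * x\<^sup>\<star>" by transfer (simp add: presented.refl)
  show "x * x\<^sup>\<star> * (y * y\<^sup>\<star>) = y * y\<^sup>\<star> * (x * x\<^sup>\<star>)" by transfer (rule presented.comm)
qed

end

lift_definition w_gen :: "'s::left_cancellative_monoid \<Rightarrow> 's winv" is "\<lambda>s. [Gen (WIsom s)]" .

lift_definition e_gen :: "'s::left_cancellative_monoid cideal \<Rightarrow> 's winv" is "\<lambda>X. [Gen (WProj X)]" .

lemma word_star_map: "word_star (map (map_letter f) u) = map (map_letter f) (word_star u)"
proof -
  have "letter_star (map_letter f l) = map_letter f (letter_star l)" for l by (cases l) auto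
  then show ?thesis by (simp add: word_star_def rev_map comp_def)
qed

lift_definition sstar_to_W :: "'s::left_cancellative_monoid sstar \<Rightarrow> 's winv"
  is "map (map_letter WIsom)"
proof -
  fix x y :: "'s letter list"
  assume "presented sstar_rel x y"
  then show "presented w_rel (map (map_letter WIsom) x) (map (map_letter WIsom) y)"
  proof induction
    case (rel x y)
    then show ?case
    proof cases
      case (1 p q)
      then show ?thesis by (simp add: presented.sym[OF presented.rel[where R=w_rel, OF w_rel.mult]])
    next
      case (2 p)
      then show ?thesis by (simp add: presented.rel[where R=w_rel, OF w_rel.isometry])
    qed
  next
    case (regular u)
    show ?case
      using presented.regular[of w_rel "map (map_letter WIsom) u"] by (simp add: word_star_map)
  next
    case (comm u v)
    show ?case
      using presented.comm[of w_rel "map (map_letter WIsom) u" "map (map_letter WIsom) v"]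
      by (simp add: word_star_map)
  next
    case (refl u)
    show ?case by (rule presented.refl)
  next
    case (sym u v)
    show ?case by (rule presented.sym[OF sym.IH])
  next
    case (trans u v w)
    show ?case by (rule presented.trans[OF trans.IH])
  next
    case (append u u' v v')
    show ?case using presented.append[OF append.IH] by simp
  next
    case (star u v)
    show ?case using presented.star[OF star.IH] by (simp add: word_star_map)
  qed
qed

lemma sstar_to_W_v: "sstar_to_W (v_gen s) = w_gen s"
  by transfer (simp add: presented.refl)

lemma sstar_to_W_mult: "sstar_to_W (x * y) = sstar_to_W x * sstar_to_W y"
  by transfer (simp add: presented.refl)

lemma sstar_to_W_invol: "sstar_to_W (x\<^sup>\<star>) = (sstar_to_W x)\<^sup>\<star>"
  by transfer (simp add: presented.refl word_star_map)

text \<open>\<open>W\<close> has the zero element \<open>e_gen cideal_empty\<close>, which need not be the image of an element of \<open>S*\<close>, while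
  elements of \<open>S*\<close> may be identified with it; so the relation \<open>\<approx>\<close> lives on \<open>S*\<close> with a zero adjoined.
  By \<open>star_rep_adjoin0\<close> the *-representations of the latter are the *-preserving homomorphisms of
  \<open>S*\<close>, without further condition.\<close>

fun sstar0_to_W :: "'s::left_cancellative_monoid sstar adjoin0 \<Rightarrow> 's winv" where
  "sstar0_to_W (Elt x) = sstar_to_W x"
| "sstar0_to_W Zero0 = e_gen cideal_empty"

definition approx_R5 :: "'s::left_cancellative_monoid sstar adjoin0 \<Rightarrow> 's sstar adjoin0 \<Rightarrow> bool"
    (infix "\<approx>\<^sub>R\<^sub>5" 50) where
  "x \<approx>\<^sub>R\<^sub>5 y \<longleftrightarrow> sstar0_to_W x = sstar0_to_W y"


section \<open>The C*-algebras in the diagram\<close>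

definition Cstar_sstar :: "('s::left_cancellative_monoid sstar adjoin0, 'h) full set" where
  "Cstar_sstar = full_cstar"

definition Cstar_S :: "('s::left_cancellative_monoid winv, 'h) full set" where
  "Cstar_S = full_cstar"

definition Cstar_r_sstar :: "'s::left_cancellative_monoid sstar bop set" where
  "Cstar_r_sstar = reduced_cstar"

definition S_isometry :: "'s::left_cancellative_monoid \<Rightarrow> 's bop" where
  "S_isometry p = shift_op UNIV (\<lambda>q. p * q)"

lemma S_isometry_delta: "S_isometry p \<bullet>\<^sub>B delta q = delta (p * q)"
  unfolding S_isometry_def by (subst shift_op_delta) (auto intro!: injI dest: left_cancel)

definition Cstar_r_S :: "'s::left_cancellative_monoid bop set" where
  "Cstar_r_S = cstar_generated (range S_isometry)"

definition ideal_J :: "('s::left_cancellative_monoid sstar adjoin0, 'h) full set" where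
  "ideal_J = closed_ideal_generated Cstar_sstar {full_gen x - full_gen y |x y. x \<approx>\<^sub>R\<^sub>5 y}"

definition ideal_J_r :: "'s::left_cancellative_monoid sstar bop set" where
  "ideal_J_r = {T \<in> Cstar_r_sstar. \<forall>\<xi>. T \<bullet>\<^sub>B ell2_embed v_gen \<xi> = 0}"

end

(*
  All four maps are globally defined contractive linear maps that are multiplicative on the relevant algebra:
  precomposition with S* -> W, and compressions to subspaces spanned by basis vectors. That each of them
  is onto needs only that the image of a *-homomorphism of operator algebras is closed. This follows
  without spectral theory: replacing a by a (1 - a*a / M)^n, with n about M / (8 |f a|^2), changes f a
  little and brings the norm of a down to 2 |f a|, so elements of the closure lift by successive
  approximation.

  For exactness of the upper row let a lie outside J. The elements (1 - h / M)^n, with h a finite sum of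
  b*b, b in J, play the role of 1 - u for an approximate unit u of J; applied to suitable vectors they give
  vector functionals that are small on J and bounded below on a*a. A limit point vanishes on J, and its
  GNS representation factors through W and does not kill a. A transfinite Cholesky decomposition
  realizes that representation inside l2('h).
*)

theory Submission
  imports Defs
begin

section \<open>Vectors and operators with prescribed inner products\<close>

text \<open>The obstacle is that all representations act on the one space l2('h): neither the
  quotient by J nor an abstract GNS completion comes with a space of its own, so whatever separates
  \<open>a\<close> from J must be found inside l2('h). There is room because the GNS space of a
  functional on the algebra of an inverse semigroup P with unit is the closed span of the classes of
  the elements of P. It needs no more basis vectors than P has elements, an injection of P into 'h
  provides them, and a well-ordering of P says which basis vector is fresh. Limits are taken of
  functionals only, for pointwise convergence, where Tychonoff's theorem gives compactness.
  Everything that the GNS construction uses about a functional is therefore stated as a closed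
  condition. Powers of 1 - h / M replace functional calculus because they can be written inside an
  algebra without unit, are respected by *-homomorphisms, change an element only within the ideal
  that contains h, and can be estimated vector by vector. Adjoining a zero to S* makes W a genuine
  quotient: every projection of W is the zero or the image of a word in the isometries.\<close>

lemma cinner_zero [simp]: "cinner 0 f = 0" "cinner f 0 = 0"
  by (simp_all add: cinner_def)

lemma ell2_scaleC_left_distrib: "(c + d) *\<^sub>C (f :: 'a ell2) = c *\<^sub>C f + d *\<^sub>C f"
  and ell2_scaleC_right_distrib: "c *\<^sub>C (f + g :: 'a ell2) = c *\<^sub>C f + c *\<^sub>C g"
  and ell2_scaleC_scaleC [simp]: "c *\<^sub>C d *\<^sub>C (f :: 'a ell2) = (c * d) *\<^sub>C f"
  and ell2_scaleC_zero [simp]: "0 *\<^sub>C f = 0" "c *\<^sub>C (0 :: 'a ell2) = 0"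
  and ell2_scaleC_one [simp]: "1 *\<^sub>C f = f"
  by (rule ell2_eqI; simp add: algebra_simps)+

lemma ell2_scaleC_sum: "c *\<^sub>C (\<Sum>x\<in>F. f x :: 'a ell2) = (\<Sum>x\<in>F. c *\<^sub>C f x)"
  by (induction F rule: infinite_finite_induct) (auto simp: ell2_scaleC_right_distrib)

lemma cinner_sum_left: "cinner (\<Sum>x\<in>F. f x) g = (\<Sum>x\<in>F. cinner (f x) g)"
  by (induction F rule: infinite_finite_induct) (auto simp: cinner_add_left)

lemma cinner_sum_right: "cinner f (\<Sum>x\<in>F. g x) = (\<Sum>x\<in>F. cinner f (g x))"
  by (induction F rule: infinite_finite_induct) (auto simp: cinner_add_right)

lemma cinner_sum_scaleC:
  "cinner (\<Sum>x\<in>F. c x *\<^sub>C f x) (\<Sum>y\<in>G. d y *\<^sub>C g y) =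
    (\<Sum>x\<in>F. \<Sum>y\<in>G. c x * cnj (d y) * cinner (f x) (g y))"
  unfolding cinner_sum_left cinner_scaleC_left
  by (simp add: cinner_sum_right cinner_scaleC_right sum_distrib_left mult_ac)

lemma norm_delta: "norm (delta a) = 1"
proof -
  have "complex_of_real ((norm (delta a))\<^sup>2) = complex_of_real 1"
    unfolding cinner_self_norm[symmetric] cinner_delta_right by (simp add: delta.rep_eq)
  then have "(norm (delta a))\<^sup>2 = 1" by (simp only: of_real_eq_iff)
  then show ?thesis using norm_ge_zero[of "delta a"] by (simp add: power2_eq_1_iff)
qed

lemma cinner_tendsto_right:
  assumes "(f \<longlongrightarrow> l) F" shows "((\<lambda>n. cinner y (f n)) \<longlongrightarrow> cinner y l) F"
  using tendsto_cnj[OF cinner_tendsto_left[OF assms, of y]] by (simp flip: cinner_commute)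

lemma ell2_norm_add_scaleC:
  "(norm (w + t *\<^sub>C u))\<^sup>2 = (norm w)\<^sup>2 + 2 * Re (t * cinner u w) + (cmod t)\<^sup>2 * (norm u)\<^sup>2"
proof -
  have "Re (cinner w (t *\<^sub>C u)) = Re (cinner (t *\<^sub>C u) w)"
    by (subst cinner_commute) simp
  then have "inner w (t *\<^sub>C u) = Re (t * cinner u w)"
    by (simp add: inner_ell2_def cinner_scaleC_left)
  then show ?thesis
    using dot_norm[of w "t *\<^sub>C u"] by (simp add: norm_ell2_scaleC power_mult_distrib field_simps)
qed

lemma cinner_self_eq_0: "cinner f f = 0 \<longleftrightarrow> f = 0"
  by (simp add: cinner_self_norm)

text \<open>The functional is given by its graph, so that it need not be introduced as a function on a subspace.\<close>

lemma riesz_graph: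
  fixes \<Gamma> :: "('a ell2 \<times> complex) set"
  assumes zero: "(0, 0) \<in> \<Gamma>"
    and add: "\<And>u a v b. (u, a) \<in> \<Gamma> \<Longrightarrow> (v, b) \<in> \<Gamma> \<Longrightarrow> (u + v, a + b) \<in> \<Gamma>"
    and scale: "\<And>u a c. (u, a) \<in> \<Gamma> \<Longrightarrow> (c *\<^sub>C u, c * a) \<in> \<Gamma>"
    and bound: "\<And>u a. (u, a) \<in> \<Gamma> \<Longrightarrow> cmod a \<le> C * norm u" and C: "0 \<le> C"
  shows "\<exists>w. (\<forall>(u, a)\<in>\<Gamma>. cinner u w = a) \<and> norm w \<le> C \<and>
    (\<forall>v. (\<forall>(u, a)\<in>\<Gamma>. cinner u v = 0) \<longrightarrow> cinner w v = 0)"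
proof -
  \<comment> \<open>If \<open>w\<close> represents the functional then \<open>G (u, a)\<close> is |u
    - w|^2 - |w|^2, so minimizing sequences should converge to \<open>w\<close>.\<close>
  define G where "G = (\<lambda>(u :: 'a ell2, a). (norm u)\<^sup>2 - 2 * Re a)"
  define g where "g = (INF p\<in>\<Gamma>. G p)"
  have lower: "- C\<^sup>2 \<le> G p" if "p \<in> \<Gamma>" for p
  proof -
    obtain u a where p: "p = (u, a)" by (cases p)
    have "Re a \<le> C * norm u" using bound[of u a] that p complex_Re_le_cmod[of a] by auto
    moreover have "0 \<le> (norm u - C)\<^sup>2" by simp
    ultimately show ?thesis by (simp add: p G_def power2_diff mult.commute)
  qed
  have bdd: "bdd_below (G ` \<Gamma>)" using lower by (auto intro: bdd_belowI[where m="- C\<^sup>2"])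
  have ne: "\<Gamma> \<noteq> {}" using zero by auto
  have g_le: "g \<le> G p" if "p \<in> \<Gamma>" for p
    unfolding g_def by (rule cINF_lower[OF bdd that])
  have "\<exists>p\<in>\<Gamma>. G p < g + 1 / (real n + 1)" for n
    using cINF_less_iff[OF ne bdd, of "g + 1 / (real n + 1)"] by (simp add: g_def[symmetric])
  then obtain p where p: "\<And>n. p n \<in> \<Gamma>" "\<And>n. G (p n) < g + 1 / (real n + 1)" by metis
  define u where "u n = fst (p n)" for n
  define a where "a n = snd (p n)" for n
  have ua: "(u n, a n) \<in> \<Gamma>" "(norm (u n))\<^sup>2 - 2 * Re (a n) < g + 1 / (real n + 1)" for n
    using p[of n] by (auto simp: u_def a_def G_def split: prod.splits)
  \<comment> \<open>Parallelogram law: the midpoint also lies in \<open>\<Gamma>\<close>, so its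
    value of \<open>G\<close> is at least the infimum \<open>g\<close>.\<close>
  have near: "(norm (u n - u m))\<^sup>2 \<le> 2 / (real n + 1) + 2 / (real m + 1)" for n m
  proof -
    have "((1/2) *\<^sub>C (u n + u m), (1/2) * (a n + a m)) \<in> \<Gamma>"
      by (intro scale add ua)
    from g_le[OF this] have "4 * g \<le> (norm (u n + u m))\<^sup>2 - 4 * Re (a n + a m)"
      by (simp add: G_def norm_ell2_scaleC power_mult_distrib field_simps)
    moreover have "(norm (u n - u m))\<^sup>2 + (norm (u n + u m))\<^sup>2 = 2 * (norm (u n))\<^sup>2 + 2 * (norm (u m))\<^sup>2"
      by (simp add: power2_norm_eq_inner inner_diff inner_add inner_commute)
    ultimately show ?thesis using ua(2)[of n] ua(2)[of m] by simp
  qed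
  have "Cauchy u"
  proof (rule metric_CauchyI)
    fix e :: real assume e: "0 < e"
    obtain N where N: "4 / e\<^sup>2 < real N" using reals_Archimedean2 by blast
    have "dist (u m) (u n) < e" if "m \<ge> N" "n \<ge> N" for m n
    proof -
      have "4 < e\<^sup>2 * (real N + 1)"
        using N e by (simp add: field_simps) (smt (verit) zero_less_power)
      then have "2 / (real N + 1) < e\<^sup>2 / 2" by (simp add: field_simps)
      moreover have "2 / (real n + 1) \<le> 2 / (real N + 1)" "2 / (real m + 1) \<le> 2 / (real N + 1)"
        using that by (auto intro!: divide_left_mono)
      ultimately have "(norm (u m - u n))\<^sup>2 < e\<^sup>2" using near[of m n] by linarith
      then show ?thesis using e by (simp add: dist_norm power2_less_imp_less)
    qed
    then show "\<exists>M. \<forall>m\<ge>M. \<forall>n\<ge>M. dist (u m) (u n) < e" by blast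
  qed
  then obtain w where w: "u \<longlonglongrightarrow> w" by (auto simp: Cauchy_convergent_iff convergent_def)
  have repr: "cinner v w = b" if vb: "(v, b) \<in> \<Gamma>" for v b
  proof -
    define \<beta> where "\<beta> = cinner v w - b"
    have ineq: "0 \<le> 2 * Re (t * \<beta>) + (cmod t)\<^sup>2 * (norm v)\<^sup>2" for t
    proof -
      have "- (1 / (real n + 1)) \<le> 2 * Re (t * cinner v (u n)) + (cmod t)\<^sup>2 * (norm v)\<^sup>2 - 2 * Re (t * b)" for n
      proof -
        have "(u n + t *\<^sub>C v, a n + t * b) \<in> \<Gamma>" by (intro add scale ua vb)
        from g_le[OF this] ua(2)[of n] show ?thesis
          by (simp add: G_def ell2_norm_add_scaleC)
      qed
      moreover have "(\<lambda>n. - (1 / (real n + 1))) \<longlonglongrightarrow> - 0"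
        by (intro tendsto_minus) (use LIMSEQ_inverse_real_of_nat in \<open>simp add: inverse_eq_divide add.commute\<close>)
      moreover have "(\<lambda>n. 2 * Re (t * cinner v (u n)) + (cmod t)\<^sup>2 * (norm v)\<^sup>2 - 2 * Re (t * b))
          \<longlonglongrightarrow> 2 * Re (t * cinner v w) + (cmod t)\<^sup>2 * (norm v)\<^sup>2 - 2 * Re (t * b)"
        by (intro tendsto_intros cinner_tendsto_right w)
      ultimately have "- 0 \<le> 2 * Re (t * cinner v w) + (cmod t)\<^sup>2 * (norm v)\<^sup>2 - 2 * Re (t * b)"
        by (intro LIMSEQ_le[where X="\<lambda>n. - (1 / (real n + 1))"]) auto
      then show ?thesis by (simp add: \<beta>_def algebra_simps)
    qed
    \<comment> \<open>For t = - s cnj \<beta> the linear term is -2 s |\<beta>|^2 and the quadratic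
      one is at most s |\<beta>|^2, which forces \<beta> = 0. The summand 1 covers v = 0.\<close>
    define s where "s = 1 / ((norm v)\<^sup>2 + 1)"
    have pos: "0 < (norm v)\<^sup>2 + 1" by (simp add: add_nonneg_pos)
    then have s: "0 < s" "s * (norm v)\<^sup>2 \<le> 1" by (simp_all add: s_def field_simps)
    have "Re (- s * cnj \<beta> * \<beta>) = - s * (cmod \<beta>)\<^sup>2"
      unfolding cmod_power2 by (simp add: power2_eq_square algebra_simps)
    with ineq[of "- s * cnj \<beta>"] s(1)
    have "0 \<le> - 2 * s * (cmod \<beta>)\<^sup>2 + s\<^sup>2 * (cmod \<beta>)\<^sup>2 * (norm v)\<^sup>2"
      by (simp add: norm_mult power_mult_distrib)
    also have "\<dots> = s * (cmod \<beta>)\<^sup>2 * (s * (norm v)\<^sup>2 - 2)"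
      by (simp add: power2_eq_square algebra_simps)
    also have "\<dots> \<le> s * (cmod \<beta>)\<^sup>2 * (- 1)"
      using s by (intro mult_left_mono) auto
    finally have "(cmod \<beta>)\<^sup>2 \<le> 0" using s(1) by (simp add: mult_le_0_iff)
    then show ?thesis by (simp add: \<beta>_def)
  qed
  have "(\<lambda>n. cmod (a n)) \<longlonglongrightarrow> cmod (cinner w w)"
    using tendsto_norm[OF cinner_tendsto_left[OF w, of w]] repr[OF ua(1)] by simp
  moreover have "(\<lambda>n. C * norm (u n)) \<longlonglongrightarrow> C * norm w" by (intro tendsto_intros w)
  ultimately have "cmod (cinner w w) \<le> C * norm w"
    by (rule LIMSEQ_le) (use bound[OF ua(1)] in blast)
  then have "norm w * norm w \<le> C * norm w"
    by (simp add: cinner_self_norm norm_power power2_eq_square norm_mult)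
  then have "norm w \<le> C" using C by (cases "norm w = 0") (auto simp: mult_le_cancel_right)
  moreover have "cinner w v = 0" if "\<forall>(u, a)\<in>\<Gamma>. cinner u v = 0" for v
  proof (rule LIMSEQ_unique[OF cinner_tendsto_left[OF w]])
    have "cinner (u n) v = 0" for n using that ua(1)[of n] by blast
    then show "(\<lambda>n. cinner (u n) v) \<longlonglongrightarrow> 0" by simp
  qed
  ultimately show ?thesis using repr by blast
qed

text \<open>The bound says that the value of a combination depends only on the vector it represents,
  so the pairs form the graph of a bounded functional on the span. The last conclusion places
  \<open>w\<close> in the closed span of the family, which makes it unique.\<close>

lemma riesz_family:
  fixes k :: "'x \<Rightarrow> 'a ell2" and f :: "'x \<Rightarrow> complex"
  assumes bound: "\<And>F c. finite F \<Longrightarrow> F \<subseteq> X \<Longrightarrow>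
      cmod (\<Sum>x\<in>F. c x * f x) \<le> C * norm (\<Sum>x\<in>F. c x *\<^sub>C k x)" and C: "0 \<le> C"
  shows "\<exists>w. (\<forall>x\<in>X. cinner (k x) w = f x) \<and> norm w \<le> C \<and>
    (\<forall>v. (\<forall>x\<in>X. cinner (k x) v = 0) \<longrightarrow> cinner w v = 0)"
proof -
  define \<Gamma> where "\<Gamma> = {(\<Sum>x\<in>F. c x *\<^sub>C k x, \<Sum>x\<in>F. c x * f x) |F c. finite F \<and> F \<subseteq> X}"
  have mem: "(\<Sum>x\<in>F. c x *\<^sub>C k x, \<Sum>x\<in>F. c x * f x) \<in> \<Gamma>" if "finite F" "F \<subseteq> X" for F c
    using that by (auto simp: \<Gamma>_def)
  have "\<exists>w. (\<forall>(u, a)\<in>\<Gamma>. cinner u w = a) \<and> norm w \<le> C \<and>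
    (\<forall>v. (\<forall>(u, a)\<in>\<Gamma>. cinner u v = 0) \<longrightarrow> cinner w v = 0)"
  proof (rule riesz_graph)
    show "(0, 0) \<in> \<Gamma>" using mem[of "{}"] by simp
    show "cmod a \<le> C * norm u" if "(u, a) \<in> \<Gamma>" for u a
      using that bound by (auto simp: \<Gamma>_def)
    show "(c *\<^sub>C u, c * a) \<in> \<Gamma>" if ua: "(u, a) \<in> \<Gamma>" for u a c
    proof -
      obtain F d where "finite F" "F \<subseteq> X" "u = (\<Sum>x\<in>F. d x *\<^sub>C k x)" "a = (\<Sum>x\<in>F. d x * f x)"
        using ua by (auto simp: \<Gamma>_def)
      with mem[of F "\<lambda>x. c * d x"] show ?thesis
        by (simp add: ell2_scaleC_sum sum_distrib_left mult.assoc)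
    qed
    show "(u + v, a + b) \<in> \<Gamma>" if ua: "(u, a) \<in> \<Gamma>" and vb: "(v, b) \<in> \<Gamma>" for u a v b
    proof -
      obtain F c where F: "finite F" "F \<subseteq> X" "u = (\<Sum>x\<in>F. c x *\<^sub>C k x)" "a = (\<Sum>x\<in>F. c x * f x)"
        using ua by (auto simp: \<Gamma>_def)
      obtain H d where H: "finite H" "H \<subseteq> X" "v = (\<Sum>x\<in>H. d x *\<^sub>C k x)" "b = (\<Sum>x\<in>H. d x * f x)"
        using vb by (auto simp: \<Gamma>_def)
      define c' where "c' x = (if x \<in> F then c x else 0)" for x
      define d' where "d' x = (if x \<in> H then d x else 0)" for x
      have "u = (\<Sum>x\<in>F \<union> H. c' x *\<^sub>C k x)" "v = (\<Sum>x\<in>F \<union> H. d' x *\<^sub>C k x)"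
        "a = (\<Sum>x\<in>F \<union> H. c' x * f x)" "b = (\<Sum>x\<in>F \<union> H. d' x * f x)"
        unfolding F H by (intro sum.mono_neutral_cong_left; use F H in \<open>auto simp: c'_def d'_def\<close>)+
      then have "u + v = (\<Sum>x\<in>F \<union> H. (c' x + d' x) *\<^sub>C k x)" "a + b = (\<Sum>x\<in>F \<union> H. (c' x + d' x) * f x)"
        by (simp_all add: sum.distrib ell2_scaleC_left_distrib distrib_right)
      with mem[of "F \<union> H" "\<lambda>x. c' x + d' x"] F H show ?thesis by simp
    qed
  qed (rule C)
  then obtain w where w: "\<And>u a. (u, a) \<in> \<Gamma> \<Longrightarrow> cinner u w = a" "norm w \<le> C"
    "\<And>v. (\<forall>(u, a)\<in>\<Gamma>. cinner u v = 0) \<Longrightarrow> cinner w v = 0" by fast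
  have k: "(k x, f x) \<in> \<Gamma>" if "x \<in> X" for x
    using mem[of "{x}" "\<lambda>_. 1"] that by simp
  have "cinner w v = 0" if v: "\<forall>x\<in>X. cinner (k x) v = 0" for v
  proof (rule w(3), clarify)
    fix u a assume "(u, a) \<in> \<Gamma>"
    then obtain F c where "finite F" "F \<subseteq> X" "u = (\<Sum>x\<in>F. c x *\<^sub>C k x)" by (auto simp: \<Gamma>_def)
    then show "cinner u v = 0"
      using v by (auto simp: cinner_sum_left cinner_scaleC_left intro!: sum.neutral)
  qed
  with w(1)[OF k] w(2) show ?thesis by blast
qed

text \<open>The adjoint is constructed first: it sends y to the vector representing
  \<open>k x\<close> -> \<open>cinner (m x) y\<close>. Taken in the closed span of \<open>k\<close>,
  these vectors are unique, so they depend linearly on y, and the operator vanishes off that span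
  without further work. The two vanishing statements are what later determines adjoints and products
  of such operators.\<close>

lemma bop_extension:
  fixes k m :: "'x \<Rightarrow> 'a ell2"
  assumes bound: "\<And>F c. finite F \<Longrightarrow>
      norm (\<Sum>x\<in>F. c x *\<^sub>C m x) \<le> C * norm (\<Sum>x\<in>F. c x *\<^sub>C k x)" and C: "0 \<le> C"
  shows "\<exists>T :: 'a bop. (\<forall>x. T \<bullet>\<^sub>B k x = m x) \<and> (\<forall>v. (\<forall>x. cinner (k x) v = 0) \<longrightarrow> T \<bullet>\<^sub>B v = 0) \<and>
    (\<forall>v. (\<forall>x. cinner (m x) v = 0) \<longrightarrow> T\<^sup>\<star> \<bullet>\<^sub>B v = 0)"
proof -
  have "\<exists>w. (\<forall>x\<in>UNIV. cinner (k x) w = cinner (m x) y) \<and> norm w \<le> C * norm y \<and>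
      (\<forall>v. (\<forall>x\<in>UNIV. cinner (k x) v = 0) \<longrightarrow> cinner w v = 0)" for y
  proof (rule riesz_family)
    fix F :: "'x set" and c :: "'x \<Rightarrow> complex" assume F: "finite F"
    have "(\<Sum>x\<in>F. c x * cinner (m x) y) = cinner (\<Sum>x\<in>F. c x *\<^sub>C m x) y"
      by (simp add: cinner_sum_left cinner_scaleC_left)
    then have "cmod (\<Sum>x\<in>F. c x * cinner (m x) y) \<le> norm (\<Sum>x\<in>F. c x *\<^sub>C m x) * norm y"
      by (simp add: cinner_bound)
    also have "\<dots> \<le> (C * norm (\<Sum>x\<in>F. c x *\<^sub>C k x)) * norm y"
      by (intro mult_right_mono bound F) simp
    finally show "cmod (\<Sum>x\<in>F. c x * cinner (m x) y) \<le> C * norm y * norm (\<Sum>x\<in>F. c x *\<^sub>C k x)"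
      by (simp add: mult_ac)
  qed (simp add: C)
  then obtain r where r: "\<And>x y. cinner (k x) (r y) = cinner (m x) y" "\<And>y. norm (r y) \<le> C * norm y"
    "\<And>y v. (\<And>x. cinner (k x) v = 0) \<Longrightarrow> cinner (r y) v = 0"
    by (metis UNIV_I)
  \<comment> \<open>Two vectors of the closed span of \<open>k\<close> with equal inner products
    against \<open>k\<close> coincide; this yields linearity of \<open>r\<close>.\<close>
  have uniq: "v = w" if "\<And>x. cinner (k x) v = cinner (k x) w"
    "\<And>z. (\<And>x. cinner (k x) z = 0) \<Longrightarrow> cinner v z = 0"
    "\<And>z. (\<And>x. cinner (k x) z = 0) \<Longrightarrow> cinner w z = 0" for v w
  proof -
    have 0: "cinner (k x) (v - w) = 0" for x by (simp add: cinner_diff_right that(1))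
    have "cinner (v - w) (v - w) = 0"
      using that(2)[OF 0] that(3)[OF 0] by (subst cinner_diff_left) simp
    then show ?thesis by (simp add: cinner_self_eq_0)
  qed
  have "\<exists>R. \<forall>y. R \<bullet>\<^sub>B y = r y"
  proof (rule bop_blinfunI[where K=C])
    show "r (x + y) = r x + r y" for x y
      by (rule uniq) (simp_all add: r(1) r(3) cinner_add_right cinner_add_left)
    show "r (c *\<^sub>C x) = c *\<^sub>C r x" for c x
      by (rule uniq) (simp_all add: r(1) r(3) cinner_scaleC_right cinner_scaleC_left)
    show "norm (r y) \<le> norm y * C" for y using r(2)[of y] by (simp add: mult.commute)
  qed
  then obtain R where R: "\<And>y. R \<bullet>\<^sub>B y = r y" by blast
  show ?thesis
  proof (intro exI[of _ "R\<^sup>\<star>"] conjI allI impI)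
    show "R\<^sup>\<star> \<bullet>\<^sub>B k x = m x" for x
    proof (rule cinner_ext_right)
      fix y
      have "cinner (R\<^sup>\<star> \<bullet>\<^sub>B k x) y = cinner (m x) y" by (simp add: bop_adjoint' R r(1))
      then show "cinner y (R\<^sup>\<star> \<bullet>\<^sub>B k x) = cinner y (m x)" by (metis cinner_commute)
    qed
    show "R\<^sup>\<star> \<bullet>\<^sub>B v = 0" if "\<forall>x. cinner (k x) v = 0" for v
      by (rule cinner_ext_right) (use that r(3) in \<open>simp add: bop_adjoint[symmetric] R\<close>)
    show "(R\<^sup>\<star>)\<^sup>\<star> \<bullet>\<^sub>B v = 0" if "\<forall>x. cinner (m x) v = 0" for v
    proof -
      have "r v = 0" by (rule uniq) (use that r(1,3) in auto)
      then show ?thesis by (simp add: invol_invol R)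
    qed
  qed
qed

text \<open>Split v into its projection \<open>w\<close> on the closed span of \<open>k\<close>,
  found by \<open>riesz_family\<close>, and an orthogonal remainder. On \<open>w\<close> the
  operators agree because the adjoint of S - T maps every vector into the orthogonal complement of
  the family.\<close>

lemma bop_eq_on_family:
  fixes k :: "'x \<Rightarrow> 'a ell2"
  assumes k: "\<And>x. S \<bullet>\<^sub>B k x = T \<bullet>\<^sub>B k x"
    and perp: "\<And>v. (\<And>x. cinner (k x) v = 0) \<Longrightarrow> S \<bullet>\<^sub>B v = T \<bullet>\<^sub>B v"
  shows "S = T"
proof (rule bop_eqI)
  fix v
  have "\<exists>w. (\<forall>x\<in>UNIV. cinner (k x) w = cinner (k x) v) \<and> norm w \<le> norm v \<and>
      (\<forall>z. (\<forall>x\<in>UNIV. cinner (k x) z = 0) \<longrightarrow> cinner w z = 0)"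
  proof (rule riesz_family)
    fix F :: "'x set" and c :: "'x \<Rightarrow> complex"
    have "(\<Sum>x\<in>F. c x * cinner (k x) v) = cinner (\<Sum>x\<in>F. c x *\<^sub>C k x) v"
      by (simp add: cinner_sum_left cinner_scaleC_left)
    then show "cmod (\<Sum>x\<in>F. c x * cinner (k x) v) \<le> norm v * norm (\<Sum>x\<in>F. c x *\<^sub>C k x)"
      using cinner_bound[of "\<Sum>x\<in>F. c x *\<^sub>C k x" v] by (simp add: mult.commute)
  qed simp
  then obtain w where w: "\<And>x. cinner (k x) w = cinner (k x) v"
    "\<And>z. (\<And>x. cinner (k x) z = 0) \<Longrightarrow> cinner w z = 0" by blast
  have "S \<bullet>\<^sub>B (v - w) = T \<bullet>\<^sub>B (v - w)" by (rule perp) (simp add: cinner_diff_right w)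
  moreover have "S \<bullet>\<^sub>B w = T \<bullet>\<^sub>B w"
  proof -
    have "cinner ((S - T) \<bullet>\<^sub>B w) y = 0" for y
      unfolding bop_adjoint by (rule w(2)) (simp add: bop_adjoint[symmetric] k)
    from this[of "(S - T) \<bullet>\<^sub>B w"] have "(S - T) \<bullet>\<^sub>B w = 0" by (simp only: cinner_self_eq_0)
    then show ?thesis by simp
  qed
  ultimately show "S \<bullet>\<^sub>B v = T \<bullet>\<^sub>B v" by (simp add: bop_diff)
qed

text \<open>A transfinite Cholesky decomposition: the vector of \<open>x\<close> is a combination of its predecessors plus
  a multiple of the fresh basis vector \<open>delta (i x)\<close>.\<close>

lemma gram_kernel:
  fixes K :: "'x \<Rightarrow> 'x \<Rightarrow> complex" and i :: "'x \<Rightarrow> 'a"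
  assumes i: "inj i"
    and herm: "\<And>x y. K y x = cnj (K x y)"
    and nonneg: "\<And>x. 0 \<le> Re (K x x)"
    and cs: "\<And>F c x. finite F \<Longrightarrow> (cmod (\<Sum>y\<in>F. c y * K y x))\<^sup>2 \<le>
      Re (K x x) * Re (\<Sum>y\<in>F. \<Sum>z\<in>F. c y * cnj (c z) * K y z)"
  shows "\<exists>k :: 'x \<Rightarrow> 'a ell2. \<forall>x y. cinner (k x) (k y) = K x y"
proof -
  obtain r :: "'x rel" where r: "Well_order r" "Field r = UNIV"
    using well_ordering[where 'a='x] by (elim exE conjE)
  define l where "l = r - Id"
  have wf: "wf l" using r by (auto simp: l_def well_order_on_def)
  have "Relation.trans r" "antisym r" "total_on UNIV r"
    using r unfolding well_order_on_def linear_order_on_def partial_order_on_def preorder_on_def by auto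
  then have trans: "(x, z) \<in> l" if "(x, y) \<in> l" "(y, z) \<in> l" for x y z
    using that unfolding l_def by (metis DiffD1 DiffD2 DiffI antisymD pair_in_Id_conv transD)
  have total: "x = y \<or> (x, y) \<in> l \<or> (y, x) \<in> l" for x y
    using \<open>total_on UNIV r\<close> unfolding l_def total_on_def by auto
  \<comment> \<open>The support condition keeps the label \<open>i x\<close> out of all earlier
    vectors, so a multiple of \<open>delta (i x)\<close> can correct the norm without disturbing the
    inner products.\<close>
  define P where "P k x v \<longleftrightarrow> (\<forall>y. (y, x) \<in> l \<longrightarrow> cinner (k y) v = K y x) \<and> cinner v v = K x x \<and>
    (\<forall>a. ell2_nth v a \<noteq> 0 \<longrightarrow> a = i x \<or> (\<exists>y. (y, x) \<in> l \<and> a = i y))" for k :: "'x \<Rightarrow> 'a ell2" and x v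
  have "\<exists>k. \<forall>x. P k x (k x)"
  proof (rule dependent_wf_choice[OF wf])
    show "P f x v = P g x v" if "\<And>z. (z, x) \<in> l \<Longrightarrow> f z = g z" for f g x v
      using that by (simp add: P_def)
    fix x and k :: "'x \<Rightarrow> 'a ell2"
    assume prev: "\<And>y. (y, x) \<in> l \<Longrightarrow> P k y (k y)"
    \<comment> \<open>Among the predecessors the Gram matrix is already \<open>K\<close>; this turns
      \<open>cs\<close> into the norm bound that \<open>riesz_family\<close> asks for.\<close>
    have gram: "cinner (k y) (k z) = K y z" if "(y, x) \<in> l" "(z, x) \<in> l" for y z
      using total[of y z] prev[OF that(1)] prev[OF that(2)] herm[of z y] cinner_commute[of "k y" "k z"]
      by (auto simp: P_def)
    have "\<exists>w. (\<forall>y\<in>{y. (y, x) \<in> l}. cinner (k y) w = K y x) \<and> norm w \<le> sqrt (Re (K x x)) \<and>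
      (\<forall>v. (\<forall>y\<in>{y. (y, x) \<in> l}. cinner (k y) v = 0) \<longrightarrow> cinner w v = 0)"
    proof (rule riesz_family)
      fix F :: "'x set" and c :: "'x \<Rightarrow> complex" assume F: "finite F" "F \<subseteq> {y. (y, x) \<in> l}"
      define u where "u = (\<Sum>y\<in>F. c y *\<^sub>C k y)"
      have "cinner u u = (\<Sum>y\<in>F. \<Sum>z\<in>F. c y * cnj (c z) * cinner (k y) (k z))"
        unfolding u_def by (rule cinner_sum_scaleC)
      also have "\<dots> = (\<Sum>y\<in>F. \<Sum>z\<in>F. c y * cnj (c z) * K y z)"
        by (intro sum.cong refl arg_cong2[where f="(*)"] gram) (use F in auto)
      finally have "Re (\<Sum>y\<in>F. \<Sum>z\<in>F. c y * cnj (c z) * K y z) = (norm u)\<^sup>2"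
        by (metis cinner_self_norm Re_complex_of_real)
      with cs[OF F(1), of c x] have "(cmod (\<Sum>y\<in>F. c y * K y x))\<^sup>2 \<le> Re (K x x) * (norm u)\<^sup>2" by simp
      then show "cmod (\<Sum>y\<in>F. c y * K y x) \<le> sqrt (Re (K x x)) * norm (\<Sum>y\<in>F. c y *\<^sub>C k y)"
        unfolding u_def[symmetric]
        by - (rule power2_le_imp_le, simp_all add: power_mult_distrib nonneg)
    qed (simp add: nonneg)
    then obtain w where w': "\<forall>y\<in>{y. (y, x) \<in> l}. cinner (k y) w = K y x" "norm w \<le> sqrt (Re (K x x))"
      "\<forall>v. (\<forall>y\<in>{y. (y, x) \<in> l}. cinner (k y) v = 0) \<longrightarrow> cinner w v = 0" by (elim exE conjE)
    have w: "\<And>y. (y, x) \<in> l \<Longrightarrow> cinner (k y) w = K y x" "norm w \<le> sqrt (Re (K x x))"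
      "\<And>v. (\<And>y. (y, x) \<in> l \<Longrightarrow> cinner (k y) v = 0) \<Longrightarrow> cinner w v = 0"
      using w' by simp_all
    \<comment> \<open>If \<open>a\<close> labels no predecessor, \<open>delta a\<close> is
      orthogonal to all their vectors, hence to \<open>w\<close>, which lies in their closed
      span.\<close>
    have supp: "\<exists>y. (y, x) \<in> l \<and> a = i y" if "ell2_nth w a \<noteq> 0" for a
    proof (rule ccontr)
      assume none: "\<not> ?thesis"
      have "cinner (k y) (delta a) = 0" if y: "(y, x) \<in> l" for y
      proof (rule ccontr)
        assume "cinner (k y) (delta a) \<noteq> 0"
        then have "ell2_nth (k y) a \<noteq> 0" by (simp add: cinner_delta_right)
        with prev[OF y] have "a = i y \<or> (\<exists>z. (z, y) \<in> l \<and> a = i z)" by (simp add: P_def)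
        with none y show False by (blast intro: trans)
      qed
      from w(3)[OF this] that show False by (simp add: cinner_delta_right)
    qed
    have ix: "i x \<noteq> i y" if "(y, x) \<in> l" for y
      using that i by (auto simp: l_def dest: injD)
    \<comment> \<open>\<open>w\<close> has the right inner products but may be too short;
      \<open>d\<close> is the missing length. The bound on \<open>norm w\<close> makes the radicand
      nonnegative.\<close>
    define d where "d = sqrt (Re (K x x) - (norm w)\<^sup>2)"
    have "(norm w)\<^sup>2 \<le> (sqrt (Re (K x x)))\<^sup>2" by (intro power_mono w(2)) simp
    then have d: "d\<^sup>2 = Re (K x x) - (norm w)\<^sup>2" by (simp add: d_def nonneg)
    have Kxx: "K x x = complex_of_real (Re (K x x))" using herm[of x x] by (simp add: complex_eq_iff)
    define v where "v = w + complex_of_real d *\<^sub>C delta (i x)"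
    have w0: "cinner w (delta (i x)) = 0"
      using supp[of "i x"] ix by (auto simp: cinner_delta_right)
    have "cinner (k y) v = K y x" if y: "(y, x) \<in> l" for y
    proof -
      have "ell2_nth (k y) (i x) = 0"
      proof (rule ccontr)
        assume "ell2_nth (k y) (i x) \<noteq> 0"
        with prev[OF y] have "i x = i y \<or> (\<exists>z. (z, y) \<in> l \<and> i x = i z)" by (simp add: P_def)
        with y ix show False by (blast intro: trans)
      qed
      with w(1)[OF y] show ?thesis
        by (simp add: v_def cinner_add_right cinner_scaleC_right cinner_delta_right)
    qed
    moreover have "cinner v v = K x x"
    proof -
      have "cinner (delta (i x)) w = 0" using w0 cinner_commute[of "delta (i x)" w] by simp
      then have "(norm v)\<^sup>2 = (norm w)\<^sup>2 + d\<^sup>2" by (simp add: v_def ell2_norm_add_scaleC norm_delta)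
      then have "cinner v v = complex_of_real ((norm w)\<^sup>2 + d\<^sup>2)" by (simp only: cinner_self_norm)
      then show ?thesis using d Kxx by simp
    qed
    moreover have "a = i x \<or> (\<exists>y. (y, x) \<in> l \<and> a = i y)" if "ell2_nth v a \<noteq> 0" for a
      using that supp[of a] by (auto simp: v_def delta.rep_eq split: if_splits)
    ultimately show "\<exists>v. P k x v" unfolding P_def by blast
  qed
  then obtain k where k: "\<And>x. P k x (k x)" by blast
  have "cinner (k x) (k y) = K x y" for x y
    using total[of x y] k[of x] k[of y] herm[of x y] cinner_commute[of "k x" "k y"]
    by (auto simp: P_def)
  then show ?thesis by blast
qed

section \<open>Linear spans and generated subalgebras\<close>

lemma scaleC_one [simp]: "1 *\<^sub>C (x :: 'a::cstar_algebra) = x"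
  using scaleC_of_real[of 1 x] by simp

lemma scaleC_zero_left [simp]: "0 *\<^sub>C (x :: 'a::cstar_algebra) = 0"
  using scaleC_of_real[of 0 x] by simp

lemma scaleC_zero_right [simp]: "c *\<^sub>C (0 :: 'a::cstar_algebra) = 0"
  using bounded_linear.linear[OF scaleC_bounded_linear] by (rule linear_0)

lemma scaleC_minus_one: "(- 1) *\<^sub>C (x :: 'a::cstar_algebra) = - x"
  using scaleC_of_real[of "- 1" x] by simp

lemma invol_zero [simp]: "(0 :: 'a::cstar_algebra)\<^sup>\<star> = 0"
  using bounded_linear.linear[OF invol_bounded_linear] by (rule linear_0)

lemma invol_diff: "(x - y :: 'a::cstar_algebra)\<^sup>\<star> = x\<^sup>\<star> - y\<^sup>\<star>"
  using bounded_linear.linear[OF invol_bounded_linear] by (rule linear_diff)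

lemma invol_sum: "(\<Sum>x\<in>F. f x :: 'a::cstar_algebra)\<^sup>\<star> = (\<Sum>x\<in>F. (f x)\<^sup>\<star>)"
  by (induction F rule: infinite_finite_induct) (auto simp: invol_add)

inductive_set lspan :: "'a::cstar_algebra set \<Rightarrow> 'a set" for G where
  lspan_zero: "0 \<in> lspan G"
| lspan_base: "g \<in> G \<Longrightarrow> g \<in> lspan G"
| lspan_add: "x \<in> lspan G \<Longrightarrow> y \<in> lspan G \<Longrightarrow> x + y \<in> lspan G"
| lspan_scale: "x \<in> lspan G \<Longrightarrow> c *\<^sub>C x \<in> lspan G"

lemma closure_lspan_induct:
  assumes "x \<in> closure (lspan G)" "closed {x. P x}" "P 0" "\<And>g. g \<in> G \<Longrightarrow> P g"
    "\<And>x y. P x \<Longrightarrow> P y \<Longrightarrow> P (x + y)" "\<And>c x. P x \<Longrightarrow> P (c *\<^sub>C x)"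
  shows "P x"
proof -
  have "y \<in> {x. P x}" if "y \<in> lspan G" for y
    using that by induction (auto intro: assms)
  then have "closure (lspan G) \<subseteq> {x. P x}" by (intro closure_minimal assms) auto
  with assms(1) show ?thesis by auto
qed

lemma cstar_subalgebra_diff: "cstar_subalgebra A \<Longrightarrow> x \<in> A \<Longrightarrow> y \<in> A \<Longrightarrow> x - y \<in> A"
  unfolding cstar_subalgebra_def by (metis scaleC_minus_one diff_conv_add_uminus)

lemma lspan_subset: "cstar_subalgebra A \<Longrightarrow> G \<subseteq> A \<Longrightarrow> lspan G \<subseteq> A"
proof
  fix x assume A: "cstar_subalgebra A" "G \<subseteq> A" and "x \<in> lspan G"
  from this(3) show "x \<in> A" by induction (use A in \<open>auto simp: cstar_subalgebra_def\<close>)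
qed

lemma cstar_subalgebra_closure_lspan:
  assumes mult: "\<And>g h. g \<in> G \<Longrightarrow> h \<in> G \<Longrightarrow> g * h \<in> G" and star: "\<And>g. g \<in> G \<Longrightarrow> g\<^sup>\<star> \<in> G"
  shows "cstar_subalgebra (closure (lspan G))"
proof -
  have m1: "x * h \<in> lspan G" if "x \<in> lspan G" "h \<in> G" for x h
    using that by induction (auto intro: lspan.intros mult simp: distrib_right scaleC_mult_left)
  have m: "x * y \<in> lspan G" if "y \<in> lspan G" "x \<in> lspan G" for x y
    using that by induction (auto intro: lspan.intros m1 simp: distrib_left scaleC_mult_right)
  have s: "x\<^sup>\<star> \<in> lspan G" if "x \<in> lspan G" for x
    using that by induction (auto intro: lspan.intros star simp: invol_add invol_scaleC)
  have binary: "f x y \<in> closure (lspan G)"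
    if b: "x \<in> closure (lspan G)" "y \<in> closure (lspan G)" "\<And>x y. x \<in> lspan G \<Longrightarrow> y \<in> lspan G \<Longrightarrow> f x y \<in> lspan G"
      "\<And>u v x y. u \<longlonglongrightarrow> x \<Longrightarrow> v \<longlonglongrightarrow> y \<Longrightarrow> (\<lambda>n. f (u n) (v n)) \<longlonglongrightarrow> f x y" for f x y
  proof -
    obtain u v where "\<And>n. u n \<in> lspan G" "u \<longlonglongrightarrow> x" "\<And>n. v n \<in> lspan G" "v \<longlonglongrightarrow> y"
      using b(1,2) unfolding closure_sequential by metis
    with b(3,4) show ?thesis
      unfolding closure_sequential by (intro exI[of _ "\<lambda>n. f (u n) (v n)"]) simp
  qed
  have unary: "f x \<in> closure (lspan G)"
    if b: "x \<in> closure (lspan G)" "\<And>x. x \<in> lspan G \<Longrightarrow> f x \<in> lspan G" "bounded_linear f" for f x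
  proof -
    obtain u where "\<And>n. u n \<in> lspan G" "u \<longlonglongrightarrow> x"
      using b(1) unfolding closure_sequential by metis
    with b(2,3) show ?thesis
      unfolding closure_sequential by (intro exI[of _ "\<lambda>n. f (u n)"]) (simp add: bounded_linear.tendsto)
  qed
  show ?thesis
    unfolding cstar_subalgebra_def
  proof (intro conjI ballI allI)
    show "0 \<in> closure (lspan G)" by (intro subsetD[OF closure_subset] lspan_zero)
    fix x assume x: "x \<in> closure (lspan G)"
    show "x\<^sup>\<star> \<in> closure (lspan G)" by (rule unary[OF x s invol_bounded_linear])
    show "c *\<^sub>C x \<in> closure (lspan G)" for c
      by (rule unary[OF x lspan_scale scaleC_bounded_linear])
    fix y assume y: "y \<in> closure (lspan G)"
    show "x + y \<in> closure (lspan G)" by (rule binary[OF x y]) (auto intro: lspan_add tendsto_add)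
    show "x * y \<in> closure (lspan G)" by (rule binary[OF x y]) (auto intro: m tendsto_mult)
  qed simp
qed

lemma cstar_subalgebra_generated: "cstar_subalgebra (cstar_generated G)"
proof -
  have "closed (\<Inter>{A. cstar_subalgebra A \<and> G \<subseteq> A})"
    by (intro closed_Inter) (auto simp: cstar_subalgebra_def)
  then show ?thesis
    unfolding cstar_generated_def cstar_subalgebra_def[of "\<Inter>_"] by (auto simp: cstar_subalgebra_def)
qed

text \<open>For a *-semigroup \<open>M\<close> the linear span is already a *-algebra, so only the
  closure is left to take.\<close>

lemma cstar_generated_eq_closure_lspan:
  assumes "\<And>g h. g \<in> M \<Longrightarrow> h \<in> M \<Longrightarrow> g * h \<in> M" and "\<And>g. g \<in> M \<Longrightarrow> g\<^sup>\<star> \<in> M"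
    and "G \<subseteq> M" "M \<subseteq> cstar_generated G"
  shows "cstar_generated G = closure (lspan M)"
proof
  have "G \<subseteq> closure (lspan M)" using assms(3) lspan_base closure_subset by blast
  with cstar_subalgebra_closure_lspan[OF assms(1,2)] show "cstar_generated G \<subseteq> closure (lspan M)"
    unfolding cstar_generated_def by blast
  show "closure (lspan M) \<subseteq> cstar_generated G"
    by (intro closure_minimal lspan_subset cstar_subalgebra_generated assms)
      (use cstar_subalgebra_generated in \<open>auto simp: cstar_subalgebra_def\<close>)
qed

section \<open>Images of *-homomorphisms\<close>

text \<open>For a symmetric \<open>X\<close> with spectrum in [0, 1] this is the bound \<open>t (1 - t)\<^sup>2\<^sup>n \<le> 1 / (2 n + 1)\<close>: the
  sum of \<open>t (1 - t)\<^sup>k\<close> over \<open>k \<le> 2 n\<close> telescopes to at most 1 and its terms decrease.\<close>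

lemma symmetric_power_bounds:
  fixes X Y :: "'v::real_inner \<Rightarrow> 'v"
  assumes lin: "linear X" and sym: "\<And>u v. inner (X u) v = inner u (X v)"
    and nonneg: "\<And>u. 0 \<le> inner (X u) u" and le1: "\<And>u. inner (X u) u \<le> (norm u)\<^sup>2"
    and Y: "\<And>u. Y u = u - X u"
  shows "(2 * real n + 1) * inner (X ((Y ^^ n) u)) ((Y ^^ n) u) \<le> (norm u)\<^sup>2"
    and "norm ((Y ^^ n) u) \<le> norm u"
proof -
  have symY: "inner (Y u) v = inner u (Y v)" for u v by (simp add: Y inner_diff sym)
  have symYn: "inner ((Y ^^ k) u) v = inner u ((Y ^^ k) v)" for k u v
    by (induction k arbitrary: u v) (simp_all add: symY funpow_swap1)
  have linY: "Y (u - v) = Y u - Y v" for u v by (simp add: Y linear_diff[OF lin])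
  have linYn: "(Y ^^ k) (u - v) = (Y ^^ k) u - (Y ^^ k) v" for k u v
    by (induction k) (simp_all add: linY)
  have XYn: "X ((Y ^^ k) u) = (Y ^^ k) (X u)" for k u
    by (induction k arbitrary: u) (simp_all add: Y linear_diff[OF lin])
  have posY: "0 \<le> inner (Y u) u" for u
    using le1[of u] by (simp add: Y inner_diff power2_norm_eq_inner)
  \<comment> \<open>No square root of Y is taken: an even power is a square, and an odd one is Y
    between two copies of a smaller power.\<close>
  have pos: "0 \<le> inner ((Y ^^ k) u) u" for k u
  proof (cases "even k")
    case True
    then obtain m where "k = m + m" by (metis evenE mult_2)
    then have "inner ((Y ^^ k) u) u = inner ((Y ^^ m) u) ((Y ^^ m) u)"
      by (simp only: funpow_add o_apply symYn)
    then show ?thesis by simp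
  next
    case False
    then obtain m where "k = 2 * m + 1" by (rule oddE)
    then have "k = m + Suc m" by simp
    then have "inner ((Y ^^ k) u) u = inner (Y ((Y ^^ m) u)) ((Y ^^ m) u)"
      by (simp only: funpow_add o_apply funpow.simps symYn)
    then show ?thesis by (simp add: posY)
  qed
  define q where "q k u = inner (X ((Y ^^ k) u)) u" for k u
  \<comment> \<open>X Y^k - X Y^(k+1) = X Y^k X, and Y^k is positive.\<close>
  have dec1: "q (Suc k) u \<le> q k u" for k u
  proof -
    have "q k u - q (Suc k) u = inner ((Y ^^ k) (X u)) (X u)"
      by (simp add: q_def funpow_swap1 Y[of u] linYn linear_diff[OF lin] inner_diff sym[of "(Y ^^ k) (X u)"])
    with pos[of k "X u"] show ?thesis by simp
  qed
  have dec: "q m u \<le> q k u" if "k \<le> m" for k m u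
    using that by (induction m rule: dec_induct) (auto intro: order.trans[OF dec1])
  \<comment> \<open>X = 1 - Y gives X Y^k = Y^k - Y^(k+1).\<close>
  have tel: "(\<Sum>k<m. q k u) = (norm u)\<^sup>2 - inner ((Y ^^ m) u) u" for m u
    by (induction m) (simp_all add: q_def Y[of "(Y ^^ m) u" for m] inner_diff power2_norm_eq_inner)
  have "(2 * real n + 1) * q (2 * n) u = (\<Sum>k<2 * n + 1. q (2 * n) u)" by simp
  also have "\<dots> \<le> (\<Sum>k<2 * n + 1. q k u)" by (intro sum_mono dec) auto
  also have "\<dots> \<le> (norm u)\<^sup>2" unfolding tel using pos[of "2 * n + 1" u] by simp
  also have "q (2 * n) u = inner (X ((Y ^^ n) u)) ((Y ^^ n) u)"
    by (simp add: q_def mult_2 funpow_add XYn symYn)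
  finally show "(2 * real n + 1) * inner (X ((Y ^^ n) u)) ((Y ^^ n) u) \<le> (norm u)\<^sup>2" .
  \<comment> \<open>Y^2 = 1 - X - X Y, and X Y is positive because it dominates X Y^2 = Y X
    Y.\<close>
  have contr: "norm (Y u) \<le> norm u" for u
  proof (rule power2_le_imp_le)
    have "q 2 u = inner (Y (X (Y u))) u"
      using XYn[of 1 "Y u"] by (simp add: q_def numeral_2_eq_2)
    then have "0 \<le> q 2 u" by (simp add: symY nonneg)
    moreover have "0 \<le> q 0 u" by (simp add: q_def nonneg)
    moreover have "(norm (Y u))\<^sup>2 = (norm u)\<^sup>2 - (q 0 u + q 1 u)"
      using tel[of u "Suc (Suc 0)"] unfolding power2_norm_eq_inner symY by (simp add: inner_commute)
    ultimately show "(norm (Y u))\<^sup>2 \<le> (norm u)\<^sup>2" using dec[of 1 2 u] by simp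
  qed simp
  show "norm ((Y ^^ n) u) \<le> norm u"
    by (induction n) (auto intro: order.trans[OF contr])
qed

text \<open>\<open>shrink M h n a\<close> is \<open>a (1 - h / M)\<^sup>n\<close>, written without a unit.\<close>

definition shrink :: "real \<Rightarrow> 'a::cstar_algebra \<Rightarrow> nat \<Rightarrow> 'a \<Rightarrow> 'a" where
  "shrink M h n a = ((\<lambda>a. a - (1 / M) *\<^sub>R (a * h)) ^^ n) a"

lemma shrink_0 [simp]: "shrink M h 0 a = a"
  and shrink_Suc: "shrink M h (Suc n) a = shrink M h n a - (1 / M) *\<^sub>R (shrink M h n a * h)"
  by (simp_all add: shrink_def)

text \<open>On vectors the operator 1 - h / M exists outright, so \<open>shrink\<close> becomes
  \<open>a\<close> applied after a power to which \<open>symmetric_power_bounds\<close>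
  speaks.\<close>

lemma shrink_apply:
  "shrink M h n a \<bullet>\<^sub>B \<xi> = a \<bullet>\<^sub>B (((\<lambda>\<xi>. \<xi> - (1 / M) *\<^sub>R (h \<bullet>\<^sub>B \<xi>)) ^^ n) \<xi>)"
proof (induction n arbitrary: \<xi>)
  case (Suc n)
  have "shrink M h (Suc n) a \<bullet>\<^sub>B \<xi> = shrink M h n a \<bullet>\<^sub>B (\<xi> - (1 / M) *\<^sub>R (h \<bullet>\<^sub>B \<xi>))"
    by (simp add: shrink_Suc bop_diff scaleR_scaleC_ell2 bop_scaleC)
  with Suc show ?case by (simp only: funpow_Suc_right o_apply)
qed simp

text \<open>Take X = h / M, where h is the sum of the squares of the \<open>T i\<close>. The bound
  on their norms gives X at most 1, and the sum on the left is M times the quadratic form of X at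
  the shrunken vector. A single operator serves the closedness of images; a finite family serves the
  ideal.\<close>

lemma bop_symmetric_power_bounds:
  fixes T :: "'i \<Rightarrow> 'a bop" and I :: "'i set" and M :: real
  defines "Y \<equiv> \<lambda>\<xi>. \<xi> - (1 / M) *\<^sub>R ((\<Sum>i\<in>I. (T i)\<^sup>\<star> * T i) \<bullet>\<^sub>B \<xi>)"
  assumes M: "0 < M" and bound: "(\<Sum>i\<in>I. (norm (T i))\<^sup>2) \<le> M"
  shows "(\<Sum>i\<in>I. (norm (T i \<bullet>\<^sub>B (Y ^^ n) \<xi>))\<^sup>2) \<le> M / (2 * real n + 1) * (norm \<xi>)\<^sup>2"
    and "norm ((Y ^^ n) \<xi>) \<le> norm \<xi>"
proof -
  define X where "X \<xi> = (1 / M) *\<^sub>R ((\<Sum>i\<in>I. (T i)\<^sup>\<star> * T i) \<bullet>\<^sub>B \<xi>)" for \<xi>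
  have sum_apply: "(\<Sum>i\<in>J. S i) \<bullet>\<^sub>B \<xi> = (\<Sum>i\<in>J. S i \<bullet>\<^sub>B \<xi>)" for S :: "'i \<Rightarrow> 'a bop" and J \<xi>
    by (induction J rule: infinite_finite_induct) auto
  have adj: "inner ((T i)\<^sup>\<star> \<bullet>\<^sub>B u) v = inner u (T i \<bullet>\<^sub>B v)" for i u v
    by (simp add: inner_ell2_def bop_adjoint')
  have Xi: "inner (X u) v = (1 / M) * (\<Sum>i\<in>I. inner (T i \<bullet>\<^sub>B u) (T i \<bullet>\<^sub>B v))" for u v
    by (simp add: X_def sum_apply inner_sum_left adj)
  have Xu: "inner (X u) u = (1 / M) * (\<Sum>i\<in>I. (norm (T i \<bullet>\<^sub>B u))\<^sup>2)" for u
    by (simp add: Xi power2_norm_eq_inner)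
  have lin: "linear X"
    by (rule linearI) (simp_all add: X_def bop_add bop_scaleC scaleR_scaleC_ell2 ell2_scaleC_right_distrib mult.commute)
  have sym: "inner (X u) v = inner u (X v)" for u v
    unfolding inner_commute[of u] Xi by (simp add: inner_commute)
  have nonneg: "0 \<le> inner (X u) u" for u
    using M by (simp add: Xu sum_nonneg)
  have le1: "inner (X u) u \<le> (norm u)\<^sup>2" for u
  proof -
    have "(\<Sum>i\<in>I. (norm (T i \<bullet>\<^sub>B u))\<^sup>2) \<le> (\<Sum>i\<in>I. (norm (T i))\<^sup>2 * (norm u)\<^sup>2)"
      by (intro sum_mono) (simp flip: power_mult_distrib add: norm_bop_apply power_mono)
    also have "\<dots> \<le> M * (norm u)\<^sup>2"
      unfolding sum_distrib_right[symmetric] by (intro mult_right_mono bound) simp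
    finally show ?thesis using M by (simp add: Xu field_simps)
  qed
  have Y: "Y u = u - X u" for u by (simp add: Y_def X_def)
  note * = symmetric_power_bounds[OF lin sym nonneg le1 Y]
  show "norm ((Y ^^ n) \<xi>) \<le> norm \<xi>" by (rule *(2))
  show "(\<Sum>i\<in>I. (norm (T i \<bullet>\<^sub>B (Y ^^ n) \<xi>))\<^sup>2) \<le> M / (2 * real n + 1) * (norm \<xi>)\<^sup>2"
    using *(1)[of n \<xi>] M unfolding Xu by (simp add: field_simps)
qed

text \<open>The bound expresses that t (1 - t / M)^(2 n) is at most M / (2 n + 1) for t between 0
  and M. It is made a property of the type so that operators and bounded functions into operators,
  where it can be checked on vectors, share the lifting argument.\<close>

definition shrinkable :: "'a::cstar_algebra itself \<Rightarrow> bool" where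
  "shrinkable _ \<longleftrightarrow> (\<forall>(a :: 'a) M n. 0 < M \<longrightarrow> (norm a)\<^sup>2 \<le> M \<longrightarrow>
     (norm (shrink M (a\<^sup>\<star> * a) n a))\<^sup>2 \<le> M / (2 * real n + 1))"

lemma norm_shrink_bop:
  fixes a :: "'a bop"
  assumes "0 < M" "(norm a)\<^sup>2 \<le> M"
  shows "norm (shrink M (a\<^sup>\<star> * a) n a) \<le> sqrt (M / (2 * real n + 1))"
proof (rule norm_bop_bound)
  fix \<xi>
  have "(norm (shrink M (a\<^sup>\<star> * a) n a \<bullet>\<^sub>B \<xi>))\<^sup>2 \<le> M / (2 * real n + 1) * (norm \<xi>)\<^sup>2"
    using bop_symmetric_power_bounds(1)[where M=M and I="{()}" and T="\<lambda>_. a" and n=n and \<xi>=\<xi>] assms by (simp add: shrink_apply)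
  also have "\<dots> = (sqrt (M / (2 * real n + 1)) * norm \<xi>)\<^sup>2"
    using assms by (simp add: power_mult_distrib)
  finally show "norm (shrink M (a\<^sup>\<star> * a) n a \<bullet>\<^sub>B \<xi>) \<le> sqrt (M / (2 * real n + 1)) * norm \<xi>"
    by (rule power2_le_imp_le) (use assms in simp)
qed (use assms in simp)

lemma shrinkable_bop: "shrinkable TYPE('a bop)"
  unfolding shrinkable_def
proof (intro allI impI)
  fix a :: "'a bop" and M :: real and n
  assume M: "0 < M" "(norm a)\<^sup>2 \<le> M"
  have "(norm (shrink M (a\<^sup>\<star> * a) n a))\<^sup>2 \<le> (sqrt (M / (2 * real n + 1)))\<^sup>2"
    by (intro power_mono norm_shrink_bop M) simp
  with M show "(norm (shrink M (a\<^sup>\<star> * a) n a))\<^sup>2 \<le> M / (2 * real n + 1)" by simp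
qed

lemma shrink_bcontfun: "apply_bcontfun (shrink M h n a) x = shrink M (apply_bcontfun h x) n (apply_bcontfun a x)"
  by (induction n) (simp_all add: shrink_Suc)

lemma shrinkable_bcontfun: "shrinkable TYPE('x::metric_space \<Rightarrow>\<^sub>C 'a bop)"
  unfolding shrinkable_def
proof (intro allI impI)
  fix a :: "'x \<Rightarrow>\<^sub>C 'a bop" and M :: real and n
  assume M: "0 < M" "(norm a)\<^sup>2 \<le> M"
  have "norm (shrink M (a\<^sup>\<star> * a) n a) \<le> sqrt (M / (2 * real n + 1))"
  proof (rule norm_bound)
    fix x
    have "(norm (apply_bcontfun a x))\<^sup>2 \<le> M"
      using power_mono[OF norm_bounded norm_ge_zero, of a x 2] M(2) by (rule order.trans)
    from norm_shrink_bop[OF M(1) this] show "norm (apply_bcontfun (shrink M (a\<^sup>\<star> * a) n a) x) \<le> sqrt (M / (2 * real n + 1))"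
      by (simp add: shrink_bcontfun)
  qed
  then have "(norm (shrink M (a\<^sup>\<star> * a) n a))\<^sup>2 \<le> (sqrt (M / (2 * real n + 1)))\<^sup>2"
    by (intro power_mono) auto
  with M show "(norm (shrink M (a\<^sup>\<star> * a) n a))\<^sup>2 \<le> M / (2 * real n + 1)" by simp
qed

lemma shrink_mem:
  assumes A: "cstar_subalgebra A" "a \<in> A" "h \<in> A"
  shows "shrink M h n a \<in> A"
proof (induction n)
  case (Suc n)
  have "(1 / M) *\<^sub>R (shrink M h n a * h) \<in> A"
    using A Suc by (auto simp: cstar_subalgebra_def simp flip: scaleC_of_real)
  with A(1) Suc show ?case unfolding shrink_Suc by (rule cstar_subalgebra_diff)
qed (simp add: A)

section \<open>Approximate lifts along a *-homomorphism\<close>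

lemma star_hom_props:
  assumes f: "star_hom A B f" and A: "cstar_subalgebra A" and x: "x \<in> A" and y: "y \<in> A"
  shows "f (x + y) = f x + f y" "f (x - y) = f x - f y" "f (x * y) = f x * f y" "f (x\<^sup>\<star>) = (f x)\<^sup>\<star>"
    "f (c *\<^sub>C x) = c *\<^sub>C f x" "f (r *\<^sub>R x) = r *\<^sub>R f x" "f 0 = 0"
proof -
  show 1: "f (x + y) = f x + f y" "f (x * y) = f x * f y" "f (x\<^sup>\<star>) = (f x)\<^sup>\<star>" "f (c *\<^sub>C x) = c *\<^sub>C f x" for c
    using f x y by (auto simp: star_hom_def)
  show "f (r *\<^sub>R x) = r *\<^sub>R f x" using 1(4)[of "complex_of_real r"] by (simp add: scaleC_of_real)
  show "f 0 = 0" using 1(4)[of 0] by simp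
  have m: "- y \<in> A" "f (- y) = - f y"
    using f A y unfolding star_hom_def cstar_subalgebra_def by (metis scaleC_minus_one)+
  then have "f (x + - y) = f x + f (- y)" using f x by (auto simp: star_hom_def)
  with m show "f (x - y) = f x - f y" by simp
qed

lemma star_hom_shrink:
  assumes f: "star_hom A B f" and A: "cstar_subalgebra A" "a \<in> A" "h \<in> A"
  shows "f (shrink M h n a) = shrink M (f h) n (f a)"
proof (induction n)
  case (Suc n)
  have s: "shrink M h n a \<in> A" by (rule shrink_mem[OF A])
  then have sh: "shrink M h n a * h \<in> A" using A by (auto simp: cstar_subalgebra_def)
  then have r: "(1 / M) *\<^sub>R (shrink M h n a * h) \<in> A"
    using A by (auto simp: cstar_subalgebra_def simp flip: scaleC_of_real)
  show ?case
    unfolding shrink_Suc star_hom_props(2)[OF f A(1) s r] star_hom_props(6)[OF f A(1) sh sh]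
      star_hom_props(3)[OF f A(1) s A(3)] Suc ..
qed simp

text \<open>The right side is the binomial expansion of (1 - h / M)^n - 1 with every term replaced
  by its norm. It is crude, but it depends only on the size of \<open>h\<close>; after applying a
  *-homomorphism this is |f a|^2, which may be far below |a|^2.\<close>

lemma norm_shrink_diff:
  fixes b :: "'a::cstar_algebra"
  assumes M: "0 < M" and h: "norm h \<le> r"
  shows "norm (b - shrink M h n b) \<le> ((1 + r / M) ^ n - 1) * norm b"
proof -
  have r: "0 \<le> r" using h norm_ge_zero order.trans by blast
  have step: "norm (shrink M h n b * h) \<le> norm (shrink M h n b) * r" for n
    by (rule order.trans[OF norm_mult_ineq]) (intro mult_left_mono h norm_ge_zero)
  have grow: "norm (shrink M h n b) \<le> (1 + r / M) ^ n * norm b" for n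
  proof (induction n)
    case (Suc n)
    have "norm (shrink M h (Suc n) b) \<le> norm (shrink M h n b) + (1 / M) * norm (shrink M h n b * h)"
      unfolding shrink_Suc using norm_triangle_ineq4 M by (metis abs_of_pos divide_pos_pos norm_scaleR zero_less_one)
    also have "\<dots> \<le> norm (shrink M h n b) + (1 / M) * (norm (shrink M h n b) * r)"
      using M by (intro add_left_mono mult_left_mono step) auto
    also have "\<dots> = (1 + r / M) * norm (shrink M h n b)" by (simp add: algebra_simps)
    also have "\<dots> \<le> (1 + r / M) * ((1 + r / M) ^ n * norm b)"
      using r M by (intro mult_left_mono Suc) auto
    finally show ?case by (simp add: mult_ac)
  qed simp
  show ?thesis
  proof (induction n)
    case (Suc n)
    have "norm (b - shrink M h (Suc n) b) \<le> norm (b - shrink M h n b) + norm ((1 / M) *\<^sub>R (shrink M h n b * h))"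
      unfolding shrink_Suc using norm_triangle_ineq[of "b - shrink M h n b" "(1 / M) *\<^sub>R (shrink M h n b * h)"]
      by (simp add: algebra_simps)
    also have "\<dots> \<le> ((1 + r / M) ^ n - 1) * norm b + (1 / M) * ((1 + r / M) ^ n * norm b * r)"
    proof (intro add_mono Suc)
      have "norm (shrink M h n b * h) \<le> (1 + r / M) ^ n * norm b * r"
        by (rule order.trans[OF step]) (intro mult_right_mono grow r)
      then show "norm ((1 / M) *\<^sub>R (shrink M h n b * h)) \<le> (1 / M) * ((1 + r / M) ^ n * norm b * r)"
        using M by (simp add: divide_right_mono)
    qed
    also have "\<dots> = ((1 + r / M) ^ Suc n - 1) * norm b" by (simp add: algebra_simps)
    finally show ?case .
  qed simp
qed

lemma approximate_lift:
  fixes f :: "'a::cstar_algebra \<Rightarrow> 'b::cstar_algebra"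
  assumes sh: "shrinkable TYPE('a)" and A: "cstar_subalgebra A" and f: "star_hom A B f" and a: "a \<in> A"
  shows "\<exists>a'\<in>A. norm a' \<le> 2 * norm (f a) \<and> norm (f a - f a') \<le> norm (f a) / 4"
proof (cases "f a = 0")
  case True
  have "0 \<in> A" using A by (simp add: cstar_subalgebra_def)
  moreover have "f 0 = 0" by (rule star_hom_props(7)[OF f A a a])
  ultimately show ?thesis using True by (intro bexI[of _ 0]) auto
next
  case False
  define r where "r = (norm (f a))\<^sup>2"
  have r: "0 < r" using False by (simp add: r_def)
  \<comment> \<open>M >= |a|^2 is required by \<open>shrinkable\<close>; M >= 16 r keeps r / M, the
    cost of rounding \<open>n\<close> up, below 1/16.\<close>
  define M where "M = max ((norm a)\<^sup>2) (16 * r)"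
  have M: "0 < M" "(norm a)\<^sup>2 \<le> M" "16 * r \<le> M" using r by (auto simp: M_def)
  \<comment> \<open>A large n makes \<open>a'\<close> small, a small n keeps \<open>f a'\<close>
    near \<open>f a\<close>. This choice gives M / (2 n + 1) <= 4 r as well as n r / M <= 1/8 +
    1/16, and exp (3/16) - 1 <= 3/16 + 9/256 < 1/4.\<close>
  define n where "n = nat \<lceil>M / (8 * r)\<rceil>"
  have n: "M / (8 * r) \<le> real n" "real n \<le> M / (8 * r) + 1"
    using M r unfolding n_def by (auto intro: real_nat_ceiling_ge)
  define a' where "a' = shrink M (a\<^sup>\<star> * a) n a"
  have h: "a\<^sup>\<star> * a \<in> A" using A a by (auto simp: cstar_subalgebra_def)
  have "a' \<in> A" unfolding a'_def by (rule shrink_mem[OF A a h])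
  moreover have "norm a' \<le> 2 * norm (f a)"
  proof (rule power2_le_imp_le)
    have "(norm a')\<^sup>2 \<le> M / (2 * real n + 1)"
      using sh M unfolding shrinkable_def a'_def by blast
    also have "\<dots> \<le> 4 * r"
    proof -
      have "M \<le> 8 * r * real n" using n(1) r by (simp add: field_simps)
      also have "\<dots> \<le> 4 * r * (2 * real n + 1)" using r by (simp add: algebra_simps)
      finally show ?thesis by (simp add: field_simps)
    qed
    finally show "(norm a')\<^sup>2 \<le> (2 * norm (f a))\<^sup>2" by (simp add: r_def power_mult_distrib)
  qed simp
  moreover have "norm (f a - f a') \<le> norm (f a) / 4"
  proof -
    have as: "a\<^sup>\<star> \<in> A" using A a by (simp add: cstar_subalgebra_def)
    have fh: "f (a\<^sup>\<star> * a) = (f a)\<^sup>\<star> * f a"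
      using star_hom_props(3)[OF f A as a] star_hom_props(4)[OF f A a a] by simp
    have fa': "f a' = shrink M ((f a)\<^sup>\<star> * f a) n (f a)"
      unfolding a'_def star_hom_shrink[OF f A a h] fh ..
    have "norm (f a - f a') \<le> ((1 + r / M) ^ n - 1) * norm (f a)"
      unfolding fa' by (rule norm_shrink_diff[OF M(1)]) (simp add: r_def cstar_identity)
    also have "\<dots> \<le> 1 / 4 * norm (f a)"
    proof (intro mult_right_mono norm_ge_zero)
      have "real n * (r / M) \<le> (M / (8 * r) + 1) * (r / M)"
        using r M by (intro mult_right_mono n(2)) auto
      also have "\<dots> = 1 / 8 + r / M" using r M by (simp add: field_simps)
      also have "\<dots> \<le> 3 / 16" using M by (simp add: field_simps)
      finally have t: "real n * (r / M) \<le> 3 / 16" .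
      have "(1 + r / M) ^ n \<le> exp (r / M) ^ n"
        using r M by (intro power_mono exp_ge_add_one_self) auto
      also have "\<dots> = exp (real n * (r / M))" by (simp only: exp_of_nat_mult)
      also have "\<dots> \<le> exp (3 / 16)" using t by simp
      also have "\<dots> \<le> 1 + 3 / 16 + (3 / 16)\<^sup>2" by (rule exp_bound) auto
      finally show "(1 + r / M) ^ n - 1 \<le> 1 / 4" by (simp add: power2_eq_square)
    qed
    finally show ?thesis by simp
  qed
  ultimately show ?thesis by blast
qed

text \<open>Successive approximation as in the open mapping theorem: each remainder in the closure
  of the image is halved by subtracting the image of an element of comparable norm, and these
  elements form a geometrically convergent series.\<close>

lemma closed_star_hom_image:
  fixes f :: "'a::cstar_algebra \<Rightarrow> 'b::cstar_algebra"
  assumes sh: "shrinkable TYPE('a)" and A: "cstar_subalgebra A" and f: "star_hom A B f"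
    and contr: "\<And>a. a \<in> A \<Longrightarrow> norm (f a) \<le> norm a"
  shows "closed (f ` A)"
proof -
  note p = star_hom_props[OF f A]
  have A': "0 \<in> A" "\<And>x y. x \<in> A \<Longrightarrow> y \<in> A \<Longrightarrow> x + y \<in> A" using A by (auto simp: cstar_subalgebra_def)
  note Ad = cstar_subalgebra_diff[OF A]
  have f0: "f 0 = 0" by (rule p(7)[OF A'(1) A'(1)])
  let ?C = "closure (f ` A)"
  \<comment> \<open>Choose f a within |b| / 8 of b, so |f a| <= 9/8 |b|. Replacing a by its
    approximate lift gives norm at most 9/4 |b| <= 3 |b| and error at most 1/8 |b| + 9/32 |b| <= |b|
    / 2.\<close>
  have step: "\<exists>a\<in>A. norm a \<le> 3 * norm b \<and> norm (b - f a) \<le> norm b / 2" if b: "b \<in> ?C" for b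
  proof (cases "b = 0")
    case True
    then show ?thesis using A'(1) f0 by (intro bexI[of _ 0]) auto
  next
    case False
    then have "0 < norm b / 8" by simp
    with b obtain y where "y \<in> f ` A" "dist y b < norm b / 8" unfolding closure_approachable by blast
    then obtain a where a: "a \<in> A" "dist (f a) b < norm b / 8" by blast
    obtain a' where a': "a' \<in> A" "norm a' \<le> 2 * norm (f a)" "norm (f a - f a') \<le> norm (f a) / 4"
      using approximate_lift[OF sh A f a(1)] by blast
    have d: "norm (b - f a) < norm b / 8" using a(2) by (simp add: dist_norm norm_minus_commute)
    have "norm (f a) \<le> norm b + norm (b - f a)"
      using norm_triangle_ineq4[of b "b - f a"] by simp
    with d have fa: "norm (f a) \<le> 9/8 * norm b" by simp
    have "norm (b - f a') \<le> norm (b - f a) + norm (f a - f a')"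
      using norm_triangle_ineq[of "b - f a" "f a - f a'"] by simp
    with d a'(3) fa have "norm (b - f a') \<le> norm b / 2" using norm_ge_zero[of b] by linarith
    moreover have "norm a' \<le> 3 * norm b" using a'(2) fa norm_ge_zero[of b] by linarith
    ultimately show ?thesis using a'(1) by blast
  qed
  then have "\<forall>b. \<exists>a. b \<in> ?C \<longrightarrow> a \<in> A \<and> norm a \<le> 3 * norm b \<and> norm (b - f a) \<le> norm b / 2" by blast
  from choice[OF this] obtain g where g: "\<And>b. b \<in> ?C \<Longrightarrow> g b \<in> A" "\<And>b. b \<in> ?C \<Longrightarrow> norm (g b) \<le> 3 * norm b"
    "\<And>b. b \<in> ?C \<Longrightarrow> norm (b - f (g b)) \<le> norm b / 2" by auto
  \<comment> \<open>The remainders have to stay in the closure of the image, the only place where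
    \<open>g\<close> is controlled.\<close>
  have Cdiff: "b - f a \<in> ?C" if b: "b \<in> ?C" and a: "a \<in> A" for a b
  proof -
    obtain v where v: "\<And>n. v n \<in> f ` A" "v \<longlonglongrightarrow> b"
      using b unfolding closure_sequential by blast
    define u where "u n = inv_into A f (v n)" for n
    have u: "\<And>n. u n \<in> A" "(\<lambda>n. f (u n)) \<longlonglongrightarrow> b"
      using v by (simp_all add: u_def inv_into_into f_inv_into_f)
    have "(\<lambda>n. f (u n - a)) \<longlonglongrightarrow> b - f a"
      unfolding p(2)[OF u(1) a] by (intro tendsto_intros u)
    with Ad[OF u(1) a] show ?thesis
      unfolding closure_sequential by (intro exI[of _ "\<lambda>n. f (u n - a)"]) simp
  qed
  have "b \<in> f ` A" if b: "b \<in> ?C" for b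
  proof -
    define bs where "bs = rec_nat b (\<lambda>_ x. x - f (g x))"
    have bs: "bs 0 = b" "\<And>n. bs (Suc n) = bs n - f (g (bs n))" by (simp_all add: bs_def)
    have C: "bs n \<in> ?C" for n by (induction n) (auto simp: bs b intro: Cdiff g)
    have small: "norm (bs n) \<le> (1/2) ^ n * norm b" for n
    proof (induction n)
      case (Suc n)
      have "norm (bs (Suc n)) \<le> norm (bs n) / 2" unfolding bs by (rule g(3)[OF C])
      with Suc show ?case by simp
    qed (simp add: bs)
    define s where "s n = (\<Sum>i<n. g (bs i))" for n
    have sA: "s n \<in> A" for n by (induction n) (auto simp: s_def A' g(1)[OF C])
    have fs: "f (s n) = b - bs n" for n
    proof (induction n)
      case (Suc n)
      have "s (Suc n) = s n + g (bs n)" by (simp add: s_def)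
      then show ?case using p(1)[OF sA g(1)[OF C], of n n] Suc by (simp add: bs)
    qed (simp add: s_def f0 bs)
    have "summable (\<lambda>n. g (bs n))"
    proof (rule summable_comparison_test)
      show "summable (\<lambda>n. 3 * norm b * (1/2 :: real) ^ n)" by (intro summable_mult summable_geometric) simp
      have "norm (g (bs n)) \<le> 3 * norm b * (1/2) ^ n" for n
        using g(2)[OF C[of n]] small[of n] by (simp only: mult.assoc mult.commute[of "norm b"])
      then show "\<exists>N. \<forall>n\<ge>N. norm (g (bs n)) \<le> 3 * norm b * (1/2) ^ n" by blast
    qed
    then have lim: "s \<longlonglongrightarrow> (\<Sum>n. g (bs n))" unfolding s_def by (rule summable_LIMSEQ)
    then have a: "(\<Sum>n. g (bs n)) \<in> A" (is "?a \<in> A")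
      using A sA unfolding cstar_subalgebra_def closed_sequential_limits by blast
    have "(\<lambda>n. f (s n)) \<longlonglongrightarrow> f ?a"
    proof (rule LIM_zero_cancel, rule Lim_null_comparison)
      show "\<forall>\<^sub>F n in sequentially. norm (f (s n) - f ?a) \<le> norm (s n - ?a)"
        using contr[OF Ad[OF sA a]] by (simp add: p(2)[OF sA a])
      show "(\<lambda>n. norm (s n - ?a)) \<longlonglongrightarrow> 0"
        using lim by (simp add: LIM_zero tendsto_norm_zero)
    qed
    moreover have "(\<lambda>n. f (s n)) \<longlonglongrightarrow> b"
    proof -
      have "bs \<longlonglongrightarrow> 0"
      proof (rule Lim_null_comparison)
        show "\<forall>\<^sub>F n in sequentially. norm (bs n) \<le> (1/2) ^ n * norm b" using small by simp
        show "(\<lambda>n. (1/2 :: real) ^ n * norm b) \<longlonglongrightarrow> 0"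
          by (intro tendsto_mult_left_zero LIMSEQ_power_zero) simp
      qed
      from tendsto_diff[OF tendsto_const[of b] this] show ?thesis by (simp add: fs)
    qed
    ultimately have "f ?a = b" by (rule LIMSEQ_unique)
    with a show ?thesis by blast
  qed
  then have "?C = f ` A" using closure_subset by blast
  then show ?thesis by (metis closed_closure)
qed

text \<open>One inclusion is continuity; the other needs the image to be closed. This identifies the
  images of all four maps of the diagram from their values on generators.\<close>

lemma star_hom_image_closure_lspan:
  fixes f :: "'a::cstar_algebra \<Rightarrow> 'b::cstar_algebra"
  assumes sh: "shrinkable TYPE('a)" and A: "cstar_subalgebra A" and f: "star_hom A B f"
    and contr: "\<And>a. a \<in> A \<Longrightarrow> norm (f a) \<le> norm a" and AG: "A = closure (lspan G)"
  shows "f ` A = closure (lspan (f ` G))"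
proof
  note p = star_hom_props[OF f A]
  have sub: "lspan G \<subseteq> A" unfolding AG by (rule closure_subset)
  have GA: "G \<subseteq> A" using sub lspan_base by blast
  have lsp: "f x \<in> lspan (f ` G)" if "x \<in> lspan G" for x
    using that
  proof induction
    case lspan_zero
    then show ?case using p(7) A by (auto simp: cstar_subalgebra_def intro: lspan.intros)
  next
    case (lspan_add x y)
    then have "f (x + y) = f x + f y" using p(1)[of x y] sub by blast
    with lspan_add show ?case by (simp add: lspan.lspan_add)
  next
    case (lspan_scale x c)
    then have "f (c *\<^sub>C x) = c *\<^sub>C f x" using p(5)[of x x c] sub by blast
    with lspan_scale show ?case by (simp add: lspan.lspan_scale)
  qed (auto intro: lspan.intros)
  have sub_img: "f ` G \<subseteq> f ` A" using GA by blast
  have "lspan (f ` G) \<subseteq> f ` A"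
  proof
    fix y assume "y \<in> lspan (f ` G)"
    then show "y \<in> f ` A"
    proof induction
      case lspan_zero
      have "0 \<in> A" using A by (simp add: cstar_subalgebra_def)
      with p(7)[OF this this] show ?case by force
    next
      case (lspan_add x y)
      then obtain u v where "u \<in> A" "v \<in> A" "x = f u" "y = f v" by blast
      with p(1)[of u v] A show ?case by (auto simp: cstar_subalgebra_def intro!: image_eqI[of _ _ "u + v"])
    next
      case (lspan_scale x c)
      then obtain u where "u \<in> A" "x = f u" by blast
      with p(5)[of u u c] A show ?case by (auto simp: cstar_subalgebra_def intro!: image_eqI[of _ _ "c *\<^sub>C u"])
    qed (use GA in blast)
  qed
  then show "closure (lspan (f ` G)) \<subseteq> f ` A"
    by (intro closure_minimal closed_star_hom_image[OF sh A f contr])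
  show "f ` A \<subseteq> closure (lspan (f ` G))"
  proof clarify
    fix a assume a: "a \<in> A"
    then obtain u where u: "\<And>n. u n \<in> lspan G" "u \<longlonglongrightarrow> a" unfolding AG closure_sequential by blast
    have "(\<lambda>n. f (u n)) \<longlonglongrightarrow> f a"
    proof (rule LIM_zero_cancel, rule Lim_null_comparison)
      have "norm (f (u n) - f a) \<le> norm (u n - a)" for n
        using contr[OF cstar_subalgebra_diff[OF A _ a]] p(2)[OF _ a] u(1)[of n] sub by auto
      then show "\<forall>\<^sub>F n in sequentially. norm (f (u n) - f a) \<le> norm (u n - a)" by simp
      show "(\<lambda>n. norm (u n - a)) \<longlonglongrightarrow> 0"
        using u(2) by (simp add: LIM_zero tendsto_norm_zero)
    qed
    moreover have "\<forall>n. f (u n) \<in> lspan (f ` G)" using lsp[OF u(1)] by blast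
    ultimately show "f a \<in> closure (lspan (f ` G))"
      unfolding closure_sequential by (intro exI[of _ "\<lambda>n. f (u n)"]) simp
  qed
qed

section \<open>The full C*-algebra of an inverse semigroup\<close>

lemma l1_add: "f \<in> l1 \<Longrightarrow> g \<in> l1 \<Longrightarrow> (\<lambda>s. f s + g s) \<in> l1"
  unfolding l1_def mem_Collect_eq
proof (rule summable_on_comparison_test)
  assume "(\<lambda>s. cmod (f s)) summable_on UNIV" "(\<lambda>s. cmod (g s)) summable_on UNIV"
  then show "(\<lambda>s. cmod (f s) + cmod (g s)) summable_on UNIV" by (rule summable_on_add)
qed (auto intro: norm_triangle_ineq)

lemma l1_scale: "f \<in> l1 \<Longrightarrow> (\<lambda>s. c * f s) \<in> l1"
  unfolding l1_def mem_Collect_eq norm_mult by (rule summable_on_cmult_right)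

lemma l1_unit: "(\<lambda>t. if t = s then 1 else 0) \<in> l1"
  unfolding l1_def
  by (auto intro!: finite_nonzero_values_imp_summable_on intro: finite_subset[of _ "{s}"])

lemma l1_term_bound: "norm (f s *\<^sub>C rep_apply \<pi> s) \<le> cmod (f s)"
  using mult_left_mono[OF norm_rep_le_1[of \<pi> s], of "cmod (f s)"] by (simp add: norm_scaleC)

lemma l1_term_summable:
  assumes "f \<in> l1" shows "(\<lambda>s. norm (f s *\<^sub>C rep_apply \<pi> s)) summable_on A"
    and "(\<lambda>s. f s *\<^sub>C rep_apply \<pi> s) summable_on A"
proof -
  have "(\<lambda>s. cmod (f s)) summable_on A"
    using assms unfolding l1_def mem_Collect_eq by (rule summable_on_subset_banach) simp
  then show "(\<lambda>s. norm (f s *\<^sub>C rep_apply \<pi> s)) summable_on A"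
    by (rule summable_on_comparison_test) (auto simp: l1_term_bound)
  then show "(\<lambda>s. f s *\<^sub>C rep_apply \<pi> s) summable_on A" by (rule abs_summable_summable)
qed

lemma l1_hat_add: "f \<in> l1 \<Longrightarrow> g \<in> l1 \<Longrightarrow> l1_hat (\<lambda>s. f s + g s) = l1_hat f + l1_hat g"
  by (rule bcontfun_eqI)
    (simp add: l1_hat_apply l1_add scaleC_add_left infsum_add l1_term_summable)

lemma l1_hat_scale: "f \<in> l1 \<Longrightarrow> l1_hat (\<lambda>s. c * f s) = c *\<^sub>C l1_hat f"
proof (rule bcontfun_eqI)
  fix \<pi> assume f: "f \<in> l1"
  have "(\<Sum>\<^sub>\<infinity>s. c *\<^sub>C (f s *\<^sub>C rep_apply \<pi> s)) = c *\<^sub>C (\<Sum>\<^sub>\<infinity>s. f s *\<^sub>C rep_apply \<pi> s)"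
    by (rule infsumI[OF has_sum_bounded_linear[OF scaleC_bounded_linear
            has_sum_infsum[OF l1_term_summable(2)[OF f]]]])
  then show "apply_bcontfun (l1_hat (\<lambda>s. c * f s)) \<pi> = apply_bcontfun (c *\<^sub>C l1_hat f) \<pi>"
    by (simp add: l1_hat_apply f l1_scale scaleC_scaleC)
qed

lemma apply_bcontfun_sum: "apply_bcontfun (\<Sum>x\<in>F. f x) \<pi> = (\<Sum>x\<in>F. apply_bcontfun (f x) \<pi>)"
  by (induction F rule: infinite_finite_induct) auto

lemma lspan_sum: "(\<And>x. x \<in> F \<Longrightarrow> f x \<in> lspan G) \<Longrightarrow> (\<Sum>x\<in>F. f x) \<in> lspan G"
  by (induction F rule: infinite_finite_induct) (auto intro: lspan.intros)

text \<open>Semigroup elements act as contractions in every representation, so the l1 tail beyond a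
  finite set bounds the error uniformly over representations.\<close>

lemma l1_hat_mem_closure_lspan:
  assumes f: "f \<in> l1"
  shows "(l1_hat f :: ('p::inverse_semigroup, 'h) full) \<in> closure (lspan (range full_gen))"
  unfolding closure_approachable
proof (intro allI impI)
  fix e :: real assume e: "0 < e"
  let ?n = "\<lambda>s. cmod (f s)"
  have sm: "?n summable_on B" for B
    using f unfolding l1_def mem_Collect_eq by (rule summable_on_subset_banach) simp
  have "\<forall>\<^sub>F F in finite_subsets_at_top UNIV. dist (sum ?n F) (infsum ?n UNIV) < e"
    using tendstoD[OF infsum_tendsto[OF sm] e] .
  then obtain F where F: "finite F" "dist (sum ?n F) (infsum ?n UNIV) < e"
    unfolding eventually_finite_subsets_at_top by blast
  have "infsum ?n UNIV = infsum ?n F + infsum ?n (- F)"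
    by (subst infsum_Un_disjoint[symmetric]) (auto simp: sm)
  with F have tail: "infsum ?n (- F) < e" by (simp add: dist_real_def)
  define g :: "('p, 'h) full" where "g = (\<Sum>s\<in>F. f s *\<^sub>C full_gen s)"
  have "g \<in> lspan (range full_gen)"
    unfolding g_def by (intro lspan_sum lspan.intros) auto
  moreover have "dist g (l1_hat f) < e"
  proof -
    have "norm (l1_hat f - g) \<le> infsum ?n (- F)"
    proof (rule norm_bound)
      fix \<pi> :: "('p, 'h) rep"
      let ?t = "\<lambda>s. f s *\<^sub>C rep_apply \<pi> s"
      have "infsum ?t UNIV = infsum ?t F + infsum ?t (- F)"
        by (subst infsum_Un_disjoint[symmetric]) (auto simp: l1_term_summable(2)[OF f])
      then have "apply_bcontfun (l1_hat f - g) \<pi> = infsum ?t (- F)"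
        using F(1) by (simp add: l1_hat_apply[OF f] g_def apply_bcontfun_sum full_gen_apply)
      also have "norm \<dots> \<le> (\<Sum>\<^sub>\<infinity>s\<in>-F. norm (?t s))"
        by (rule norm_infsum_bound[OF l1_term_summable(1)[OF f]])
      also have "\<dots> \<le> infsum ?n (- F)"
        by (rule infsum_mono) (simp_all add: l1_term_summable(1)[OF f] sm l1_term_bound)
      finally show "norm (apply_bcontfun (l1_hat f - g) \<pi>) \<le> infsum ?n (- F)" .
    qed
    with tail show ?thesis by (simp add: dist_norm norm_minus_commute)
  qed
  ultimately show "\<exists>y\<in>lspan (range full_gen). dist y (l1_hat f :: ('p, 'h) full) < e" by blast
qed

lemma full_cstar_eq: "full_cstar = closure (lspan (range full_gen))"
proof
  show "full_cstar \<subseteq> closure (lspan (range full_gen))"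
    unfolding full_cstar_def by (intro closure_minimal) (auto intro: l1_hat_mem_closure_lspan)
  have "x \<in> l1_hat ` l1" if "x \<in> lspan (range full_gen)" for x :: "('p::inverse_semigroup, 'h) full"
    using that
  proof induction
    case lspan_zero
    have z: "l1_hat (\<lambda>s. 0 * (if s = undefined then 1 else 0)) = (0 :: ('p, 'h) full)"
      unfolding l1_hat_scale[OF l1_unit] by simp
    show ?case
      by (rule image_eqI[where x="\<lambda>s. 0 * (if s = undefined then 1 else 0)"])
        (simp_all only: z l1_scale[OF l1_unit])
  next
    case (lspan_base g)
    then show ?case by (auto simp: full_gen_def l1_unit)
  next
    case (lspan_add x y)
    then obtain f g where "f \<in> l1" "x = l1_hat f" "g \<in> l1" "y = l1_hat g" by blast
    then show ?case by (intro image_eqI[where x="\<lambda>s. f s + g s"]) (simp_all add: l1_add l1_hat_add)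
  next
    case (lspan_scale x c)
    then obtain f where "f \<in> l1" "x = l1_hat f" by blast
    then show ?case by (intro image_eqI[where x="\<lambda>s. c * f s"]) (simp_all add: l1_scale l1_hat_scale)
  qed
  then show "closure (lspan (range full_gen)) \<subseteq> full_cstar"
    unfolding full_cstar_def by (intro closure_mono) blast
qed

lemma star_rep_apply:
  "rep_apply \<pi> (s * t) = rep_apply \<pi> s * rep_apply \<pi> t" "rep_apply \<pi> (s\<^sup>\<star>) = (rep_apply \<pi> s)\<^sup>\<star>"
  "is_zero z \<Longrightarrow> rep_apply \<pi> z = 0"
  using rep_apply[of \<pi>] by (simp_all add: star_rep_def)

lemma full_gen_mult: "full_gen s * full_gen t = full_gen (s * t)"
  and full_gen_invol: "(full_gen s)\<^sup>\<star> = full_gen (s\<^sup>\<star>)"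
  and full_gen_zero: "is_zero z \<Longrightarrow> full_gen z = 0"
  by (rule bcontfun_eqI; simp add: full_gen_apply star_rep_apply)+

lemma cstar_subalgebra_full: "cstar_subalgebra full_cstar"
  unfolding full_cstar_eq
  by (rule cstar_subalgebra_closure_lspan) (auto simp: full_gen_mult full_gen_invol)

lemma full_gen_mem: "full_gen s \<in> full_cstar"
  unfolding full_cstar_eq by (rule subsetD[OF closure_subset], rule lspan_base) simp

lemma apply_bcontfun_bounded_linear: "bounded_linear (\<lambda>f. apply_bcontfun f x)"
  by (rule bounded_linear_intro[where K=1]) (auto simp: norm_bounded)

section \<open>Compression to a subspace spanned by basis vectors\<close>

text \<open>For injective \<open>i\<close> this is the adjoint of the isometry
  \<open>ell2_embed i\<close>, see \<open>cinner_embed\<close>.\<close>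

definition ell2_pull :: "('a \<Rightarrow> 'b) \<Rightarrow> 'b ell2 \<Rightarrow> 'a ell2" where
  "ell2_pull i \<eta> = Abs_ell2 (\<lambda>x. ell2_nth \<eta> (i x))"

lemma ell2_nth_pull: "inj i \<Longrightarrow> ell2_nth (ell2_pull i \<eta>) x = ell2_nth \<eta> (i x)"
  and norm_pull: "inj i \<Longrightarrow> norm (ell2_pull i \<eta>) \<le> norm \<eta>"
  using ell2_pull_mem[of i UNIV \<eta>] by (simp_all add: ell2_pull_def Abs_ell2_inverse)

lemma pull_simps:
  assumes "inj i"
  shows "ell2_pull i (f + g) = ell2_pull i f + ell2_pull i g" "ell2_pull i (c *\<^sub>C f) = c *\<^sub>C ell2_pull i f"
    "ell2_pull i (ell2_embed i h) = h" "ell2_pull i (delta (i a)) = delta a"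
    "b \<notin> range i \<Longrightarrow> ell2_pull i (delta b) = 0"
  by (rule ell2_eqI; use assms in \<open>auto simp: ell2_nth_pull ell2_nth_embed delta.rep_eq inj_eq\<close>)+

lemma embed_simps:
  "ell2_embed i (f + g) = ell2_embed i f + ell2_embed i g" "ell2_embed i (c *\<^sub>C f) = c *\<^sub>C ell2_embed i f"
  "ell2_embed i 0 = 0"
  by (rule ell2_eqI; simp add: ell2_nth_embed)+

lemma cinner_embed:
  assumes i: "inj i"
  shows "cinner (ell2_embed i \<xi>) \<eta> = cinner \<xi> (ell2_pull i \<eta>)"
proof -
  have "cinner (ell2_embed i \<xi>) \<eta> = (\<Sum>\<^sub>\<infinity>u\<in>range i. ell2_nth \<xi> (inv i u) * cnj (ell2_nth \<eta> u))"
    unfolding cinner_def by (rule infsum_cong_neutral) (auto simp: ell2_nth_embed)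
  also have "\<dots> = (\<Sum>\<^sub>\<infinity>x. ell2_nth \<xi> x * cnj (ell2_nth \<eta> (i x)))"
    by (subst infsum_reindex[OF i]) (simp add: o_def i)
  finally show ?thesis by (simp add: cinner_def ell2_nth_pull[OF i])
qed

lemma norm_embed:
  assumes i: "inj i" shows "norm (ell2_embed i \<xi>) = norm \<xi>"
proof -
  have "complex_of_real ((norm (ell2_embed i \<xi>))\<^sup>2) = complex_of_real ((norm \<xi>)\<^sup>2)"
    unfolding cinner_self_norm[symmetric] cinner_embed[OF i] pull_simps(3)[OF i] ..
  then show ?thesis by (simp only: of_real_eq_iff) simp
qed

lemma embed_inject: "inj i \<Longrightarrow> ell2_embed i \<xi> = ell2_embed i \<eta> \<longleftrightarrow> \<xi> = \<eta>"
  by (metis pull_simps(3))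

text \<open>With V the isometry \<open>ell2_embed i\<close>, this is the product of the adjoint of
  V, T and V. The operator is chosen by its action; \<open>compress_apply\<close> supplies existence
  for injective \<open>i\<close>.\<close>

definition compress :: "('a \<Rightarrow> 'b) \<Rightarrow> 'b bop \<Rightarrow> 'a bop" where
  "compress i T = (SOME U. \<forall>\<xi>. U \<bullet>\<^sub>B \<xi> = ell2_pull i (T \<bullet>\<^sub>B ell2_embed i \<xi>))"

text \<open>T transported to the range of \<open>ell2_embed i\<close> and extended by 0 on the
  orthogonal complement. This turns a representation on a smaller l2 into one on l2('h).\<close>

definition dilate :: "('a \<Rightarrow> 'b) \<Rightarrow> 'a bop \<Rightarrow> 'b bop" where
  "dilate i T = (SOME U. \<forall>\<xi>. U \<bullet>\<^sub>B \<xi> = ell2_embed i (T \<bullet>\<^sub>B ell2_pull i \<xi>))"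

lemma compress_apply:
  assumes i: "inj i"
  shows "compress i T \<bullet>\<^sub>B \<xi> = ell2_pull i (T \<bullet>\<^sub>B ell2_embed i \<xi>)"
proof -
  have "\<exists>U. \<forall>\<xi>. U \<bullet>\<^sub>B \<xi> = ell2_pull i (T \<bullet>\<^sub>B ell2_embed i \<xi>)"
  proof (rule bop_blinfunI[where K="norm T"])
    show "norm (ell2_pull i (T \<bullet>\<^sub>B ell2_embed i x)) \<le> norm x * norm T" for x
      using order.trans[OF norm_pull[OF i] norm_bop_apply, of T "ell2_embed i x"]
      by (simp add: norm_embed[OF i] mult.commute)
  qed (simp_all add: embed_simps pull_simps[OF i] bop_add bop_scaleC)
  from someI_ex[OF this] show ?thesis unfolding compress_def by blast
qed

lemma dilate_apply:
  assumes i: "inj i"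
  shows "dilate i T \<bullet>\<^sub>B \<xi> = ell2_embed i (T \<bullet>\<^sub>B ell2_pull i \<xi>)"
proof -
  have "\<exists>U. \<forall>\<xi>. U \<bullet>\<^sub>B \<xi> = ell2_embed i (T \<bullet>\<^sub>B ell2_pull i \<xi>)"
  proof (rule bop_blinfunI[where K="norm T"])
    fix x
    have "norm (T \<bullet>\<^sub>B ell2_pull i x) \<le> norm T * norm x"
      by (rule order.trans[OF norm_bop_apply]) (intro mult_left_mono norm_pull i norm_ge_zero)
    then show "norm (ell2_embed i (T \<bullet>\<^sub>B ell2_pull i x)) \<le> norm x * norm T"
      by (simp add: norm_embed[OF i] mult.commute)
  qed (simp_all add: embed_simps pull_simps[OF i] bop_add bop_scaleC)
  from someI_ex[OF this] show ?thesis unfolding dilate_def by blast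
qed

lemma compress_simps:
  assumes i: "inj i"
  shows "compress i (S + T) = compress i S + compress i T" "compress i (c *\<^sub>C T) = c *\<^sub>C compress i T"
    "compress i (T\<^sup>\<star>) = (compress i T)\<^sup>\<star>" "compress i 0 = 0" "compress i (dilate i U) = U"
    "norm (compress i T) \<le> norm T"
proof -
  show "compress i (S + T) = compress i S + compress i T" "compress i (c *\<^sub>C T) = c *\<^sub>C compress i T"
    "compress i (dilate i U) = U"
    by (rule bop_eqI; simp add: compress_apply[OF i] dilate_apply[OF i] pull_simps[OF i])+
  show "compress i 0 = 0"
    by (rule bop_eqI) (use pull_simps(2)[OF i, where c=0 and f=0] in \<open>simp add: compress_apply[OF i]\<close>)
  have "cinner (compress i T \<bullet>\<^sub>B x) y = cinner x (compress i (T\<^sup>\<star>) \<bullet>\<^sub>B y)" for x y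
  proof -
    have "cinner (compress i T \<bullet>\<^sub>B x) y = cnj (cinner (ell2_embed i y) (T \<bullet>\<^sub>B ell2_embed i x))"
      unfolding compress_apply[OF i] cinner_embed[OF i] by (rule cinner_commute)
    also have "\<dots> = cinner (T \<bullet>\<^sub>B ell2_embed i x) (ell2_embed i y)" by (rule cinner_commute[symmetric])
    also have "\<dots> = cinner x (compress i (T\<^sup>\<star>) \<bullet>\<^sub>B y)"
      by (simp add: bop_adjoint compress_apply[OF i] cinner_embed[OF i])
    finally show ?thesis .
  qed
  then show "compress i (T\<^sup>\<star>) = (compress i T)\<^sup>\<star>" by (rule bop_adjoint_unique[symmetric])
  show "norm (compress i T) \<le> norm T"
  proof (rule norm_bop_bound)
    show "norm (compress i T \<bullet>\<^sub>B x) \<le> norm T * norm x" for x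
      using order.trans[OF norm_pull[OF i] norm_bop_apply, of T "ell2_embed i x"]
      by (simp add: norm_embed[OF i] compress_apply[OF i])
  qed simp
qed

lemma dilate_simps:
  assumes i: "inj i"
  shows "dilate i (S * T) = dilate i S * dilate i T" "dilate i (T\<^sup>\<star>) = (dilate i T)\<^sup>\<star>" "dilate i 0 = 0"
proof -
  show "dilate i (S * T) = dilate i S * dilate i T" "dilate i 0 = 0"
    by (rule bop_eqI; simp add: dilate_apply[OF i] pull_simps[OF i] embed_simps)+
  have "cinner (dilate i T \<bullet>\<^sub>B x) y = cinner x (dilate i (T\<^sup>\<star>) \<bullet>\<^sub>B y)" for x y
  proof -
    have "cinner (dilate i T \<bullet>\<^sub>B x) y = cinner (ell2_pull i x) (T\<^sup>\<star> \<bullet>\<^sub>B ell2_pull i y)"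
      by (simp add: dilate_apply[OF i] cinner_embed[OF i] bop_adjoint)
    also have "\<dots> = cnj (cinner (ell2_embed i (T\<^sup>\<star> \<bullet>\<^sub>B ell2_pull i y)) x)"
      unfolding cinner_embed[OF i] by (rule cinner_commute)
    also have "\<dots> = cinner x (ell2_embed i (T\<^sup>\<star> \<bullet>\<^sub>B ell2_pull i y))" by (rule cinner_commute[symmetric])
    finally show ?thesis by (simp add: dilate_apply[OF i])
  qed
  then show "dilate i (T\<^sup>\<star>) = (dilate i T)\<^sup>\<star>" by (rule bop_adjoint_unique[symmetric])
qed

lemma compress_bounded_linear: "inj i \<Longrightarrow> bounded_linear (compress i)"
  by (rule bounded_linear_intro[where K=1])
    (simp_all add: compress_simps flip: scaleC_of_real)

lemma embed_bounded_linear: "inj i \<Longrightarrow> bounded_linear (ell2_embed i)"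
  by (rule bounded_linear_intro[where K=1]) (simp_all add: embed_simps norm_embed scaleR_scaleC_ell2)

lemma bop_apply_bounded_linear: "bounded_linear (\<lambda>T. T \<bullet>\<^sub>B \<xi>)"
  by (rule bounded_linear_intro[where K="norm \<xi>"]) (simp_all add: norm_bop_apply)

text \<open>Invariance of the range of \<open>ell2_embed i\<close>, written as an equation that is
  linear and continuous in \<open>T\<close>, so that it passes to closed spans.\<close>

definition leaves_invariant :: "('a \<Rightarrow> 'b) \<Rightarrow> 'b bop \<Rightarrow> bool" where
  "leaves_invariant i T \<longleftrightarrow> (\<forall>\<xi>. T \<bullet>\<^sub>B ell2_embed i \<xi> = ell2_embed i (compress i T \<bullet>\<^sub>B \<xi>))"

lemma leaves_invariantI:
  assumes i: "inj i" and "\<And>\<xi>. T \<bullet>\<^sub>B ell2_embed i \<xi> = ell2_embed i (U \<bullet>\<^sub>B \<xi>)"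
  shows "leaves_invariant i T" "compress i T = U"
proof -
  show *: "compress i T = U"
    by (rule bop_eqI) (simp add: compress_apply[OF i] assms pull_simps[OF i])
  show "leaves_invariant i T" unfolding leaves_invariant_def * using assms by blast
qed

lemma compress_mult:
  "inj i \<Longrightarrow> leaves_invariant i T \<Longrightarrow> compress i (S * T) = compress i S * compress i T"
  by (rule bop_eqI) (simp add: compress_apply leaves_invariant_def)

lemma closed_leaves_invariant:
  assumes i: "inj i" shows "closed {T. leaves_invariant i T}"
proof -
  have "closed {T. T \<bullet>\<^sub>B ell2_embed i \<xi> = ell2_embed i (compress i T \<bullet>\<^sub>B \<xi>)}" for \<xi>
    by (intro closed_Collect_eq bounded_linear.continuous_on[OF bop_apply_bounded_linear]
        bounded_linear.continuous_on[OF embed_bounded_linear[OF i]]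
        bounded_linear.continuous_on[OF compress_bounded_linear[OF i]] continuous_on_id)
  then show ?thesis unfolding leaves_invariant_def by (rule closed_Collect_all)
qed

lemma leaves_invariant_closure_lspan:
  assumes i: "inj i" and "T \<in> closure (lspan G)" and "\<And>g. g \<in> G \<Longrightarrow> leaves_invariant i g"
  shows "leaves_invariant i T"
  using assms(2) closed_leaves_invariant[OF i]
proof (rule closure_lspan_induct)
  show "leaves_invariant i 0" by (simp add: leaves_invariant_def compress_simps[OF i] embed_simps)
qed (use assms(3) in \<open>simp_all add: leaves_invariant_def compress_simps[OF i] embed_simps\<close>)

text \<open>\<open>dilate i 1\<close> is the projection onto the range of
  \<open>ell2_embed i\<close>. After multiplying by it, the two sides become operators on the large
  space that agree on its basis, both being 0 at basis vectors outside the range of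
  \<open>i\<close>.\<close>

lemma intertwine_on_basis:
  assumes i: "inj i" and "\<And>s. T \<bullet>\<^sub>B delta (i s) = ell2_embed i (U \<bullet>\<^sub>B delta s)"
  shows "T \<bullet>\<^sub>B ell2_embed i \<xi> = ell2_embed i (U \<bullet>\<^sub>B \<xi>)"
proof -
  have "T * dilate i 1 = dilate i U"
  proof (rule bop_eq_on_basis)
    fix b
    show "(T * dilate i 1) \<bullet>\<^sub>B delta b = dilate i U \<bullet>\<^sub>B delta b"
    proof (cases "b \<in> range i")
      case True
      then show ?thesis
        by (auto simp: dilate_apply[OF i] pull_simps[OF i] ell2_embed_delta[OF i] assms(2))
    next
      case False
      then show ?thesis by (simp add: dilate_apply[OF i] pull_simps(5)[OF i] embed_simps bop_zero)
    qed
  qed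
  then have "(T * dilate i 1) \<bullet>\<^sub>B ell2_embed i \<xi> = dilate i U \<bullet>\<^sub>B ell2_embed i \<xi>" by simp
  then show ?thesis by (simp add: dilate_apply[OF i] pull_simps[OF i])
qed

section \<open>Homomorphisms induced by representations and quotients\<close>

text \<open>Elements of \<open>full\<close> are functions on the representations on l2('h), so the
  homomorphism induced by \<open>\<pi>\<close> is evaluation at its dilation, brought back by
  compression.\<close>

definition rep_hom :: "('x \<Rightarrow> 'h) \<Rightarrow> ('p::inverse_semigroup \<Rightarrow> 'x bop) \<Rightarrow> ('p, 'h) full \<Rightarrow> 'x bop" where
  "rep_hom i \<pi> a = compress i (apply_bcontfun a (Abs_rep (\<lambda>s. dilate i (\<pi> s))))"

lemma rep_hom:
  fixes \<pi> :: "'p::inverse_semigroup \<Rightarrow> 'x bop" and i :: "'x \<Rightarrow> 'h"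
  assumes i: "inj i" and \<pi>: "star_rep \<pi>"
  shows "rep_hom i \<pi> (full_gen s) = \<pi> s" "star_hom full_cstar UNIV (rep_hom i \<pi>)"
    "norm (rep_hom i \<pi> a) \<le> norm a" "rep_hom i \<pi> ` full_cstar = closure (lspan (range \<pi>))"
    "bounded_linear (rep_hom i \<pi>)" "rep_hom i \<pi> (c *\<^sub>C a) = c *\<^sub>C rep_hom i \<pi> a"
proof -
  have rep: "rep_apply (Abs_rep (\<lambda>s. dilate i (\<pi> s))) = (\<lambda>s. dilate i (\<pi> s))"
    using \<pi> by (intro Abs_rep_inverse) (simp add: star_rep_def dilate_simps[OF i])
  show gen: "rep_hom i \<pi> (full_gen s) = \<pi> s" for s
    by (simp add: rep_hom_def full_gen_apply rep compress_simps[OF i])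
  show norm: "norm (rep_hom i \<pi> a) \<le> norm a" for a
    unfolding rep_hom_def by (rule order.trans[OF compress_simps(6)[OF i] norm_bounded])
  have lin: "rep_hom i \<pi> (a + b) = rep_hom i \<pi> a + rep_hom i \<pi> b" "rep_hom i \<pi> (c *\<^sub>C a) = c *\<^sub>C rep_hom i \<pi> a"
    "rep_hom i \<pi> (a\<^sup>\<star>) = (rep_hom i \<pi> a)\<^sup>\<star>" for a b c
    by (simp_all add: rep_hom_def compress_simps[OF i])
  show "rep_hom i \<pi> (c *\<^sub>C a) = c *\<^sub>C rep_hom i \<pi> a" by (rule lin)
  show "bounded_linear (rep_hom i \<pi>)"
    by (rule bounded_linear_intro[where K=1]) (simp_all add: lin norm flip: scaleC_of_real)
  \<comment> \<open>Dilated operators preserve the embedded space; this passes to the closed span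
    and makes the compression multiplicative.\<close>
  have inv: "leaves_invariant i (apply_bcontfun a (Abs_rep (\<lambda>s. dilate i (\<pi> s))))"
    if "a \<in> full_cstar" for a
    using that[unfolded full_cstar_eq]
  proof (rule closure_lspan_induct)
    show "closed {a. leaves_invariant i (apply_bcontfun a (Abs_rep (\<lambda>s. dilate i (\<pi> s))))}"
      using continuous_closed_vimage[OF closed_leaves_invariant[OF i],
          of "\<lambda>a. apply_bcontfun a (Abs_rep (\<lambda>s. dilate i (\<pi> s)))"]
      by (simp add: vimage_def bounded_linear.isCont[OF apply_bcontfun_bounded_linear])
    fix g :: "('p, 'h) full" assume "g \<in> range full_gen"
    then show "leaves_invariant i (apply_bcontfun g (Abs_rep (\<lambda>s. dilate i (\<pi> s))))"
      by (auto simp: full_gen_apply rep leaves_invariant_def dilate_apply[OF i] pull_simps[OF i]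
          compress_simps[OF i])
  qed (simp_all add: leaves_invariant_def compress_simps[OF i] embed_simps)
  show hom: "star_hom full_cstar UNIV (rep_hom i \<pi>)"
    unfolding star_hom_def
    by (auto simp: lin) (simp add: rep_hom_def compress_mult[OF i inv])
  show "rep_hom i \<pi> ` full_cstar = closure (lspan (range \<pi>))"
    by (subst star_hom_image_closure_lspan[OF shrinkable_bcontfun cstar_subalgebra_full hom norm full_cstar_eq])
      (simp add: image_image gen)
qed

text \<open>The two conditions on zeros reflect that representations must annihilate a zero:
  \<open>q_zero\<close> lets representations be pulled back along \<open>q\<close>, and
  \<open>q_zero_lift\<close> lets a representation that factors through \<open>q\<close>
  descend.\<close>

locale inverse_semigroup_quotient =
  fixes q :: "'p::inverse_semigroup \<Rightarrow> 'q::inverse_semigroup"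
  assumes q_mult: "q (s * t) = q s * q t" and q_star: "q (s\<^sup>\<star>) = (q s)\<^sup>\<star>" and q_surj: "surj q"
    and q_zero: "is_zero z \<Longrightarrow> is_zero (q z)" and q_zero_lift: "is_zero w \<Longrightarrow> \<exists>z. is_zero z \<and> q z = w"
begin

definition pull_rep :: "('q, 'h) rep \<Rightarrow> ('p, 'h) rep" where
  "pull_rep \<sigma> = Abs_rep (\<lambda>s. rep_apply \<sigma> (q s))"

lemma pull_rep_apply: "rep_apply (pull_rep \<sigma>) s = rep_apply \<sigma> (q s)"
proof -
  have "star_rep (\<lambda>s. rep_apply \<sigma> (q s))"
    by (simp add: star_rep_def q_mult q_star star_rep_apply q_zero)
  then show ?thesis by (simp add: pull_rep_def Abs_rep_inverse)
qed

definition quotient_hom :: "('p, 'h) full \<Rightarrow> ('q, 'h) full" where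
  "quotient_hom a = Bcontfun (\<lambda>\<sigma>. apply_bcontfun a (pull_rep \<sigma>))"

lemma quotient_hom_apply: "apply_bcontfun (quotient_hom a) \<sigma> = apply_bcontfun a (pull_rep \<sigma>)"
  unfolding quotient_hom_def
proof (subst Bcontfun_inverse)
  show "(\<lambda>\<sigma>. apply_bcontfun a (pull_rep \<sigma>)) \<in> bcontfun"
    by (rule bcontfun_normI[of _ "norm a"]) (auto simp: continuous_on_open_vimage rep_open norm_bounded)
qed simp

lemma quotient_hom:
  fixes a :: "('p, 'h) full"
  shows "quotient_hom (full_gen s :: ('p, 'h) full) = full_gen (q s)"
    "star_hom full_cstar UNIV (quotient_hom :: ('p, 'h) full \<Rightarrow> _)"
    "norm (quotient_hom a) \<le> norm a"
    "quotient_hom ` full_cstar = (full_cstar :: ('q, 'h) full set)"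
    "bounded_linear (quotient_hom :: ('p, 'h) full \<Rightarrow> _)" "quotient_hom (c *\<^sub>C a) = c *\<^sub>C quotient_hom a"
proof -
  show gen: "quotient_hom (full_gen s :: ('p, 'h) full) = full_gen (q s)" for s
    by (rule bcontfun_eqI) (simp add: quotient_hom_apply full_gen_apply pull_rep_apply)
  show norm: "norm (quotient_hom a) \<le> norm a" for a :: "('p, 'h) full"
    by (rule norm_bound) (simp add: quotient_hom_apply norm_bounded)
  have lin: "quotient_hom (a + b) = quotient_hom a + quotient_hom b"
    "quotient_hom (a * b) = quotient_hom a * quotient_hom b"
    "quotient_hom (c *\<^sub>C a) = c *\<^sub>C quotient_hom a" "quotient_hom (a\<^sup>\<star>) = (quotient_hom a)\<^sup>\<star>"
    for a b :: "('p, 'h) full" and c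
    by (rule bcontfun_eqI; simp add: quotient_hom_apply)+
  show "quotient_hom (c *\<^sub>C a) = c *\<^sub>C quotient_hom a" by (rule lin)
  show "bounded_linear (quotient_hom :: ('p, 'h) full \<Rightarrow> _)"
    by (rule bounded_linear_intro[where K=1]) (simp_all add: lin norm flip: scaleC_of_real)
  show hom: "star_hom full_cstar UNIV (quotient_hom :: ('p, 'h) full \<Rightarrow> _)"
    by (simp add: star_hom_def lin)
  have "range (\<lambda>s. full_gen (q s)) = (range full_gen :: ('q, 'h) full set)"
    using q_surj by (metis image_image)
  then show "quotient_hom ` full_cstar = (full_cstar :: ('q, 'h) full set)"
    by (subst star_hom_image_closure_lspan[OF shrinkable_bcontfun cstar_subalgebra_full hom norm full_cstar_eq])
      (simp add: image_image gen full_cstar_eq)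
qed

end

section \<open>The kernel of the homomorphism induced by a quotient\<close>

text \<open>Let h be the sum of the squares of the elements of \<open>F\<close>. Shrinking
  \<open>a\<close> by h changes it only within J, so its norm stays at least d and some vector
  almost attains it; applying (1 - h / M)^n to that vector makes all elements of \<open>F\<close>
  nearly vanish on it.\<close>

lemma vector_outside_ideal:
  fixes A J :: "('x::metric_space \<Rightarrow>\<^sub>C 'h bop) set"
  assumes A: "cstar_subalgebra A" and J: "closed_ideal A J" and a: "a \<in> A"
    and d: "0 < d" "\<And>b. b \<in> J \<Longrightarrow> d \<le> norm (a - b)"
    and F: "finite F" "F \<subseteq> J" and e: "0 < e"
  shows "\<exists>x \<eta>. norm \<eta> \<le> 1 \<and> d / 2 \<le> norm (apply_bcontfun a x \<bullet>\<^sub>B \<eta>) \<and>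
    (\<forall>b\<in>F. norm (apply_bcontfun b x \<bullet>\<^sub>B \<eta>) \<le> e)"
proof -
  have JA: "J \<subseteq> A" "0 \<in> J" "\<And>x y. x \<in> J \<Longrightarrow> y \<in> J \<Longrightarrow> x + y \<in> J" "\<And>c x. x \<in> J \<Longrightarrow> c *\<^sub>C x \<in> J"
    "\<And>b x. b \<in> A \<Longrightarrow> x \<in> J \<Longrightarrow> b * x \<in> J"
    using J by (auto simp: closed_ideal_def)
  define h where "h = (\<Sum>b\<in>F. b\<^sup>\<star> * b)"
  have "(\<Sum>b\<in>G. b\<^sup>\<star> * b) \<in> J" if "finite G" "G \<subseteq> J" for G
    using that
  proof (induction G)
    case (insert b G)
    then have "b\<^sup>\<star> \<in> A" using JA(1) A by (auto simp: cstar_subalgebra_def)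
    with insert show ?case by (auto intro!: JA(3,5))
  qed (simp add: JA)
  then have h: "h \<in> J" unfolding h_def using F by blast
  \<comment> \<open>The summand 1 keeps M positive even if \<open>F\<close> is empty.\<close>
  define M where "M = (\<Sum>b\<in>F. (norm b)\<^sup>2) + 1"
  have M: "0 < M" by (simp add: M_def add_nonneg_pos sum_nonneg)
  obtain n where n: "M / e\<^sup>2 < real n" using reals_Archimedean2 by blast
  have small: "M / (2 * real n + 1) \<le> e\<^sup>2"
  proof -
    have "M \<le> e\<^sup>2 * real n" using n e by (simp add: field_simps)
    also have "\<dots> \<le> e\<^sup>2 * (2 * real n + 1)" by (intro mult_left_mono) auto
    finally show ?thesis by (simp add: field_simps)
  qed
  have sA: "shrink M h m a \<in> A" for m
    by (rule shrink_mem[OF A a]) (use h JA(1) in blast)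
  \<comment> \<open>Each shrinking step subtracts a multiple of a product with the factor h in
    J.\<close>
  have diff: "a - shrink M h m a \<in> J" for m
  proof (induction m)
    case (Suc m)
    have "complex_of_real (1 / M) *\<^sub>C (shrink M h m a * h) \<in> J" by (intro JA sA h)
    then have "(a - shrink M h m a) + (1 / M) *\<^sub>R (shrink M h m a * h) \<in> J"
      using Suc by (intro JA(3)) (simp_all only: scaleC_of_real)
    then show ?case by (simp add: shrink_Suc algebra_simps)
  qed (simp add: JA)
  have big: "d \<le> norm (shrink M h n a)" using d(2)[OF diff[of n]] by simp
  obtain x where x: "d / 2 < norm (apply_bcontfun (shrink M h n a) x)"
  proof (rule ccontr)
    assume "\<not> thesis"
    with that have "norm (shrink M h n a) \<le> d / 2" by (intro norm_bound) (meson not_le)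
    with big d(1) show False by simp
  qed
  obtain \<xi> where \<xi>: "d / 2 * norm \<xi> < norm (apply_bcontfun (shrink M h n a) x \<bullet>\<^sub>B \<xi>)"
  proof (rule ccontr)
    assume "\<not> thesis"
    with that have "norm (apply_bcontfun (shrink M h n a) x) \<le> d / 2"
      using d(1) by (intro norm_bop_bound) (auto simp: not_le[symmetric])
    with x show False by simp
  qed
  have \<xi>0: "norm \<xi> \<noteq> 0" using \<xi> by (auto simp: bop_zero)
  define T where "T b = apply_bcontfun b x" for b :: "'x \<Rightarrow>\<^sub>C 'h bop"
  define Y where "Y = (\<lambda>\<xi>. \<xi> - (1 / M) *\<^sub>R ((\<Sum>b\<in>F. (T b)\<^sup>\<star> * T b) \<bullet>\<^sub>B \<xi>))"
  have "(\<Sum>b\<in>F. (norm (T b))\<^sup>2) \<le> (\<Sum>b\<in>F. (norm b)\<^sup>2)"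
    by (intro sum_mono power_mono) (auto simp: T_def norm_bounded)
  then have bound: "(\<Sum>b\<in>F. (norm (T b))\<^sup>2) \<le> M" by (simp add: M_def)
  note powers = bop_symmetric_power_bounds[where T=T and I=F, OF M bound, folded Y_def]
  have hx: "apply_bcontfun h x = (\<Sum>b\<in>F. (T b)\<^sup>\<star> * T b)"
    by (simp add: h_def apply_bcontfun_sum T_def)
  define \<zeta> where "\<zeta> = (1 / norm \<xi>) *\<^sub>R \<xi>"
  have \<zeta>: "norm \<zeta> = 1" using \<xi>0 by (simp add: \<zeta>_def)
  have "apply_bcontfun (shrink M h n a) x \<bullet>\<^sub>B \<zeta> = (1 / norm \<xi>) *\<^sub>R (apply_bcontfun (shrink M h n a) x \<bullet>\<^sub>B \<xi>)"
    by (simp add: \<zeta>_def bop_scaleC scaleR_scaleC_ell2)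
  with \<xi> \<xi>0 have "d / 2 < norm (apply_bcontfun (shrink M h n a) x \<bullet>\<^sub>B \<zeta>)"
    by (simp add: field_simps)
  also have "apply_bcontfun (shrink M h n a) x \<bullet>\<^sub>B \<zeta> = apply_bcontfun a x \<bullet>\<^sub>B ((Y ^^ n) \<zeta>)"
    by (simp add: shrink_bcontfun shrink_apply hx Y_def)
  finally have 1: "d / 2 < norm (apply_bcontfun a x \<bullet>\<^sub>B ((Y ^^ n) \<zeta>))" .
  have "norm (apply_bcontfun b x \<bullet>\<^sub>B ((Y ^^ n) \<zeta>)) \<le> e" if b: "b \<in> F" for b
  proof (rule power2_le_imp_le)
    have "(norm (T b \<bullet>\<^sub>B ((Y ^^ n) \<zeta>)))\<^sup>2 \<le> (\<Sum>b\<in>F. (norm (T b \<bullet>\<^sub>B ((Y ^^ n) \<zeta>)))\<^sup>2)"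
      using b F by (intro member_le_sum) auto
    also have "\<dots> \<le> M / (2 * real n + 1)" using powers(1)[of n \<zeta>] \<zeta> by simp
    finally show "(norm (apply_bcontfun b x \<bullet>\<^sub>B ((Y ^^ n) \<zeta>)))\<^sup>2 \<le> e\<^sup>2"
      using small by (simp add: T_def)
  qed (use e in simp)
  moreover have "norm ((Y ^^ n) \<zeta>) \<le> 1" using powers(2)[of n \<zeta>] \<zeta> by simp
  ultimately show ?thesis using 1 by (intro exI[of _ x] exI[of _ "(Y ^^ n) \<zeta>"]) auto
qed

text \<open>Every clause holds for the functional of a vector of norm at most 1 and survives
  pointwise limits. The Cauchy-Schwarz clause feeds \<open>gram_kernel\<close>; the last one bounds
  left multiplication on the GNS space.\<close>

definition positive_functional :: "('v::cstar_algebra \<Rightarrow> complex) \<Rightarrow> bool" where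
  "positive_functional \<omega> \<longleftrightarrow> (\<forall>x y. \<omega> (x + y) = \<omega> x + \<omega> y) \<and> (\<forall>c x. \<omega> (c *\<^sub>C x) = c * \<omega> x) \<and>
    (\<forall>x. cmod (\<omega> x) \<le> norm x) \<and> (\<forall>x. \<omega> (x\<^sup>\<star>) = cnj (\<omega> x)) \<and> (\<forall>x. 0 \<le> Re (\<omega> (x\<^sup>\<star> * x))) \<and>
    (\<forall>x y. (cmod (\<omega> (y\<^sup>\<star> * x)))\<^sup>2 \<le> Re (\<omega> (y\<^sup>\<star> * y)) * Re (\<omega> (x\<^sup>\<star> * x))) \<and>
    (\<forall>x z. norm z \<le> 1 \<longrightarrow> Re (\<omega> ((z * x)\<^sup>\<star> * (z * x))) \<le> Re (\<omega> (x\<^sup>\<star> * x)))"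

lemma positive_functional_vector:
  fixes x :: "'x::metric_space" and \<eta> :: "'h ell2"
  defines "\<omega> \<equiv> \<lambda>b :: 'x \<Rightarrow>\<^sub>C 'h bop. cinner (apply_bcontfun b x \<bullet>\<^sub>B \<eta>) \<eta>"
  assumes \<eta>: "norm \<eta> \<le> 1"
  shows "positive_functional \<omega>"
    and "\<omega> (b\<^sup>\<star> * c) = cinner (apply_bcontfun c x \<bullet>\<^sub>B \<eta>) (apply_bcontfun b x \<bullet>\<^sub>B \<eta>)"
    and "Re (\<omega> (b\<^sup>\<star> * b)) = (norm (apply_bcontfun b x \<bullet>\<^sub>B \<eta>))\<^sup>2"
proof -
  show prod: "\<omega> (b\<^sup>\<star> * c) = cinner (apply_bcontfun c x \<bullet>\<^sub>B \<eta>) (apply_bcontfun b x \<bullet>\<^sub>B \<eta>)" for b c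
    by (simp add: \<omega>_def bop_adjoint')
  show sq: "Re (\<omega> (b\<^sup>\<star> * b)) = (norm (apply_bcontfun b x \<bullet>\<^sub>B \<eta>))\<^sup>2" for b
    unfolding prod cinner_self_norm by simp
  show "positive_functional \<omega>"
    unfolding positive_functional_def sq
  proof (intro conjI allI impI)
    fix b c :: "'x \<Rightarrow>\<^sub>C 'h bop" and t
    show "\<omega> (b + c) = \<omega> b + \<omega> c" "\<omega> (t *\<^sub>C b) = t * \<omega> b"
      by (simp_all add: \<omega>_def cinner_add_left cinner_scaleC_left)
    have "cmod (\<omega> b) \<le> norm (apply_bcontfun b x \<bullet>\<^sub>B \<eta>) * norm \<eta>" unfolding \<omega>_def by (rule cinner_bound)
    also have "\<dots> \<le> norm (apply_bcontfun b x \<bullet>\<^sub>B \<eta>) * 1" by (intro mult_left_mono \<eta>) simp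
    also have "\<dots> \<le> norm (apply_bcontfun b x) * norm \<eta>" using norm_bop_apply by simp
    also have "\<dots> \<le> norm b * 1" by (intro mult_mono norm_bounded \<eta>) auto
    finally show "cmod (\<omega> b) \<le> norm b" by simp
    show "\<omega> (b\<^sup>\<star>) = cnj (\<omega> b)"
      by (simp add: \<omega>_def bop_adjoint' flip: cinner_commute)
    show "(cmod (\<omega> (c\<^sup>\<star> * b)))\<^sup>2 \<le> (norm (apply_bcontfun c x \<bullet>\<^sub>B \<eta>))\<^sup>2 * (norm (apply_bcontfun b x \<bullet>\<^sub>B \<eta>))\<^sup>2"
      unfolding prod power_mult_distrib[symmetric]
      by (intro power_mono) (use cinner_bound in \<open>auto simp: mult.commute\<close>)
    assume "norm c \<le> 1"
    then have "norm (apply_bcontfun c x) \<le> 1" using norm_bounded[of c x] by simp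
    then have "norm (apply_bcontfun c x \<bullet>\<^sub>B (apply_bcontfun b x \<bullet>\<^sub>B \<eta>)) \<le> 1 * norm (apply_bcontfun b x \<bullet>\<^sub>B \<eta>)"
      by (intro order.trans[OF norm_bop_apply] mult_right_mono) auto
    then show "(norm (apply_bcontfun (c * b) x \<bullet>\<^sub>B \<eta>))\<^sup>2 \<le> (norm (apply_bcontfun b x \<bullet>\<^sub>B \<eta>))\<^sup>2"
      by (intro power_mono) auto
  qed simp
qed

text \<open>In the topology of pointwise convergence each clause compares continuous functions of
  finitely many values of \<open>\<omega>\<close> by an equation or a non-strict inequality.\<close>

lemma closed_positive_functional: "closed {\<omega> :: 'v::cstar_algebra \<Rightarrow> complex. positive_functional \<omega>}"
  unfolding positive_functional_def
  by (intro closed_Collect_conj closed_Collect_all closed_Collect_imp closed_Collect_eq closed_Collect_le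
      open_Collect_const continuous_intros continuous_on_product_coordinates)

text \<open>A compactness argument in the style of Banach-Alaoglu. Finitely many near-vanishing
  conditions can be met at once by the functional of a vector from
  \<open>vector_outside_ideal\<close>, and all functionals concerned lie in a product of
  discs.\<close>

lemma positive_functional_outside_ideal:
  fixes A J :: "('x::metric_space \<Rightarrow>\<^sub>C 'h bop) set"
  assumes A: "cstar_subalgebra A" and J: "closed_ideal A J" and a: "a \<in> A" "a \<notin> J"
  shows "\<exists>\<omega>. positive_functional \<omega> \<and> (\<forall>b\<in>J. \<forall>c. \<omega> (c * b) = 0) \<and> 0 < Re (\<omega> (a\<^sup>\<star> * a))"
proof -
  have "closed J" using J by (simp add: closed_ideal_def)
  with a obtain d where d: "0 < d" "\<And>b. b \<in> J \<Longrightarrow> d \<le> dist b a"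
    using closed_approachable[of J a] by (meson not_le)
  define S where "S = {\<lambda>b :: 'x \<Rightarrow>\<^sub>C 'h bop. cinner (apply_bcontfun b x \<bullet>\<^sub>B \<eta>) \<eta> |x \<eta>.
    norm \<eta> \<le> 1 \<and> d / 2 \<le> norm (apply_bcontfun a x \<bullet>\<^sub>B \<eta>)}"
  \<comment> \<open>A bound for all left multiples \<open>c * b\<close> at once, relative to the
    norm of c, which a small vector \<open>b\<close> x \<eta> provides.\<close>
  define C :: "('x \<Rightarrow>\<^sub>C 'h bop) \<times> real \<Rightarrow> (('x \<Rightarrow>\<^sub>C 'h bop) \<Rightarrow> complex) set"
    where "C = (\<lambda>(b, e). {\<omega>. \<forall>c. cmod (\<omega> (c * b)) \<le> e * norm c})"
  define K where "K = PiE UNIV (\<lambda>b :: 'x \<Rightarrow>\<^sub>C 'h bop. cball (0 :: complex) (norm b))"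
  have "compactin (product_topology (\<lambda>_. euclidean) UNIV) K"
    unfolding K_def compactin_PiE by simp
  then have K: "compact K" by (simp add: euclidean_product_topology)
  have S: "S \<subseteq> {\<omega>. positive_functional \<omega> \<and> (d / 2)\<^sup>2 \<le> Re (\<omega> (a\<^sup>\<star> * a))}"
  proof
    fix \<omega> assume "\<omega> \<in> S"
    then obtain x \<eta> where \<omega>: "\<omega> = (\<lambda>b. cinner (apply_bcontfun b x \<bullet>\<^sub>B \<eta>) \<eta>)"
      and \<eta>: "norm \<eta> \<le> 1" "d / 2 \<le> norm (apply_bcontfun a x \<bullet>\<^sub>B \<eta>)" unfolding S_def by blast
    have "(d / 2)\<^sup>2 \<le> (norm (apply_bcontfun a x \<bullet>\<^sub>B \<eta>))\<^sup>2"
      using d(1) \<eta>(2) by (intro power_mono) auto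
    with positive_functional_vector(1,3)[OF \<eta>(1)]
    show "\<omega> \<in> {\<omega>. positive_functional \<omega> \<and> (d / 2)\<^sup>2 \<le> Re (\<omega> (a\<^sup>\<star> * a))}"
      unfolding \<omega> mem_Collect_eq by metis
  qed
  have SK: "S \<subseteq> K"
  proof
    fix \<omega> assume "\<omega> \<in> S"
    with S have "positive_functional \<omega>" by blast
    then show "\<omega> \<in> K" by (simp add: K_def positive_functional_def PiE_UNIV_domain)
  qed
  have "(K \<inter> closure S) \<inter> (\<Inter>p\<in>J \<times> {0<..}. C p) \<noteq> {}"
  proof (rule compact_imp_fip_image)
    show "compact (K \<inter> closure S)" by (intro compact_Int_closed K) simp
    show "closed (C p)" for p
      unfolding C_def by (cases p)
        (auto intro!: closed_Collect_all closed_Collect_le continuous_intros continuous_on_product_coordinates)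
    fix I assume I: "finite I" "I \<subseteq> J \<times> {0::real<..}"
    \<comment> \<open>Inserting 1 keeps the minimum meaningful when \<open>I\<close> is
      empty.\<close>
    define e where "e = Min (insert 1 (snd ` I))"
    have e: "0 < e" "\<And>p. p \<in> I \<Longrightarrow> e \<le> snd p" using I by (auto simp: e_def)
    have "\<exists>x \<eta>. norm \<eta> \<le> 1 \<and> d / 2 \<le> norm (apply_bcontfun a x \<bullet>\<^sub>B \<eta>) \<and>
        (\<forall>b\<in>fst ` I. norm (apply_bcontfun b x \<bullet>\<^sub>B \<eta>) \<le> e)"
      by (rule vector_outside_ideal[OF A J a(1) d(1)])
        (use d(2) I e in \<open>auto simp: dist_norm norm_minus_commute\<close>)
    then obtain x \<eta> where x: "norm \<eta> \<le> 1" "d / 2 \<le> norm (apply_bcontfun a x \<bullet>\<^sub>B \<eta>)"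
      "\<And>p. p \<in> I \<Longrightarrow> norm (apply_bcontfun (fst p) x \<bullet>\<^sub>B \<eta>) \<le> e" by blast
    define \<omega> where "\<omega> = (\<lambda>b. cinner (apply_bcontfun b x \<bullet>\<^sub>B \<eta>) \<eta>)"
    have "\<omega> \<in> S" using x by (auto simp: S_def \<omega>_def)
    moreover have "cmod (\<omega> (c * fst p)) \<le> snd p * norm c" if p: "p \<in> I" for c p
    proof -
      let ?v = "apply_bcontfun (fst p) x \<bullet>\<^sub>B \<eta>"
      have "cmod (\<omega> (c * fst p)) \<le> norm (apply_bcontfun c x \<bullet>\<^sub>B ?v) * norm \<eta>"
        using cinner_bound[of "apply_bcontfun c x \<bullet>\<^sub>B ?v" \<eta>] by (simp add: \<omega>_def)
      also have "\<dots> \<le> (norm (apply_bcontfun c x) * norm ?v) * 1"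
        by (intro mult_mono norm_bop_apply x(1)) auto
      also have "\<dots> \<le> norm c * snd p"
        unfolding mult_1_right
        by (intro mult_mono norm_bounded order.trans[OF x(3)[OF p] e(2)[OF p]]) auto
      finally show ?thesis by (simp add: mult.commute)
    qed
    then have "\<omega> \<in> (\<Inter>p\<in>I. C p)" by (auto simp: C_def)
    ultimately show "(K \<inter> closure S) \<inter> (\<Inter>p\<in>I. C p) \<noteq> {}" using SK closure_subset by blast
  qed
  then obtain \<omega> where \<omega>: "\<omega> \<in> closure S" "\<And>b e. b \<in> J \<Longrightarrow> 0 < e \<Longrightarrow> \<omega> \<in> C (b, e)" by auto
  have "closed {\<omega>. positive_functional \<omega> \<and> (d / 2)\<^sup>2 \<le> Re (\<omega> (a\<^sup>\<star> * a))}"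
    by (intro closed_Collect_conj closed_positive_functional closed_Collect_le continuous_intros
        continuous_on_product_coordinates)
  from closure_minimal[OF S this] have "positive_functional \<omega>" "(d / 2)\<^sup>2 \<le> Re (\<omega> (a\<^sup>\<star> * a))"
    using \<omega>(1) by auto
  moreover have "0 < Re (\<omega> (a\<^sup>\<star> * a))"
    by (rule less_le_trans[OF _ \<open>(d / 2)\<^sup>2 \<le> _\<close>]) (use d(1) in simp)
  moreover have "\<omega> (c * b) = 0" if b: "b \<in> J" for b c
  proof -
    have "cmod (\<omega> (c * b)) \<le> 0"
    proof (rule field_le_epsilon)
      fix e :: real assume e: "0 < e"
      have pos: "0 < norm c + 1" by (simp add: add_nonneg_pos)
      have "cmod (\<omega> (c * b)) \<le> e / (norm c + 1) * norm c"
        using \<omega>(2)[OF b divide_pos_pos[OF e pos]] by (simp add: C_def)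
      also have "\<dots> \<le> e / (norm c + 1) * (norm c + 1)" using e pos by (intro mult_left_mono) auto
      also have "\<dots> = 0 + e" using pos by simp
      finally show "cmod (\<omega> (c * b)) \<le> 0 + e" .
    qed
    then show ?thesis by simp
  qed
  ultimately show ?thesis by (intro exI[of _ \<omega>]) auto
qed

section \<open>Generated ideals and kernels\<close>

lemma closed_ideal_generated:
  assumes "cstar_subalgebra A" "G \<subseteq> A"
  shows "closed_ideal A (closed_ideal_generated A G)"
proof -
  have A: "closed_ideal A A" using assms(1) by (auto simp: cstar_subalgebra_def closed_ideal_def)
  have "closed (\<Inter>{I. closed_ideal A I \<and> G \<subseteq> I})"
    by (intro closed_Inter) (auto simp: closed_ideal_def)
  then show ?thesis
    unfolding closed_ideal_generated_def closed_ideal_def[of A "\<Inter>_"]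
    using A assms(2) by (auto simp: closed_ideal_def)
qed

lemma closed_ideal_kernel:
  assumes A: "cstar_subalgebra A" and f: "star_hom A B f" and bl: "bounded_linear f"
  shows "closed_ideal A {a \<in> A. f a = 0}"
proof -
  note p = star_hom_props[OF f A]
  have "closed (A \<inter> {a. f a = 0})"
    using A bl by (intro closed_Int closed_Collect_eq) (auto simp: cstar_subalgebra_def intro: linear_continuous_on)
  moreover have "A \<inter> {a. f a = 0} = {a \<in> A. f a = 0}" by blast
  ultimately show ?thesis
    using A p(1,3,5,7) by (auto simp: closed_ideal_def cstar_subalgebra_def)
qed

lemma norm_full_gen: "norm (full_gen s) \<le> 1"
  by (rule norm_bound) (simp add: full_gen_apply norm_rep_le_1)

section \<open>The GNS representation of the quotient and exactness\<close>

context inverse_semigroup_quotient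
begin

text \<open>The GNS construction for \<open>\<omega>\<close>, carried out inside \<open>l2('h)\<close>: the vector \<open>k x\<close> stands for the class
  of \<open>full_gen x\<close>.\<close>

lemma gns_representation:
  fixes \<omega> :: "('p, 'h) full \<Rightarrow> complex" and i :: "'p \<Rightarrow> 'h" and u :: 'p
  assumes i: "inj i" and unit: "\<And>x. u * x = x" "\<And>x. x * u = x"
    and pos: "positive_functional \<omega>"
    and null: "\<And>x y c. q x = q y \<Longrightarrow> \<omega> (c * (full_gen x - full_gen y)) = 0"
  shows "\<exists>(\<sigma> :: ('q, 'h) rep) \<xi>. \<forall>b\<in>full_cstar. cinner (apply_bcontfun (quotient_hom b) \<sigma> \<bullet>\<^sub>B \<xi>) \<xi> = \<omega> b"
proof -
  have lin: "\<omega> (x + y) = \<omega> x + \<omega> y" "\<omega> (c *\<^sub>C x) = c * \<omega> x" "cmod (\<omega> x) \<le> norm x" "\<omega> (x\<^sup>\<star>) = cnj (\<omega> x)"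
    "0 \<le> Re (\<omega> (x\<^sup>\<star> * x))" "(cmod (\<omega> (y\<^sup>\<star> * x)))\<^sup>2 \<le> Re (\<omega> (y\<^sup>\<star> * y)) * Re (\<omega> (x\<^sup>\<star> * x))"
    "norm z \<le> 1 \<Longrightarrow> Re (\<omega> ((z * x)\<^sup>\<star> * (z * x))) \<le> Re (\<omega> (x\<^sup>\<star> * x))" for x y z c
    using pos by (simp_all add: positive_functional_def)
  have \<omega>0: "\<omega> 0 = 0" using lin(2)[of 0 0] by simp
  have \<omega>sum: "\<omega> (\<Sum>x\<in>F. f x) = (\<Sum>x\<in>F. \<omega> (f x))" for f :: "'p \<Rightarrow> ('p, 'h) full" and F
    by (induction F rule: infinite_finite_induct) (auto simp: \<omega>0 lin)
  \<comment> \<open>\<open>cinner\<close> is linear in its first argument, so the adjoint falls on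
    the second index.\<close>
  define K where "K x y = \<omega> ((full_gen y)\<^sup>\<star> * full_gen x)" for x y
  \<comment> \<open>\<open>f\<close> will be the identity or left multiplication by some
    \<open>z\<close>, so that vectors before and after applying \<open>T z\<close> share one
    formula.\<close>
  define comb :: "'p set \<Rightarrow> ('p \<Rightarrow> complex) \<Rightarrow> ('p \<Rightarrow> 'p) \<Rightarrow> ('p, 'h) full"
    where "comb F c f = (\<Sum>x\<in>F. c x *\<^sub>C full_gen (f x))" for F and c :: "'p \<Rightarrow> complex" and f :: "'p \<Rightarrow> 'p"
  have K_left: "\<omega> ((full_gen x)\<^sup>\<star> * comb F c f) = (\<Sum>y\<in>F. c y * K (f y) x)" for F c f x
    by (simp add: comb_def sum_distrib_left \<omega>sum scaleC_mult_right lin K_def)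
  have K_comb: "\<omega> ((comb F c f)\<^sup>\<star> * comb F c f) = (\<Sum>y\<in>F. \<Sum>z\<in>F. c y * cnj (c z) * K (f y) (f z))" for F c f
  proof -
    have "\<omega> ((comb F c f)\<^sup>\<star> * comb F c f) = (\<Sum>z\<in>F. cnj (c z) * \<omega> ((full_gen (f z))\<^sup>\<star> * comb F c f))"
      by (simp add: comb_def[of F c f] invol_sum sum_distrib_right \<omega>sum invol_scaleC scaleC_mult_left lin)
    also have "\<dots> = (\<Sum>z\<in>F. \<Sum>y\<in>F. c y * cnj (c z) * K (f y) (f z))"
      by (simp add: K_left sum_distrib_left mult_ac)
    finally show ?thesis by (subst (asm) sum.swap)
  qed
  have "\<exists>k :: 'p \<Rightarrow> 'h ell2. \<forall>x y. cinner (k x) (k y) = K x y"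
  proof (rule gram_kernel[OF i])
    show "K y x = cnj (K x y)" for x y
      by (simp add: K_def invol_mult invol_invol flip: lin(4))
    show "0 \<le> Re (K x x)" for x by (simp add: K_def lin)
    show "(cmod (\<Sum>y\<in>F. c y * K y x))\<^sup>2 \<le> Re (K x x) * Re (\<Sum>y\<in>F. \<Sum>z\<in>F. c y * cnj (c z) * K y z)"
      for F c x
      using lin(6)[of "full_gen x" "comb F c (\<lambda>x. x)"] K_left[of x F c "\<lambda>x. x"] K_comb[of F c "\<lambda>x. x"]
      by (simp add: K_def)
  qed
  then obtain k :: "'p \<Rightarrow> 'h ell2" where k: "\<And>x y. cinner (k x) (k y) = K x y" by blast
  have norm_comb: "(norm (\<Sum>x\<in>F. c x *\<^sub>C k (f x)))\<^sup>2 = Re (\<omega> ((comb F c f)\<^sup>\<star> * comb F c f))" for F c f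
  proof -
    have "complex_of_real ((norm (\<Sum>x\<in>F. c x *\<^sub>C k (f x)))\<^sup>2) = \<omega> ((comb F c f)\<^sup>\<star> * comb F c f)"
      unfolding cinner_self_norm[symmetric] cinner_sum_scaleC k K_comb ..
    then show ?thesis by (metis Re_complex_of_real)
  qed
  \<comment> \<open>Left multiplication by \<open>z\<close> on the GNS space: the last clause of
    \<open>positive_functional\<close> together with \<open>norm_full_gen\<close> makes it a
    contraction.\<close>
  have "\<exists>T :: 'h bop. (\<forall>x. T \<bullet>\<^sub>B k x = k (z * x)) \<and> (\<forall>v. (\<forall>x. cinner (k x) v = 0) \<longrightarrow> T \<bullet>\<^sub>B v = 0) \<and>
    (\<forall>v. (\<forall>x. cinner (k (z * x)) v = 0) \<longrightarrow> T\<^sup>\<star> \<bullet>\<^sub>B v = 0)" for z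
  proof (rule bop_extension[where C=1])
    fix F :: "'p set" and c :: "'p \<Rightarrow> complex"
    have "comb F c (\<lambda>x. z * x) = full_gen z * comb F c (\<lambda>x. x)"
      by (simp add: comb_def sum_distrib_left scaleC_mult_right full_gen_mult)
    then have "(norm (\<Sum>x\<in>F. c x *\<^sub>C k (z * x)))\<^sup>2 \<le> (norm (\<Sum>x\<in>F. c x *\<^sub>C k x))\<^sup>2"
      using norm_comb[of c "\<lambda>x. z * x" F] norm_comb[of c "\<lambda>x. x" F] lin(7)[OF norm_full_gen[of z]] by simp
    then show "norm (\<Sum>x\<in>F. c x *\<^sub>C k (z * x)) \<le> 1 * norm (\<Sum>x\<in>F. c x *\<^sub>C k x)"
      using power2_le_imp_le[OF _ norm_ge_zero] by simp
  qed simp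
  then obtain T :: "'p \<Rightarrow> 'h bop" where T: "\<And>z x. T z \<bullet>\<^sub>B k x = k (z * x)"
    "\<And>z v. (\<And>x. cinner (k x) v = 0) \<Longrightarrow> T z \<bullet>\<^sub>B v = 0"
    "\<And>z v. (\<And>x. cinner (k (z * x)) v = 0) \<Longrightarrow> (T z)\<^sup>\<star> \<bullet>\<^sub>B v = 0"
    by metis
  \<comment> \<open>This is where the representation factors through \<open>q\<close>: k (z x) - k
    (z' x) is a null vector because q (z x) = q (z' x).\<close>
  have T_cong: "T z = T z'" if zz: "q z = q z'" for z z'
  proof (rule bop_eq_on_family[where k=k])
    fix x
    define b :: "('p, 'h) full" where "b = full_gen (z * x) - full_gen (z' * x)"
    have "\<omega> (b\<^sup>\<star> * b) = 0" unfolding b_def by (rule null) (simp add: q_mult zz)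
    moreover have "cinner (k (z * x) - k (z' * x)) (k (z * x) - k (z' * x)) = \<omega> (b\<^sup>\<star> * b)"
    proof -
      have dif: "\<omega> (x - y) = \<omega> x - \<omega> y" for x y
        using lin(1)[of "x - y" y] by simp
      show ?thesis
        by (simp add: cinner_diff_left cinner_diff_right k K_def b_def invol_diff right_diff_distrib
            left_diff_distrib dif)
    qed
    ultimately have "k (z * x) - k (z' * x) = 0" by (simp only: cinner_self_eq_0)
    then show "T z \<bullet>\<^sub>B k x = T z' \<bullet>\<^sub>B k x" by (simp add: T)
  qed (simp add: T(2))
  have T_mult: "T (z * z') = T z * T z'" for z z'
    by (rule bop_eq_on_family[where k=k]) (simp_all add: T(1,2) mult.assoc bop_zero)
  have T_star: "T (z\<^sup>\<star>) = (T z)\<^sup>\<star>" for z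
  proof (rule bop_eq_on_family[where k=k])
    fix x
    \<comment> \<open>\<open>v\<close> is orthogonal to all \<open>k y\<close>, so
      \<open>T z\<close> annihilates it; hence \<open>cinner v v\<close> vanishes.\<close>
    define v where "v = (T z)\<^sup>\<star> \<bullet>\<^sub>B k x - k (z\<^sup>\<star> * x)"
    have perp: "cinner (k y) v = 0" for y
    proof -
      have "cinner (k y) ((T z)\<^sup>\<star> \<bullet>\<^sub>B k x) = K (z * y) x" by (simp add: bop_adjoint[symmetric] T k)
      moreover have "K (z * y) x = K y (z\<^sup>\<star> * x)"
        by (simp add: K_def full_gen_invol full_gen_mult isg_invol_mult isg_invol_invol mult.assoc)
      ultimately show ?thesis by (simp add: v_def cinner_diff_right k)
    qed
    have "cinner v v = cinner (k x) (T z \<bullet>\<^sub>B v) - cinner (k (z\<^sup>\<star> * x)) v"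
      by (subst (1) v_def) (simp add: cinner_diff_left bop_adjoint')
    then have "cinner v v = 0" by (simp add: T(2)[OF perp] perp)
    then show "T (z\<^sup>\<star>) \<bullet>\<^sub>B k x = (T z)\<^sup>\<star> \<bullet>\<^sub>B k x" by (simp add: cinner_self_eq_0 v_def T)
  next
    fix v assume "\<And>x. cinner (k x) v = 0"
    then show "T (z\<^sup>\<star>) \<bullet>\<^sub>B v = (T z)\<^sup>\<star> \<bullet>\<^sub>B v" by (simp add: T(2,3))
  qed
  have T_zero: "T z = 0" if z: "is_zero z" for z
  proof (rule bop_eq_on_family[where k=k])
    have "cinner (k z) (k z) = 0" by (simp add: k K_def full_gen_zero[OF z] \<omega>0)
    moreover have "z * x = z" for x using z by (simp add: is_zero_def)
    ultimately show "T z \<bullet>\<^sub>B k x = 0 \<bullet>\<^sub>B k x" for x by (simp add: T cinner_self_eq_0)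
  qed (simp add: T(2))
  \<comment> \<open>By \<open>T_cong\<close> the choice of preimage does not affect the
    operator.\<close>
  define \<sigma> where "\<sigma> w = T (inv q w)" for w
  have \<sigma>: "\<sigma> (q z) = T z" for z
    unfolding \<sigma>_def by (rule T_cong) (simp add: q_surj surj_f_inv_f)
  have "star_rep \<sigma>"
    unfolding star_rep_def
  proof (intro conjI allI impI)
    fix s t
    obtain s' t' where st: "s = q s'" "t = q t'" using q_surj by (metis surjD)
    show "\<sigma> (s * t) = \<sigma> s * \<sigma> t" unfolding st q_mult[symmetric] \<sigma> by (rule T_mult)
    show "\<sigma> (s\<^sup>\<star>) = (\<sigma> s)\<^sup>\<star>" unfolding st q_star[symmetric] \<sigma> by (rule T_star)
  next
    fix w :: 'q assume "is_zero w"
    then obtain z where "is_zero z" "q z = w" using q_zero_lift by blast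
    then show "\<sigma> w = 0" using \<sigma>[of z] T_zero by simp
  qed
  then have rep: "rep_apply (Abs_rep \<sigma>) = \<sigma>" by (simp add: Abs_rep_inverse)
  have pull: "rep_apply (pull_rep (Abs_rep \<sigma>)) z = T z" for z
    by (simp add: pull_rep_apply rep \<sigma>)
  have u_star: "u\<^sup>\<star> = u"
  proof -
    have "(u\<^sup>\<star> * u)\<^sup>\<star> = u\<^sup>\<star> * u" by (simp add: isg_invol_mult isg_invol_invol)
    then show ?thesis by (simp add: unit isg_invol_invol)
  qed
  \<comment> \<open>The cyclic vector is the class \<open>k u\<close> of the unit.\<close>
  show ?thesis
  proof (intro exI[of _ "Abs_rep \<sigma>"] exI[of _ "k u"] ballI)
    fix b :: "('p, 'h) full" assume b: "b \<in> full_cstar"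
    have "cinner (apply_bcontfun b (pull_rep (Abs_rep \<sigma>)) \<bullet>\<^sub>B k u) (k u) = \<omega> b"
      using b[unfolded full_cstar_eq]
    proof (rule closure_lspan_induct)
      have bl: "bounded_linear (\<lambda>b :: ('p, 'h) full. cinner (apply_bcontfun b (pull_rep (Abs_rep \<sigma>)) \<bullet>\<^sub>B k u) (k u))"
      proof (rule bounded_linear_intro[where K="norm (k u) * norm (k u)"])
        fix b :: "('p, 'h) full"
        show "norm (cinner (apply_bcontfun b (pull_rep (Abs_rep \<sigma>)) \<bullet>\<^sub>B k u) (k u)) \<le> norm b * (norm (k u) * norm (k u))"
          by (rule order.trans[OF cinner_bound])
            (simp add: mult.assoc[symmetric] mult_right_mono order.trans[OF norm_bop_apply] norm_bounded)
      qed (simp_all add: cinner_add_left scaleR_scaleC_ell2 cinner_scaleC_left scaleR_conv_of_real[where 'a=complex])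
      have "bounded_linear \<omega>"
        by (rule bounded_linear_intro[where K=1])
          (simp_all add: lin(1-3) scaleR_conv_of_real[where 'a=complex] flip: scaleC_of_real)
      with bl show "closed {b. cinner (apply_bcontfun b (pull_rep (Abs_rep \<sigma>)) \<bullet>\<^sub>B k u) (k u) = \<omega> b}"
        by (intro closed_Collect_eq) (auto intro: linear_continuous_on)
    next
      fix g :: "('p, 'h) full" assume "g \<in> range full_gen"
      then obtain x where g: "g = full_gen x" by blast
      show "cinner (apply_bcontfun g (pull_rep (Abs_rep \<sigma>)) \<bullet>\<^sub>B k u) (k u) = \<omega> g"
        by (simp add: g full_gen_apply pull T unit k K_def full_gen_invol full_gen_mult u_star)
    qed (simp_all add: \<omega>0 lin cinner_add_left cinner_scaleC_left)
    then show "cinner (apply_bcontfun (quotient_hom b) (Abs_rep \<sigma>) \<bullet>\<^sub>B k u) (k u) = \<omega> b"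
      by (simp add: quotient_hom_apply)
  qed
qed

theorem quotient_exact:
  fixes i :: "'p \<Rightarrow> 'h" and u :: 'p
  assumes i: "inj i" and unit: "\<And>x. u * x = x" "\<And>x. x * u = x"
  shows "short_exact (closed_ideal_generated full_cstar {full_gen x - full_gen y |x y. q x = q y})
    (full_cstar :: ('p, 'h) full set) full_cstar quotient_hom"
proof -
  define G :: "('p, 'h) full set" where "G = {full_gen x - full_gen y |x y. q x = q y}"
  define J where "J = closed_ideal_generated full_cstar G"
  have G: "G \<subseteq> full_cstar"
    using cstar_subalgebra_diff[OF cstar_subalgebra_full full_gen_mem full_gen_mem] by (auto simp: G_def)
  have J: "closed_ideal full_cstar J"
    unfolding J_def by (rule closed_ideal_generated[OF cstar_subalgebra_full G])
  have GJ: "G \<subseteq> J" unfolding J_def closed_ideal_generated_def by blast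
  note \<phi> = quotient_hom(2)[where ?'h='h]
  note p = star_hom_props[OF \<phi> cstar_subalgebra_full]
  have full: "cstar_subalgebra (full_cstar :: ('p, 'h) full set)" by (rule cstar_subalgebra_full)
  have ker: "closed_ideal full_cstar {a \<in> full_cstar. quotient_hom a = (0 :: ('q, 'h) full)}"
    by (rule closed_ideal_kernel[OF full \<phi> quotient_hom(5)])
  have "J \<subseteq> {a \<in> full_cstar. quotient_hom a = 0}"
  proof -
    have "G \<subseteq> {a \<in> full_cstar. quotient_hom a = 0}"
    proof
      fix g assume g: "g \<in> G"
      then obtain x y where "g = full_gen x - full_gen y" "q x = q y" by (auto simp: G_def)
      then have "quotient_hom g = 0"
        using p(2)[OF full_gen_mem full_gen_mem, of x y] by (simp add: quotient_hom(1))
      with g G show "g \<in> {a \<in> full_cstar. quotient_hom a = 0}" by blast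
    qed
    with ker show ?thesis unfolding J_def closed_ideal_generated_def by blast
  qed
  moreover have "a \<in> J" if a: "a \<in> full_cstar" "quotient_hom a = 0" for a
  proof (rule ccontr)
    assume "a \<notin> J"
    from positive_functional_outside_ideal[OF cstar_subalgebra_full J a(1) this]
    obtain \<omega> where \<omega>: "positive_functional \<omega>" "\<And>b c. b \<in> J \<Longrightarrow> \<omega> (c * b) = 0" "0 < Re (\<omega> (a\<^sup>\<star> * a))"
      by blast
    have "\<omega> (c * (full_gen x - full_gen y)) = 0" if "q x = q y" for x y c
      by (rule \<omega>(2)) (use GJ that in \<open>auto simp: G_def\<close>)
    from gns_representation[OF i unit \<omega>(1) this]
    obtain \<sigma> :: "('q, 'h) rep" and \<xi>
      where "\<And>b. b \<in> full_cstar \<Longrightarrow> cinner (apply_bcontfun (quotient_hom b) \<sigma> \<bullet>\<^sub>B \<xi>) \<xi> = \<omega> b" by blast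
    moreover have as: "a\<^sup>\<star> \<in> full_cstar" "a\<^sup>\<star> * a \<in> full_cstar"
      using a(1) full by (auto simp: cstar_subalgebra_def)
    moreover have "quotient_hom (a\<^sup>\<star> * a) = 0"
      using p(3)[OF as(1) a(1)] a(2) by simp
    ultimately have "\<omega> (a\<^sup>\<star> * a) = 0" by fastforce
    with \<omega>(3) show False by simp
  qed
  ultimately have "{a \<in> full_cstar. quotient_hom a = 0} = J" by blast
  then show ?thesis
    unfolding short_exact_def G_def[symmetric] J_def[symmetric]
    using J quotient_hom(4)[where ?'h='h] \<phi> by (auto simp: star_hom_def cstar_subalgebra_full)
qed

end

section \<open>The left regular representation\<close>

lemma adjoint_on_basis:
  assumes "\<And>a b. ell2_nth (U \<bullet>\<^sub>B delta b) a = cnj (ell2_nth (T \<bullet>\<^sub>B delta a) b)"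
  shows "T\<^sup>\<star> = U"
proof (rule bop_eq_on_basis, rule ell2_eqI)
  fix a b
  have "ell2_nth (T\<^sup>\<star> \<bullet>\<^sub>B delta b) a = cinner (delta b) (T \<bullet>\<^sub>B delta a)"
    by (simp add: cinner_delta_right[symmetric] bop_adjoint')
  also have "\<dots> = cnj (ell2_nth (T \<bullet>\<^sub>B delta a) b)"
    by (subst cinner_commute) (simp add: cinner_delta_right)
  finally show "ell2_nth (T\<^sup>\<star> \<bullet>\<^sub>B delta b) a = ell2_nth (U \<bullet>\<^sub>B delta b) a" by (simp add: assms)
qed

lemma delta_inject [simp]: "delta a = delta b \<longleftrightarrow> a = b" and delta_nonzero [simp]: "delta a \<noteq> 0"
proof -
  have "ell2_nth (delta a) a = 1" "ell2_nth (delta b) a = (if a = b then 1 else 0)"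
    by (simp_all add: delta.rep_eq)
  then show "delta a = delta b \<longleftrightarrow> a = b" by (metis zero_neq_one)
  from \<open>ell2_nth (delta a) a = 1\<close> show "delta a \<noteq> 0" by auto
qed

lemma isg_regular_star: "x\<^sup>\<star> * x * x\<^sup>\<star> = (x\<^sup>\<star> :: 'p::inverse_semigroup)"
  using isg_regular[of "x\<^sup>\<star>"] by (simp add: isg_invol_invol)

text \<open>The solutions u of \<open>s\<^sup>\<star> * s * u = u\<close> form the domain of the
  partial bijection u -> s u, so this computes the domain of a composite. Forward, regularity of the
  adjoint of t gives the first conjunct, and commuting the idempotents
  \<open>t * t\<^sup>\<star>\<close> and \<open>s\<^sup>\<star> * s\<close> gives the
  second.\<close>

lemma isg_initial_mult:
  fixes s t u :: "'p::inverse_semigroup"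
  shows "(s * t)\<^sup>\<star> * (s * t) * u = u \<longleftrightarrow> t\<^sup>\<star> * t * u = u \<and> s\<^sup>\<star> * s * (t * u) = t * u"
proof
  assume "(s * t)\<^sup>\<star> * (s * t) * u = u"
  then have u: "t\<^sup>\<star> * s\<^sup>\<star> * s * t * u = u" by (simp add: isg_invol_mult mult.assoc)
  have "t\<^sup>\<star> * t * u = (t\<^sup>\<star> * t * t\<^sup>\<star>) * s\<^sup>\<star> * s * t * u"
    by (subst u[symmetric]) (simp add: mult.assoc)
  also have "\<dots> = u" by (simp add: isg_regular_star u)
  finally have 1: "t\<^sup>\<star> * t * u = u" .
  have "t * u = t * t\<^sup>\<star> * (s\<^sup>\<star> * s) * t * u"
    by (subst u[symmetric]) (simp add: mult.assoc)
  also have "\<dots> = s\<^sup>\<star> * s * (t * t\<^sup>\<star>) * t * u"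
    using isg_comm[of t "s\<^sup>\<star>"] by (simp add: isg_invol_invol)
  also have "\<dots> = s\<^sup>\<star> * s * (t * u)"
    using isg_regular[of t] by (simp add: mult.assoc[symmetric]) (simp add: mult.assoc)
  finally show "t\<^sup>\<star> * t * u = u \<and> s\<^sup>\<star> * s * (t * u) = t * u" using 1 by simp
next
  assume "t\<^sup>\<star> * t * u = u \<and> s\<^sup>\<star> * s * (t * u) = t * u"
  then show "(s * t)\<^sup>\<star> * (s * t) * u = u" by (simp add: isg_invol_mult mult.assoc)
qed

lemma left_regular_mult: "left_regular (s * t) = left_regular s * left_regular t"
proof (rule bop_eq_on_basis)
  show "left_regular (s * t) \<bullet>\<^sub>B delta u = (left_regular s * left_regular t) \<bullet>\<^sub>B delta u" for u
    by (simp add: left_regular_delta isg_initial_mult bop_zero) (simp add: mult.assoc)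
qed

lemma left_regular_invol: "left_regular (s\<^sup>\<star>) = (left_regular s)\<^sup>\<star>"
proof (rule HOL.sym, rule adjoint_on_basis)
  fix a b
  have "s * s\<^sup>\<star> * b = b \<and> s\<^sup>\<star> * b = a \<longleftrightarrow> s\<^sup>\<star> * s * a = a \<and> s * a = b"
    by (auto simp: mult.assoc)
  then show "ell2_nth (left_regular (s\<^sup>\<star>) \<bullet>\<^sub>B delta b) a = cnj (ell2_nth (left_regular s \<bullet>\<^sub>B delta a) b)"
    by (auto simp: left_regular_delta isg_invol_invol delta.rep_eq)
qed

fun left_regular0 :: "'p::inverse_semigroup adjoin0 \<Rightarrow> 'p bop" where
  "left_regular0 (Elt s) = left_regular s"
| "left_regular0 Zero0 = 0"

lemma star_rep_left_regular0: "star_rep left_regular0"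
  by (simp add: star_rep_adjoin0 left_regular_mult left_regular_invol)

lemma range_left_regular0: "range left_regular0 = insert 0 (range left_regular)"
proof (intro equalityI subsetI)
  fix T assume "T \<in> range left_regular0"
  then obtain x where "T = left_regular0 x" by blast
  then show "T \<in> insert 0 (range left_regular)" by (cases x) auto
next
  fix T assume "T \<in> insert 0 (range (left_regular :: 'a \<Rightarrow> _))"
  then show "T \<in> range left_regular0"
    by (auto intro: range_eqI[of _ _ "Elt _"] range_eqI[of _ _ Zero0])
qed

lemma star_rep_range:
  assumes "star_rep \<pi>" shows "g \<in> range \<pi> \<Longrightarrow> h \<in> range \<pi> \<Longrightarrow> g * h \<in> range \<pi>" "g \<in> range \<pi> \<Longrightarrow> g\<^sup>\<star> \<in> range \<pi>"
proof -
  have "\<pi> s * \<pi> t = \<pi> (s * t)" "(\<pi> s)\<^sup>\<star> = \<pi> (s\<^sup>\<star>)" for s t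
    using assms by (simp_all add: star_rep_def)
  then show "g \<in> range \<pi> \<Longrightarrow> h \<in> range \<pi> \<Longrightarrow> g * h \<in> range \<pi>" "g \<in> range \<pi> \<Longrightarrow> g\<^sup>\<star> \<in> range \<pi>"
    by auto
qed

lemma cstar_generated_superset: "G \<subseteq> cstar_generated G"
  by (auto simp: cstar_generated_def)

lemma reduced_cstar_eq: "reduced_cstar = closure (lspan (range left_regular0))"
  unfolding reduced_cstar_def
proof (rule cstar_generated_eq_closure_lspan[OF star_rep_range[OF star_rep_left_regular0]])
  have "0 \<in> cstar_generated (range (left_regular :: 'a \<Rightarrow> _))"
    using cstar_subalgebra_generated[of "range (left_regular :: 'a \<Rightarrow> _)"] by (simp add: cstar_subalgebra_def)
  then show "range left_regular0 \<subseteq> cstar_generated (range (left_regular :: 'a \<Rightarrow> _))"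
    by (simp add: range_left_regular0 cstar_generated_superset)
qed (auto simp: range_left_regular0)

section \<open>The representation of W by partial shifts\<close>

text \<open>Partial bijections of a set form an inverse semigroup, and these operators are its
  image. Unlike arbitrary partial isometries they are closed under products and have commuting range
  projections.\<close>

definition partial_shift :: "'a bop \<Rightarrow> bool" where
  "partial_shift T \<longleftrightarrow> (\<exists>D f. inj_on f D \<and> T = shift_op D f)"

lemma shift_op_mult:
  assumes "inj_on f D" "inj_on g E"
  shows "inj_on (f \<circ> g) {t \<in> E. g t \<in> D}" "shift_op D f * shift_op E g = shift_op {t \<in> E. g t \<in> D} (f \<circ> g)"
proof -
  show 1: "inj_on (f \<circ> g) {t \<in> E. g t \<in> D}" using assms by (auto simp: inj_on_def)
  show "shift_op D f * shift_op E g = shift_op {t \<in> E. g t \<in> D} (f \<circ> g)"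
    by (rule bop_eq_on_basis) (simp add: shift_op_delta[OF 1] shift_op_delta assms bop_zero)
qed

lemma shift_op_invol:
  assumes "inj_on f D"
  shows "(shift_op D f)\<^sup>\<star> = shift_op (f ` D) (inv_into D f)"
proof (rule adjoint_on_basis)
  fix a b
  have "b \<in> f ` D \<and> a = inv_into D f b \<longleftrightarrow> a \<in> D \<and> b = f a"
    using assms by (auto simp: f_inv_into_f inv_into_into)
  then show "ell2_nth (shift_op (f ` D) (inv_into D f) \<bullet>\<^sub>B delta b) a = cnj (ell2_nth (shift_op D f \<bullet>\<^sub>B delta a) b)"
    by (auto simp: shift_op_delta inj_on_inv_into assms delta.rep_eq)
qed

lemma shift_op_range_projection:
  assumes "inj_on f D"
  shows "shift_op D f * (shift_op D f)\<^sup>\<star> = shift_op (f ` D) (\<lambda>t. t)"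
  by (rule bop_eq_on_basis)
    (simp add: shift_op_invol assms shift_op_delta inj_on_inv_into inv_into_into f_inv_into_f bop_zero)

lemma partial_shift_mult: "partial_shift S \<Longrightarrow> partial_shift T \<Longrightarrow> partial_shift (S * T)"
proof -
  assume "partial_shift S" "partial_shift T"
  then obtain D f E g where "inj_on f D" "S = shift_op D f" "inj_on g E" "T = shift_op E g"
    unfolding partial_shift_def by auto
  then show ?thesis
    unfolding partial_shift_def
    by (intro exI[of _ "{t \<in> E. g t \<in> D}"] exI[of _ "f \<circ> g"]) (simp add: shift_op_mult)
qed

lemma partial_shift_invol: "partial_shift T \<Longrightarrow> partial_shift (T\<^sup>\<star>)"
proof -
  assume "partial_shift T"
  then obtain D f where "inj_on f D" "T = shift_op D f" unfolding partial_shift_def by auto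
  then show ?thesis
    unfolding partial_shift_def
    by (intro exI[of _ "f ` D"] exI[of _ "inv_into D f"]) (simp add: shift_op_invol inj_on_inv_into)
qed

lemma partial_shift_regular:
  assumes "partial_shift T" shows "T * T\<^sup>\<star> * T = T"
proof -
  obtain D f where f: "inj_on f D" "T = shift_op D f" using assms by (auto simp: partial_shift_def)
  show ?thesis
    unfolding f(2) shift_op_range_projection[OF f(1)]
    by (rule bop_eq_on_basis) (simp add: shift_op_delta f(1) bop_zero)
qed

lemma partial_shift_comm:
  assumes "partial_shift S" "partial_shift T"
  shows "S * S\<^sup>\<star> * (T * T\<^sup>\<star>) = T * T\<^sup>\<star> * (S * S\<^sup>\<star>)"
proof -
  obtain D f E g where f: "inj_on f D" "S = shift_op D f" and g: "inj_on g E" "T = shift_op E g"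
    using assms by (auto simp: partial_shift_def)
  show ?thesis
    unfolding f(2) g(2) shift_op_range_projection[OF f(1)] shift_op_range_projection[OF g(1)]
    by (rule bop_eq_on_basis) (simp add: shift_op_delta bop_zero)
qed

lemma shift_op_UNIV: "shift_op UNIV (\<lambda>t. t) = 1"
  by (rule bop_eq_on_basis) (simp add: shift_op_delta)

lemma inj_left_mult: "inj_on (\<lambda>q. p * q) (A :: 's::left_cancellative_monoid set)"
  by (auto intro!: inj_onI dest: left_cancel)

lemma S_isometry_invol_delta:
  "(S_isometry p)\<^sup>\<star> \<bullet>\<^sub>B delta (p * t) = delta t"
  "s \<notin> range ((*) p) \<Longrightarrow> (S_isometry p)\<^sup>\<star> \<bullet>\<^sub>B delta s = 0"
  by (auto simp: S_isometry_def shift_op_invol[OF inj_left_mult] shift_op_delta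
      inj_on_inv_into inv_f_f[OF inj_left_mult])

section \<open>Evaluation of words of W on l2(S)\<close>

fun w_base :: "'s::left_cancellative_monoid wgen \<Rightarrow> 's bop" where
  "w_base (WIsom s) = S_isometry s"
| "w_base (WProj X) = shift_op (Rep_cideal X) (\<lambda>t. t)"

fun w_letter :: "'s::left_cancellative_monoid wgen letter \<Rightarrow> 's bop" where
  "w_letter (Gen g) = w_base g"
| "w_letter (GenStar g) = (w_base g)\<^sup>\<star>"

definition w_eval :: "'s::left_cancellative_monoid wgen letter list \<Rightarrow> 's bop" where
  "w_eval u = prod_list (map w_letter u)"

lemma w_eval_simps [simp]:
  "w_eval [] = 1" "w_eval (l # u) = w_letter l * w_eval u" "w_eval (u @ v) = w_eval u * w_eval v"
  by (simp_all add: w_eval_def)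

lemma bop_invol_one: "(1 :: 'a bop)\<^sup>\<star> = 1"
  by (rule bop_adjoint_unique) simp

lemma w_eval_star: "w_eval (word_star u) = (w_eval u)\<^sup>\<star>"
proof (induction u)
  case (Cons l u)
  have "w_letter (letter_star l) = (w_letter l)\<^sup>\<star>" by (cases l) (auto simp: invol_invol)
  with Cons show ?case by (simp add: word_star_def invol_mult)
qed (simp add: bop_invol_one)

lemma partial_shift_w_eval: "partial_shift (w_eval u)"
proof (induction u)
  case Nil
  show ?case
    unfolding partial_shift_def by (intro exI[of _ UNIV] exI[of _ "\<lambda>t. t"]) (simp add: shift_op_UNIV)
next
  case (Cons l u)
  have "partial_shift (w_base g)" for g :: "'a wgen"
  proof (cases g)
    case (WIsom s)
    then show ?thesis
      unfolding partial_shift_def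
      by (intro exI[of _ UNIV] exI[of _ "\<lambda>q. s * q"]) (simp add: S_isometry_def inj_left_mult)
  next
    case (WProj X)
    then show ?thesis
      unfolding partial_shift_def by (intro exI[of _ "Rep_cideal X"] exI[of _ "\<lambda>t. t"]) simp
  qed
  then have "partial_shift (w_letter l)" by (cases l) (auto intro: partial_shift_invol)
  with Cons show ?case by (simp add: partial_shift_mult)
qed

lemma proj_delta: "w_base (WProj X) \<bullet>\<^sub>B delta t = (if t \<in> Rep_cideal X then delta t else 0)"
  by (simp add: shift_op_delta)

lemma proj_invol: "(w_base (WProj X))\<^sup>\<star> = w_base (WProj X)"
  by (rule adjoint_on_basis) (auto simp: proj_delta delta.rep_eq simp del: w_base.simps)

lemma S_isometry_conj:
  "S_isometry s * w_base (WProj X) * (S_isometry s)\<^sup>\<star> = w_base (WProj (cideal_image s X))"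
proof (rule bop_eq_on_basis)
  fix t
  show "(S_isometry s * w_base (WProj X) * (S_isometry s)\<^sup>\<star>) \<bullet>\<^sub>B delta t = w_base (WProj (cideal_image s X)) \<bullet>\<^sub>B delta t"
  proof (cases "t \<in> range ((*) s)")
    case True
    then obtain r where t: "t = s * r" by blast
    have "s * r \<in> (*) s ` Rep_cideal X \<longleftrightarrow> r \<in> Rep_cideal X" by (auto dest: left_cancel)
    then show ?thesis
      by (simp add: t S_isometry_invol_delta proj_delta S_isometry_delta cideal_image.rep_eq bop_zero
          del: w_base.simps)
  next
    case False
    then have "t \<notin> (*) s ` Rep_cideal X" by blast
    with False show ?thesis
      by (simp add: S_isometry_invol_delta(2) proj_delta cideal_image.rep_eq bop_zero del: w_base.simps)
  qed
qed

lemma w_eval_rel: "w_rel u v \<Longrightarrow> w_eval u = w_eval v"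
proof (induction rule: w_rel.induct)
  case (isometry s)
  show ?case
    by (simp, rule bop_eq_on_basis) (simp add: S_isometry_delta S_isometry_invol_delta)
next
  case (mult s t)
  show ?case
    by (simp, rule bop_eq_on_basis) (simp add: S_isometry_delta mult.assoc)
next
  case (conj s X)
  then show ?case using S_isometry_conj[of s X] by (simp add: mult.assoc)
next
  case unit
  show ?case by (simp add: cideal_top.rep_eq shift_op_UNIV)
next
  case (selfadjoint X)
  show ?case using proj_invol[of X] by simp
next
  case (idempotent X)
  show ?case
    by (simp, rule bop_eq_on_basis) (simp add: shift_op_delta bop_zero)
next
  case (inter X Y)
  show ?case
    by (simp, rule bop_eq_on_basis) (simp add: shift_op_delta bop_zero cideal_inter.rep_eq)
next
  case (zero_left l)
  have "w_base (WProj cideal_empty) = (0 :: 'a bop)"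
    by (rule bop_eq_on_basis) (simp add: shift_op_delta cideal_empty.rep_eq)
  then show ?case by simp
next
  case (zero_right l)
  have "w_base (WProj cideal_empty) = (0 :: 'a bop)"
    by (rule bop_eq_on_basis) (simp add: shift_op_delta cideal_empty.rep_eq)
  then show ?case by simp
qed

text \<open>Besides the defining relations, the inverse semigroup identities have to hold for the
  operators; they do because every word evaluates to a partial shift.\<close>

lemma w_eval_presented: "presented w_rel u v \<Longrightarrow> w_eval u = w_eval v"
proof (induction rule: presented.induct)
  case (regular u)
  show ?case using partial_shift_regular[OF partial_shift_w_eval] by (simp add: w_eval_star mult.assoc)
next
  case (comm u v)
  show ?case
    unfolding w_eval_simps w_eval_star by (rule partial_shift_comm) (rule partial_shift_w_eval)+
qed (simp_all add: w_eval_rel w_eval_star)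

lift_definition w_rep :: "'s::left_cancellative_monoid winv \<Rightarrow> 's bop" is w_eval
  by (rule w_eval_presented)

lemma w_rep_mult: "w_rep (x * y) = w_rep x * w_rep y"
  by transfer simp

lemma w_rep_invol: "w_rep (x\<^sup>\<star>) = (w_rep x)\<^sup>\<star>"
  by transfer (rule w_eval_star)

lemma w_rep_w_gen: "w_rep (w_gen s) = S_isometry s"
  by transfer simp

lemma w_rep_empty: "w_rep (e_gen cideal_empty) = 0"
  by transfer (auto intro!: bop_eq_on_basis simp: shift_op_delta cideal_empty.rep_eq)

lemma w_rep_one: "w_rep 1 = 1"
  by transfer simp

section \<open>W as a quotient of S* with a zero adjoined\<close>

lemma is_zero_unique: "is_zero z \<Longrightarrow> is_zero w \<Longrightarrow> z = w"
  unfolding is_zero_def by metis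

lemma is_zero_invol: "is_zero z \<Longrightarrow> (z :: 'p::inverse_semigroup)\<^sup>\<star> = z"
proof -
  assume z: "is_zero z"
  have "(s\<^sup>\<star> * z)\<^sup>\<star> = z\<^sup>\<star> * s" "(z * s\<^sup>\<star>)\<^sup>\<star> = s * z\<^sup>\<star>" for s
    by (simp_all add: isg_invol_mult isg_invol_invol)
  with z have "z\<^sup>\<star> * s = z\<^sup>\<star> \<and> s * z\<^sup>\<star> = z\<^sup>\<star>" for s
    by (simp add: is_zero_def)
  then have "is_zero (z\<^sup>\<star>)" by (simp add: is_zero_def)
  with z show ?thesis by (rule is_zero_unique[rotated])
qed

text \<open>The relations absorb one letter at a time; induction on the word extends this to all of
  W.\<close>

lemma is_zero_empty: "is_zero (e_gen cideal_empty)"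
proof -
  let ?z = "[Gen (WProj cideal_empty)] :: 'a wgen letter list"
  have left: "presented w_rel (?z @ u) ?z" for u
  proof (induction u)
    case (Cons l u)
    have "presented w_rel ((?z @ [l]) @ u) (?z @ u)"
      by (rule presented.append[OF presented.rel presented.refl]) (simp add: w_rel.zero_left)
    then show ?case using presented.trans[OF _ Cons] by simp
  qed (simp add: presented.refl)
  have right: "presented w_rel (u @ ?z) ?z" for u
  proof (induction u)
    case (Cons l u)
    have "presented w_rel ([l] @ (u @ ?z)) ([l] @ ?z)" by (rule presented.append[OF presented.refl Cons])
    moreover have "presented w_rel ([l] @ ?z) ?z" by (rule presented.rel) (simp add: w_rel.zero_right)
    ultimately show ?case using presented.trans by fastforce
  qed (simp add: presented.refl)
  have "abs_winv ?z * s = abs_winv ?z \<and> s * abs_winv ?z = abs_winv ?z" for s :: "'a winv"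
    by (induction s rule: winv.abs_induct) (use left right in \<open>simp add: times_winv.abs_eq winv.abs_eq_iff\<close>)
  then show ?thesis by (simp add: is_zero_def e_gen.abs_eq)
qed

lemma w_gen_isometry: "(w_gen s)\<^sup>\<star> * w_gen s = 1"
  by transfer (simp add: word_star_def presented.rel[where R=w_rel, OF w_rel.isometry])

lemma w_gen_conj: "w_gen s * e_gen X * (w_gen s)\<^sup>\<star> = e_gen (cideal_image s X)"
  by transfer (simp add: word_star_def presented.rel[where R=w_rel, OF w_rel.conj])

lemma e_gen_inter: "e_gen (cideal_inter X Y) = e_gen X * e_gen Y"
  by transfer (simp add: presented.rel[where R=w_rel, OF w_rel.inter])

lemma e_gen_top: "e_gen cideal_top = 1"
  by transfer (simp add: presented.rel[where R=w_rel, OF w_rel.unit])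

text \<open>The relations describe images only. Preimages are reached through b (b^-1 Y) = b S
  \<inter> Y: this gives an identity between the projections of images, from which
  \<open>w_gen b\<close> is cancelled on both sides by the isometry relation.\<close>

lemma e_gen_vimage:
  assumes "Rep_cideal Z = (*) b -` Rep_cideal Y"
  shows "e_gen Z = (w_gen b)\<^sup>\<star> * e_gen Y * w_gen b"
proof -
  have "cideal_image b Z = cideal_inter (cideal_image b cideal_top) Y"
    unfolding Rep_cideal_inject[symmetric]
    by (auto simp: assms cideal_image.rep_eq cideal_inter.rep_eq cideal_top.rep_eq)
  then have "w_gen b * e_gen Z * (w_gen b)\<^sup>\<star> = w_gen b * 1 * (w_gen b)\<^sup>\<star> * e_gen Y"
    by (simp only: w_gen_conj e_gen_inter flip: e_gen_top)
  then have "(w_gen b)\<^sup>\<star> * (w_gen b * e_gen Z * (w_gen b)\<^sup>\<star>) * w_gen b =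
      (w_gen b)\<^sup>\<star> * (w_gen b * (w_gen b)\<^sup>\<star> * e_gen Y) * w_gen b" by simp
  then have "((w_gen b)\<^sup>\<star> * w_gen b) * e_gen Z * ((w_gen b)\<^sup>\<star> * w_gen b) =
      ((w_gen b)\<^sup>\<star> * w_gen b) * (w_gen b)\<^sup>\<star> * e_gen Y * w_gen b" by (simp only: mult.assoc)
  then show ?thesis by (simp add: w_gen_isometry)
qed

lemma sstar0_to_W_mult: "sstar0_to_W (x * y) = sstar0_to_W x * sstar0_to_W y"
  by (cases x; cases y) (simp_all add: sstar_to_W_mult is_zero_empty[unfolded is_zero_def])

lemma sstar0_to_W_invol: "sstar0_to_W (x\<^sup>\<star>) = (sstar0_to_W x)\<^sup>\<star>"
  by (cases x) (auto simp: sstar_to_W_invol is_zero_invol[OF is_zero_empty])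

lemma sstar_to_W_one: "sstar_to_W 1 = 1"
  by transfer (simp add: presented.refl)

text \<open>Following the generation of the constructible ideals, each projection becomes a word in
  the isometries or the zero. This is what makes \<open>sstar0_to_W\<close> surjective.\<close>

lemma e_gen_in_range:
  fixes X :: "'s::left_cancellative_monoid cideal"
  shows "e_gen X \<in> range sstar0_to_W"
proof -
  have "\<exists>x. \<forall>Y. Rep_cideal Y = A \<longrightarrow> sstar0_to_W x = e_gen Y" if "A \<in> constructible"
    for A :: "'s set"
    using that
  proof (induction rule: constructible.induct)
    case empty
    have "sstar0_to_W Zero0 = e_gen Y" if "Rep_cideal Y = {}" for Y
      using that cideal_empty.rep_eq by (metis Rep_cideal_inject sstar0_to_W.simps(2))
    then show ?case by blast
  next
    case top
    have "sstar0_to_W (Elt 1) = e_gen Y" if "Rep_cideal Y = UNIV" for Y :: "'s cideal"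
    proof -
      have "Y = cideal_top" using that cideal_top.rep_eq by (metis Rep_cideal_inject)
      then show ?thesis by (simp add: e_gen_top sstar_to_W_one)
    qed
    then show ?case by blast
  next
    case (step X b a)
    then obtain x where x: "\<And>Y. Rep_cideal Y = X \<Longrightarrow> sstar0_to_W x = e_gen Y" by blast
    have X: "Rep_cideal (Abs_cideal X) = X" using step.hyps by (simp add: Abs_cideal_inverse)
    \<comment> \<open>Conjugation by \<open>v_gen a\<close> realizes the image under a; conjugation
      by the adjoint of \<open>v_gen b\<close> realizes the preimage under b.\<close>
    let ?x = "(Elt (v_gen b))\<^sup>\<star> * (Elt (v_gen a) * x * (Elt (v_gen a))\<^sup>\<star>) * Elt (v_gen b)"
    have "sstar0_to_W ?x = e_gen Y" if "Rep_cideal Y = (*) b -` (*) a ` X" for Y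
    proof -
      have "sstar0_to_W ?x = (w_gen b)\<^sup>\<star> * e_gen (cideal_image a (Abs_cideal X)) * w_gen b"
        by (simp only: sstar0_to_W_mult sstar0_to_W_invol sstar0_to_W.simps sstar_to_W_v x[OF X] w_gen_conj)
      also have "\<dots> = e_gen Y"
        by (rule e_gen_vimage[symmetric]) (simp add: that cideal_image.rep_eq X)
      finally show ?thesis .
    qed
    then show ?case by blast
  qed
  from this[OF Rep_cideal] show ?thesis by (metis rangeI)
qed

lemma surj_sstar0_to_W: "surj (sstar0_to_W :: 's::left_cancellative_monoid sstar adjoin0 \<Rightarrow> 's winv)"
proof -
  have "abs_winv u \<in> range sstar0_to_W" for u :: "'s wgen letter list"
  proof (induction u)
    case Nil
    have "sstar0_to_W (Elt 1) = abs_winv []"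
      by (simp flip: one_winv.abs_eq) (transfer, simp add: presented.refl)
    then show ?case by (metis rangeI)
  next
    case (Cons l u)
    have gen: "abs_winv [Gen g] \<in> range sstar0_to_W" for g :: "'s wgen"
    proof (cases g)
      case (WIsom s)
      then have "abs_winv [Gen g] = sstar0_to_W (Elt (v_gen s))" by (simp add: sstar_to_W_v w_gen.abs_eq)
      then show ?thesis by (simp only: rangeI)
    next
      case (WProj X)
      then show ?thesis using e_gen_in_range[of X] by (simp add: e_gen.abs_eq)
    qed
    have "abs_winv [GenStar g] \<in> range sstar0_to_W" for g :: "'s wgen"
    proof -
      obtain x where "abs_winv [Gen g] = sstar0_to_W x" using gen[of g] by blast
      then have "abs_winv [GenStar g] = sstar0_to_W (x\<^sup>\<star>)"
        unfolding sstar0_to_W_invol by (simp add: invol_winv.abs_eq word_star_def flip: \<open>abs_winv [Gen g] = _\<close>)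
      then show ?thesis by (simp only: rangeI)
    qed
    with gen have "abs_winv [l] \<in> range sstar0_to_W" by (cases l) auto
    moreover have "abs_winv (l # u) = abs_winv [l] * abs_winv u"
      by (simp add: times_winv.abs_eq)
    ultimately show ?case using Cons by (auto simp: image_iff simp flip: sstar0_to_W_mult)
  qed
  then have "w \<in> range sstar0_to_W" for w :: "'s winv" by (induction w rule: winv.abs_induct)
  then show ?thesis by blast
qed

lemma is_zero_adjoin0: "is_zero (z :: 'p::inverse_semigroup adjoin0) \<longleftrightarrow> z = Zero0"
  unfolding is_zero_def by (metis adjoin0_mult_Zero0 times_adjoin0.simps(2))

interpretation W: inverse_semigroup_quotient sstar0_to_W
proof
  show "is_zero z \<Longrightarrow> is_zero (sstar0_to_W z)" for z :: "'a sstar adjoin0"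
    by (simp add: is_zero_adjoin0 is_zero_empty)
  show "\<exists>z. is_zero z \<and> sstar0_to_W z = w" if "is_zero w" for w :: "'a winv"
    using is_zero_unique[OF is_zero_empty that] by (auto simp: is_zero_adjoin0)
qed (simp_all add: sstar0_to_W_mult sstar0_to_W_invol surj_sstar0_to_W)

lemma star_rep_w_rep: "star_rep w_rep"
  unfolding star_rep_def
  using is_zero_unique[OF is_zero_empty] w_rep_empty by (auto simp: w_rep_mult w_rep_invol)

lemma sstar_induct [case_names one gen star]:
  assumes "P 1" "\<And>p x. P x \<Longrightarrow> P (v_gen p * x)" "\<And>p x. P x \<Longrightarrow> P ((v_gen p)\<^sup>\<star> * x)"
  shows "P (x :: 's::left_cancellative_monoid sstar)"
proof (induction x rule: sstar.abs_induct)
  fix u :: "'s letter list"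
  show "P (abs_sstar u)"
  proof (induction u)
    case Nil
    then show ?case using assms(1) by (simp add: one_sstar.abs_eq)
  next
    case (Cons l u)
    show ?case
    proof (cases l)
      case (Gen p)
      then have "abs_sstar (l # u) = v_gen p * abs_sstar u" by (simp add: v_gen.abs_eq times_sstar.abs_eq)
      with assms(2)[OF Cons] show ?thesis by simp
    next
      case (GenStar p)
      then have "abs_sstar (l # u) = (v_gen p)\<^sup>\<star> * abs_sstar u"
        by (simp add: v_gen.abs_eq times_sstar.abs_eq invol_sstar.abs_eq word_star_def)
      with assms(3)[OF Cons] show ?thesis by simp
    qed
  qed
qed

section \<open>Restriction to the canonical copy of l2(S)\<close>

lemma w_rep_v: "w_rep (sstar_to_W (v_gen p)) = S_isometry p"
  by (simp add: sstar_to_W_v w_rep_w_gen)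

text \<open>Equality in the presented semigroup S* is refuted in the representation on l2(S), where
  \<open>v_gen p\<close> sends \<open>delta 1\<close> to \<open>delta p\<close>.\<close>

lemma inj_v_gen: "inj (v_gen :: 's::left_cancellative_monoid \<Rightarrow> 's sstar)"
proof (rule injI)
  fix p q :: 's assume "v_gen p = v_gen q"
  then have "S_isometry p \<bullet>\<^sub>B delta 1 = S_isometry q \<bullet>\<^sub>B delta 1" by (simp flip: w_rep_v)
  then show "p = q" by (simp add: S_isometry_delta)
qed

text \<open>Decides when \<open>delta (v_gen s)\<close> lies in the domain of the adjoint of
  \<open>v_gen p\<close> in the left regular representation. Again the nontrivial direction is read
  off from the action on \<open>delta 1\<close> in l2(S).\<close>

lemma v_gen_range_projection:
  "v_gen p * (v_gen p)\<^sup>\<star> * v_gen s = v_gen s \<longleftrightarrow> s \<in> range ((*) p)"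
proof
  assume "v_gen p * (v_gen p)\<^sup>\<star> * v_gen s = v_gen s"
  then have "w_rep (sstar_to_W (v_gen p * (v_gen p)\<^sup>\<star> * v_gen s)) \<bullet>\<^sub>B delta 1 =
      w_rep (sstar_to_W (v_gen s)) \<bullet>\<^sub>B delta 1" by simp
  then have "S_isometry p \<bullet>\<^sub>B ((S_isometry p)\<^sup>\<star> \<bullet>\<^sub>B delta s) = delta s"
    by (simp add: sstar_to_W_mult sstar_to_W_invol w_rep_mult w_rep_invol w_rep_v S_isometry_delta)
  then show "s \<in> range ((*) p)"
    using S_isometry_invol_delta(2)[of s p] delta_nonzero[of s] by (metis bop_zero)
next
  assume "s \<in> range ((*) p)"
  then obtain t where "s = p * t" by blast
  then show "v_gen p * (v_gen p)\<^sup>\<star> * v_gen s = v_gen s"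
    using isg_regular[of "v_gen p"] by (simp add: mult.assoc[symmetric] flip: v_mult)
qed

text \<open>The critical case is the adjoint of \<open>v_gen p\<close>: at
  \<open>delta (v_gen s)\<close> both sides are nonzero exactly for s in p S, by
  \<open>v_gen_range_projection\<close>, and then s = p t is sent to t.\<close>

lemma left_regular_embed:
  "left_regular x \<bullet>\<^sub>B ell2_embed v_gen \<xi> = ell2_embed v_gen (w_rep (sstar_to_W x) \<bullet>\<^sub>B \<xi>)"
proof (induction x arbitrary: \<xi> rule: sstar_induct)
  case one
  have "left_regular (1 :: 'a sstar) = 1"
  proof (rule bop_eq_on_basis)
    have "(1 :: 'a sstar)\<^sup>\<star> = 1" by (metis isg_invol_invol isg_invol_mult mult_1_left mult_1_right)
    then show "left_regular 1 \<bullet>\<^sub>B delta t = 1 \<bullet>\<^sub>B delta t" for t :: "'a sstar"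
      by (simp add: left_regular_delta)
  qed
  then show ?case by (simp add: sstar_to_W_one w_rep_one)
next
  case (gen p x)
  have "left_regular (v_gen p) \<bullet>\<^sub>B ell2_embed v_gen \<xi> = ell2_embed v_gen (S_isometry p \<bullet>\<^sub>B \<xi>)" for \<xi>
    by (rule intertwine_on_basis[OF inj_v_gen])
      (simp add: left_regular_delta v_isometry S_isometry_delta ell2_embed_delta[OF inj_v_gen] v_mult)
  with gen show ?case by (simp add: left_regular_mult sstar_to_W_mult w_rep_mult w_rep_v)
next
  case (star p x)
  have "left_regular ((v_gen p)\<^sup>\<star>) \<bullet>\<^sub>B ell2_embed v_gen \<xi> = ell2_embed v_gen ((S_isometry p)\<^sup>\<star> \<bullet>\<^sub>B \<xi>)" for \<xi>
  proof (rule intertwine_on_basis[OF inj_v_gen])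
    fix s
    show "left_regular ((v_gen p)\<^sup>\<star>) \<bullet>\<^sub>B delta (v_gen s) = ell2_embed v_gen ((S_isometry p)\<^sup>\<star> \<bullet>\<^sub>B delta s)"
    proof (cases "s \<in> range ((*) p)")
      case True
      then obtain t where s: "s = p * t" by blast
      have "(v_gen p)\<^sup>\<star> * v_gen s = v_gen t"
        by (simp add: s v_isometry flip: v_mult mult.assoc)
      with True show ?thesis
        by (simp add: left_regular_delta isg_invol_invol v_gen_range_projection)
          (simp add: s S_isometry_invol_delta ell2_embed_delta[OF inj_v_gen])
    next
      case False
      then show ?thesis
        by (simp add: left_regular_delta isg_invol_invol v_gen_range_projection S_isometry_invol_delta(2) embed_simps)
    qed
  qed
  with star show ?case
    by (simp add: left_regular_mult sstar_to_W_mult w_rep_mult sstar_to_W_invol w_rep_invol w_rep_v)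
qed

lemma left_regular0_restrict:
  "leaves_invariant v_gen (left_regular0 x)" "compress v_gen (left_regular0 x) = w_rep (sstar0_to_W x)"
proof -
  have "left_regular0 x \<bullet>\<^sub>B ell2_embed v_gen \<xi> = ell2_embed v_gen (w_rep (sstar0_to_W x) \<bullet>\<^sub>B \<xi>)" for \<xi>
    by (cases x) (simp_all add: left_regular_embed w_rep_empty embed_simps)
  from leaves_invariantI[OF inj_v_gen this]
  show "leaves_invariant v_gen (left_regular0 x)" "compress v_gen (left_regular0 x) = w_rep (sstar0_to_W x)" .
qed

text \<open>The range of \<open>w_rep\<close> contains the projections of all constructible ideals
  as well. They lie in the algebra generated by the isometries because \<open>sstar0_to_W\<close> is
  onto and sends the adjoined zero to an element acting as 0.\<close>

lemma Cstar_r_S_eq: "Cstar_r_S = closure (lspan (range w_rep))"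
  unfolding Cstar_r_S_def
proof (rule cstar_generated_eq_closure_lspan[OF star_rep_range[OF star_rep_w_rep]])
  let ?A = "cstar_generated (range S_isometry) :: 'a bop set"
  have A: "cstar_subalgebra ?A" by (rule cstar_subalgebra_generated)
  have gen: "S_isometry p \<in> ?A" for p unfolding cstar_generated_def by blast
  have "S_isometry 1 = (1 :: 'a bop)" by (rule bop_eq_on_basis) (simp add: S_isometry_delta)
  with gen[of 1] have one: "1 \<in> ?A" by simp
  have elt: "w_rep (sstar_to_W x) \<in> ?A" for x
  proof (induction x rule: sstar_induct)
    case one
    show ?case using \<open>1 \<in> ?A\<close> by (simp add: sstar_to_W_one w_rep_one)
  next
    case (gen p x)
    then show ?case using A \<open>\<And>p. S_isometry p \<in> ?A\<close>
      by (auto simp: sstar_to_W_mult w_rep_mult w_rep_v cstar_subalgebra_def)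
  next
    case (star p x)
    then show ?case using A \<open>\<And>p. S_isometry p \<in> ?A\<close>
      by (auto simp: sstar_to_W_mult w_rep_mult sstar_to_W_invol w_rep_invol w_rep_v cstar_subalgebra_def)
  qed
  have "w_rep (sstar0_to_W x) \<in> ?A" for x
    using elt A by (cases x) (auto simp: w_rep_empty cstar_subalgebra_def)
  then show "range w_rep \<subseteq> ?A" using surj_sstar0_to_W by (metis image_subsetI surjD)
  show "range S_isometry \<subseteq> range w_rep" by (metis image_subsetI rangeI w_rep_w_gen)
qed

section \<open>Room for S* inside l2('h), and assembly of the diagram\<close>

lemma ex_inj_letter_list: "\<exists>f :: 's letter list \<Rightarrow> 's \<times> nat. inj f"
proof -
  \<comment> \<open>The factor \<open>nat\<close> makes the set infinite even for finite S, so it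
    can be paired with itself.\<close>
  let ?A = "UNIV :: ('s \<times> nat) set"
  have "infinite ?A" by (simp add: finite_prod)
  then have "\<exists>g. bij_betw g (?A \<times> ?A) ?A"
    using card_of_Times_same_infinite card_of_ordIso by blast
  then obtain g where "bij_betw g (?A \<times> ?A) ?A" by blast
  then have "inj g" by (simp add: bij_betw_def)
  then have g: "g p = g q \<longleftrightarrow> p = q" for p q by (rule inj_eq)
  define c where "c l = (case l of Gen s \<Rightarrow> (s, 0 :: nat) | GenStar s \<Rightarrow> (s, 1))" for l :: "'s letter"
  have c: "c l = c m \<longleftrightarrow> l = m" for l m by (cases l; cases m) (auto simp: c_def)
  \<comment> \<open>Iterated pairing separates words of equal length only; the final code therefore
    records the length too.\<close>
  define e where "e u = foldr (\<lambda>l r. g (c l, r)) u (undefined, 0)" for u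
  have e: "u = v" if "length u = length v" "e u = e v" for u v
    using that by (induction u v rule: list_induct2) (auto simp: e_def g c)
  have "inj (\<lambda>u. g ((undefined, length u), e u))"
    by (rule injI) (auto simp: g e)
  then show ?thesis by blast
qed

lemma ex_inj_sstar_adjoin0: "\<exists>f :: 's::left_cancellative_monoid sstar adjoin0 \<Rightarrow> 's \<times> nat. inj f"
proof -
  obtain f :: "'s letter list \<Rightarrow> 's \<times> nat" where f: "inj f" using ex_inj_letter_list by blast
  \<comment> \<open>The leading letter separates representatives of nonzero elements from the empty
    word, which encodes the zero.\<close>
  define h :: "'s sstar adjoin0 \<Rightarrow> 's letter list"
    where "h x = (case x of Zero0 \<Rightarrow> [] | Elt y \<Rightarrow> Gen 1 # rep_sstar y)" for x
  have "inj h"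
  proof (rule injI)
    fix x y assume "h x = h y"
    then show "x = y"
      by (cases x; cases y) (auto simp: h_def dest: arg_cong[where f=abs_sstar] simp: Quotient_abs_rep[OF Quotient_sstar])
  qed
  with f have "inj (f \<circ> h)" by (intro inj_compose)
  then show ?thesis by blast
qed

text \<open>The injection makes 'h infinite and at least as large as S* with its zero, and hence as
  the quotient W. By the cardinality remark at the definition of representations, the norms of both
  full algebras are then the suprema over all *-representations.\<close>

theorem theorem5p7:
  fixes j :: "'s::left_cancellative_monoid \<times> nat \<Rightarrow> 'h"
  assumes "inj j"
  shows "\<exists>(\<phi> :: ('s sstar adjoin0, 'h) full \<Rightarrow> ('s winv, 'h) full)
          (\<rho> :: 's sstar bop \<Rightarrow> 's bop)
          (\<Lambda> :: ('s sstar adjoin0, 'h) full \<Rightarrow> 's sstar bop)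
          (\<Lambda>\<^sub>S :: ('s winv, 'h) full \<Rightarrow> 's bop).
      (\<forall>x. \<phi> (full_gen x) = full_gen (sstar0_to_W x)) \<and>
      (\<forall>T\<in>Cstar_r_sstar. \<forall>\<xi>. T \<bullet>\<^sub>B ell2_embed v_gen \<xi> = ell2_embed v_gen (\<rho> T \<bullet>\<^sub>B \<xi>)) \<and>
      (\<forall>x. \<Lambda> (full_gen (Elt x)) = left_regular x) \<and>
      (\<forall>s. \<Lambda>\<^sub>S (full_gen (w_gen s)) = S_isometry s) \<and>
      short_exact ideal_J Cstar_sstar Cstar_S \<phi> \<and>
      short_exact ideal_J_r Cstar_r_sstar Cstar_r_S \<rho> \<and>
      star_hom Cstar_sstar Cstar_r_sstar \<Lambda> \<and> \<Lambda> ` Cstar_sstar = Cstar_r_sstar \<and>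
      star_hom Cstar_S Cstar_r_S \<Lambda>\<^sub>S \<and> \<Lambda>\<^sub>S ` Cstar_S = Cstar_r_S \<and>
      (\<forall>a\<in>Cstar_sstar. \<rho> (\<Lambda> a) = \<Lambda>\<^sub>S (\<phi> a))"
proof -
  obtain f :: "'s sstar adjoin0 \<Rightarrow> 's \<times> nat" where f: "inj f" using ex_inj_sstar_adjoin0 by blast
  have i0: "inj (j \<circ> f)" by (intro inj_compose assms f)
  define i1 where "i1 = (\<lambda>x. j (f (Elt x)))"
  have i1: "inj i1"
    using i0 unfolding i1_def by (auto simp: inj_def)
  define i2 where "i2 = (\<lambda>s. j (s, 0))"
  have i2: "inj i2" using assms unfolding i2_def by (auto simp: inj_def)
  let ?\<phi> = "W.quotient_hom :: ('s sstar adjoin0, 'h) full \<Rightarrow> ('s winv, 'h) full"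
  let ?\<rho> = "compress v_gen :: 's sstar bop \<Rightarrow> 's bop"
  let ?\<Lambda> = "rep_hom i1 left_regular0 :: ('s sstar adjoin0, 'h) full \<Rightarrow> 's sstar bop"
  let ?\<Lambda>S = "rep_hom i2 w_rep :: ('s winv, 'h) full \<Rightarrow> 's bop"
  note \<Lambda> = rep_hom[OF i1 star_rep_left_regular0]
  note \<Lambda>S = rep_hom[OF i2 star_rep_w_rep]
  have r: "Cstar_r_sstar = closure (lspan (range (left_regular0 :: 's sstar adjoin0 \<Rightarrow> _)))"
    unfolding Cstar_r_sstar_def by (rule reduced_cstar_eq)
  have r_sub: "cstar_subalgebra (Cstar_r_sstar :: 's sstar bop set)"
    unfolding Cstar_r_sstar_def reduced_cstar_def by (rule cstar_subalgebra_generated)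
  have inv: "leaves_invariant v_gen T" if "T \<in> Cstar_r_sstar" for T :: "'s sstar bop"
    using that unfolding r
    by (rule leaves_invariant_closure_lspan[OF inj_v_gen]) (auto simp: left_regular0_restrict)
  have \<rho>_hom: "star_hom Cstar_r_sstar UNIV ?\<rho>"
    by (simp add: star_hom_def compress_simps[OF inj_v_gen] compress_mult[OF inj_v_gen inv])
  have \<rho>_image: "?\<rho> ` Cstar_r_sstar = Cstar_r_S"
  proof -
    have "?\<rho> ` range left_regular0 = w_rep ` range sstar0_to_W"
      by (simp add: image_image left_regular0_restrict)
    then have "?\<rho> ` range left_regular0 = range w_rep" by (simp only: surj_sstar0_to_W)
    then show ?thesis
      using star_hom_image_closure_lspan[OF shrinkable_bop r_sub \<rho>_hom compress_simps(6)[OF inj_v_gen] r]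
      by (simp add: Cstar_r_S_eq)
  qed
  have J_r: "{T \<in> Cstar_r_sstar. ?\<rho> T = 0} = ideal_J_r"
  proof -
    have "?\<rho> T = 0 \<longleftrightarrow> (\<forall>\<xi>. T \<bullet>\<^sub>B ell2_embed v_gen \<xi> = 0)" if "T \<in> Cstar_r_sstar" for T :: "'s sstar bop"
    proof -
      have "T \<bullet>\<^sub>B ell2_embed v_gen \<xi> = 0 \<longleftrightarrow> ?\<rho> T \<bullet>\<^sub>B \<xi> = 0" for \<xi>
        using inv[OF that] embed_inject[OF inj_v_gen, of "?\<rho> T \<bullet>\<^sub>B \<xi>" 0]
        by (simp add: leaves_invariant_def embed_simps)
      moreover have "?\<rho> T = 0 \<longleftrightarrow> (\<forall>\<xi>. ?\<rho> T \<bullet>\<^sub>B \<xi> = 0)" using bop_eqI[of "?\<rho> T" 0] by auto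
      ultimately show ?thesis by simp
    qed
    then show ?thesis unfolding ideal_J_r_def by blast
  qed
  have \<rho>_exact: "short_exact ideal_J_r Cstar_r_sstar Cstar_r_S ?\<rho>"
    using closed_ideal_kernel[OF r_sub \<rho>_hom compress_bounded_linear[OF inj_v_gen]] r_sub \<rho>_hom \<rho>_image
    by (auto simp: short_exact_def J_r star_hom_def Cstar_r_S_def cstar_subalgebra_generated)
  have \<phi>_exact: "short_exact ideal_J Cstar_sstar Cstar_S ?\<phi>"
  proof -
    have unit: "Elt 1 * x = x" "x * Elt 1 = x" for x :: "'s sstar adjoin0" by (cases x; simp)+
    show ?thesis
      using W.quotient_exact[OF i0 unit]
      unfolding ideal_J_def Cstar_sstar_def Cstar_S_def approx_R5_def .
  qed
  have \<Lambda>_image: "?\<Lambda> ` Cstar_sstar = Cstar_r_sstar"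
    unfolding Cstar_sstar_def r by (rule \<Lambda>(4))
  have \<Lambda>S_image: "?\<Lambda>S ` Cstar_S = Cstar_r_S"
    unfolding Cstar_S_def Cstar_r_S_eq by (rule \<Lambda>S(4))
  \<comment> \<open>Both composites send \<open>full_gen x\<close> to
    \<open>w_rep (sstar0_to_W x)\<close>, by \<open>left_regular0_restrict\<close>; linearity and
    continuity do the rest.\<close>
  have commute: "?\<rho> (?\<Lambda> a) = ?\<Lambda>S (?\<phi> a)" if "a \<in> Cstar_sstar" for a
    using that unfolding Cstar_sstar_def full_cstar_eq
  proof (rule closure_lspan_induct)
    have l: "bounded_linear (\<lambda>a. ?\<rho> (?\<Lambda> a))"
      by (rule bounded_linear_compose[OF compress_bounded_linear[OF inj_v_gen] \<Lambda>(5)])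
    have r: "bounded_linear (\<lambda>a. ?\<Lambda>S (?\<phi> a))"
      by (rule bounded_linear_compose[OF \<Lambda>S(5) W.quotient_hom(5)])
    show "closed {a. ?\<rho> (?\<Lambda> a) = ?\<Lambda>S (?\<phi> a)}"
      using l r by (intro closed_Collect_eq) (auto intro: linear_continuous_on)
    show "?\<rho> (?\<Lambda> 0) = ?\<Lambda>S (?\<phi> 0)"
      using linear_0[OF bounded_linear.linear[OF l]] linear_0[OF bounded_linear.linear[OF r]] by simp
    show "?\<rho> (?\<Lambda> (a + b)) = ?\<Lambda>S (?\<phi> (a + b))"
      if "?\<rho> (?\<Lambda> a) = ?\<Lambda>S (?\<phi> a)" "?\<rho> (?\<Lambda> b) = ?\<Lambda>S (?\<phi> b)" for a b
      using that linear_add[OF bounded_linear.linear[OF l]] linear_add[OF bounded_linear.linear[OF r]] by simp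
    show "?\<rho> (?\<Lambda> g) = ?\<Lambda>S (?\<phi> g)" if "g \<in> range full_gen" for g
      using that by (auto simp: \<Lambda>(1) \<Lambda>S(1) W.quotient_hom(1) left_regular0_restrict)
    show "?\<rho> (?\<Lambda> (c *\<^sub>C a)) = ?\<Lambda>S (?\<phi> (c *\<^sub>C a))" if "?\<rho> (?\<Lambda> a) = ?\<Lambda>S (?\<phi> a)" for c a
      using that by (simp add: \<Lambda>(6) \<Lambda>S(6) W.quotient_hom(6) compress_simps[OF inj_v_gen])
  qed
  show ?thesis
  proof (rule exI[of _ ?\<phi>], rule exI[of _ ?\<rho>], rule exI[of _ ?\<Lambda>], rule exI[of _ ?\<Lambda>S], intro conjI ballI allI)
    show "?\<Lambda> (full_gen (Elt x)) = left_regular x" for x by (simp add: \<Lambda>(1))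
    show "?\<Lambda>S (full_gen (w_gen s)) = S_isometry s" for s by (simp add: \<Lambda>S(1) w_rep_w_gen)
    show "T \<bullet>\<^sub>B ell2_embed v_gen \<xi> = ell2_embed v_gen (?\<rho> T \<bullet>\<^sub>B \<xi>)" if "T \<in> Cstar_r_sstar" for T \<xi>
      using inv[OF that] by (simp add: leaves_invariant_def)
    show "star_hom Cstar_sstar Cstar_r_sstar ?\<Lambda>"
      using \<Lambda>(2) \<Lambda>_image by (auto simp: star_hom_def Cstar_sstar_def)
    show "star_hom Cstar_S Cstar_r_S ?\<Lambda>S"
      using \<Lambda>S(2) \<Lambda>S_image by (auto simp: star_hom_def Cstar_S_def)
  qed (fact W.quotient_hom(1) \<phi>_exact \<rho>_exact \<Lambda>_image \<Lambda>S_image commute)+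
qed

end
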